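(* Let $n\ge1$ be an integer, let $X\in\mathrm{Proj}_{\mathbb{F}}(1,2n)$ and $\delta>0$ be fixed, let $D\in\mathbb{R}$, and fix $0<\tau<1$. Let $m$ be a positive integer with $$m\ge\frac{14}{3}(\mu_1-\mu_2)^{-2}\delta^{-2}\bigl(\log(4n)+D\bigr),$$ and let $\mathcal{P}=\{P_j\}_{j=1}^m$ be an independent sequence of uniformly distributed projections in $\mathrm{Proj}_{\mathbb{F}}(n,2n)$. Then with probability at least $1-\exp(-D)$, for all $\tilde\Phi_{\mathcal{P}}(X)\in\{0,1\}^m$ such that $$d_H(\Phi_{\mathcal{P}}(X),\tilde\Phi_{\mathcal{P}}(X))\le\tau,$$ we have $$\|\tilde X-X\|\le\delta+2(\mu_1-\mu_2)^{-1}\tau,$$ where $\tilde X$ denotes the solution to the Principal Eigenspace Program (PEP) with input $\tilde\Phi_{\mathcal{P}}(X)$.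
   Context: $\mathbb{F}$ is either $\mathbb{R}$ or $\mathbb{C}$; $\beta=\frac12$ if $\mathbb{F}=\mathbb{R}$ and $\beta=1$ if $\mathbb{F}=\mathbb{C}$. $\mathrm{Proj}_{\mathbb{F}}(k,d)$ is the set of rank-$k$ orthogonal projections on $\mathbb{F}^d$; its uniform distribution is the unique probability measure invariant under conjugation by all orthogonal ($\mathbb{F}=\mathbb{R}$) or unitary ($\mathbb{F}=\mathbb{C}$) $d\times d$ matrices. $\|\cdot\|$ on matrices is the operator norm. $d_H$ is the normalized Hamming distance on $\{0,1\}^m$, i.e. the number of differing entries divided by $m$. The constants are $$\mu_1=\frac12+\frac{1}{\beta n\,4^{\beta n}B(\beta n,\beta n)},\qquad \mu_2=\frac12-\frac{1}{\beta n(2n-1)4^{\beta n}B(\beta n,\beta n)},$$ where $B(a,b)=\int_0^1 t^{a-1}(1-t)^{b-1}\,dt$ is the Beta function. For $P\in\mathrm{Proj}_{\mathbb{F}}(n,2n)$ and $X\in\mathrm{Proj}_{\mathbb{F}}(1,2n)$, $\phi_P(X)=1$ if $\mathrm{tr}(PX)\ge\frac12$ and $\phi_P(X)=0$ otherwise. For $\mathcal{P}=\{P_j\}_{j=1}^m$, the binary measurement map is $\Phi_{\mathcal{P}}(X)=(\phi_{P_j}(X))_{j=1}^m\in\{0,1\}^m$. (PEP) with input $b\in\{0,1\}^m$: put $Q_b=\frac1m\sum_{j=1}^m R_j$, where $R_j=P_j$ if $b_j=1$ and $R_j=I-P_j$ if $b_j=0$, and maximize $\mathrm{tr}(Q_bY)$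 over positive semidefinite $Y\in\mathbb{F}^{2n\times 2n}$ with $\mathrm{tr}(Y)\le1$. The solution is taken to be a rank-one orthogonal projection onto a line in the eigenspace of the largest eigenvalue of $Q_b$; when that eigenvalue is simple (which happens with probability 1 in this random model) it is the unique solution, namely the orthogonal projection onto that eigenspace. *)

theory Defs
  imports "HOL-Probability.Probability"
begin

section \<open>The scalar field\<close>

text \<open>
  The class has exactly two members up to isomorphism, the real and the complex numbers
  (with their usual absolute value and conjugation): see the two instances below and
  the lemma \<open>real_or_complex_dichotomy\<close>.
\<close>

class real_or_complex = real_normed_field + euclidean_space +
  fixes fconj :: "'a \<Rightarrow> 'a"
  assumes fconj_add: "fconj (x + y) = fconj x + fconj y"
    and fconj_mult: "fconj (x * y) = fconj x * fconj y"
    and mult_fconj_scaleR: "x * fconj x = (norm x)\<^sup>2 *\<^sub>R 1"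

instantiation real :: real_or_complex
begin
definition fconj_real :: "real \<Rightarrow> real" where "fconj_real x = x"
instance by standard (simp_all add: fconj_real_def power2_eq_square)
end

instantiation complex :: real_or_complex
begin
definition fconj_complex :: "complex \<Rightarrow> complex" where "fconj_complex = cnj"
instance by standard (simp_all add: fconj_complex_def complex_norm_square[symmetric] scaleR_conv_of_real)
end

lemma mult_fconj: "x * fconj x = of_real ((norm (x::'f::real_or_complex))\<^sup>2)"
  by (simp only: mult_fconj_scaleR of_real_def)

definition re_part :: "'f::real_or_complex \<Rightarrow> real" where
  "re_part x = x \<bullet> 1"

lemma re_part_real: "re_part (x::real) = x"
  by (simp add: re_part_def)

lemma re_part_complex: "re_part z = Re z"
  by (simp add: re_part_def inner_complex_def)

lemma fconj_1: "fconj (1::'f::real_or_complex) = 1"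
  using mult_fconj[of "1::'f"] by simp

lemma fconj_0: "fconj (0::'f::real_or_complex) = 0"
  using fconj_add[of "0::'f" 0] by simp

lemma of_real_re_part:
  "of_real (re_part x) = (x + fconj x) / (2::'f::real_or_complex)"
proof -
  have "(norm (x + 1))\<^sup>2 = (norm x)\<^sup>2 + 2 * re_part x + 1"
    using dot_norm[of x 1] by (simp add: re_part_def)
  then have "(x + 1) * fconj (x + 1) = of_real ((norm x)\<^sup>2 + 2 * re_part x + 1)"
    by (simp only: mult_fconj)
  also have "\<dots> = x * fconj x + 2 * of_real (re_part x) + 1"
    by (simp add: mult_fconj)
  finally show ?thesis
    by (simp add: fconj_add fconj_1 algebra_simps)
qed

lemma fconj_of_real: "fconj (of_real r) = (of_real r :: 'f::real_or_complex)"
proof (cases "r = 0")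
  case True then show ?thesis by (simp add: fconj_0)
next
  case False
  then show ?thesis using mult_fconj[of "of_real r :: 'f"] by (simp add: power2_eq_square)
qed

lemma real_or_complex_dichotomy:
  "(DIM('f::real_or_complex) = 1 \<and> (\<forall>x::'f. \<exists>a. x = of_real a)) \<or>
   (DIM('f) = 2 \<and> (\<exists>i::'f. i * i = -1 \<and> fconj i = - i \<and>
      (\<forall>x. \<exists>a b. x = of_real a + of_real b * i)))"
proof (cases "\<forall>x::'f. \<exists>a. x = of_real a")
  case True
  then have "span {1::'f} = UNIV"
    by (auto simp: span_singleton of_real_def)
  then have "dim (UNIV :: 'f set) = card {1::'f}"
    by (intro dim_eq_card) (simp_all add: independent_insert)
  then show ?thesis using True by simp
next
  case False
  then obtain x :: 'f where x: "\<And>a. x \<noteq> of_real a" by blast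
  define im where "im = (\<lambda>x::'f. x - of_real (re_part x))"
  have skew: "fconj (im z) = - im z" for z
  proof -
    have "im z + of_real (re_part z) = z" by (simp add: im_def)
    then have "fconj z = fconj (im z) + of_real (re_part z)"
      using fconj_add[of "im z" "of_real (re_part z)"] by (simp only: fconj_of_real)
    moreover have "2 * of_real (re_part z) = z + fconj z"
      by (simp add: of_real_re_part)
    ultimately show ?thesis
      using \<open>im z + of_real (re_part z) = z\<close> by algebra
  qed
  have y0: "im x \<noteq> 0" using x[of "re_part x"] by (simp add: im_def)
  define i where "i = im x / of_real (norm (im x))"
  have ii: "i * i = -1"
  proof -
    have "- (im x * im x) = of_real ((norm (im x))\<^sup>2)"
      using mult_fconj[of "im x"] skew[of x] by simp
    then have "im x * im x = - of_real ((norm (im x))\<^sup>2)"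
      by (metis minus_minus)
    then show ?thesis using y0 by (simp add: i_def power2_eq_square)
  qed
  then have i0: "i \<noteq> 0" by auto
  have ci: "fconj i = - i"
  proof -
    have "of_real (norm (im x)) * fconj i = - im x"
      using fconj_mult[of "of_real (norm (im x))" i] skew[of x] y0
      by (simp add: fconj_of_real i_def)
    then show ?thesis using y0 by (simp add: i_def field_simps)
  qed
  have dec: "\<exists>a b. z = of_real a + of_real b * i" for z
  proof -
    define w where "w = im z / i"
    have "im z = w * i" using i0 by (simp add: w_def)
    then have "fconj w * - i = - (w * i)"
      using skew[of z] fconj_mult[of w i] ci by simp
    then have "fconj w = w" using i0 by simp
    then have "w = of_real (re_part w)" using of_real_re_part[of w] by simp
    then have "z = of_real (re_part z) + of_real (re_part w) * i"
      using \<open>im z = w * i\<close> by (simp add: im_def algebra_simps)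
    then show ?thesis by blast
  qed
  have "z \<in> span {1, i}" for z
  proof -
    obtain a b where "z = of_real a + of_real b * i" using dec by blast
    then have "z = a *\<^sub>R 1 + b *\<^sub>R i" by (simp add: scaleR_conv_of_real)
    then show ?thesis by (simp add: span_add span_base span_scale)
  qed
  then have "span {1, i} = UNIV" by blast
  moreover have ni: "i \<noteq> a *\<^sub>R 1" for a
  proof
    assume a: "i = a *\<^sub>R 1"
    then have "of_real (a * a) = (of_real (-1) :: 'f)"
      using ii by (simp add: scaleR_conv_of_real)
    then have "a * a = -1" using of_real_eq_iff by blast
    then show False using zero_le_square[of a] by linarith
  qed
  then have "i \<notin> span {1}" by (auto simp: span_singleton)
  then have "independent {i, 1}" by (simp add: independent_insert)
  ultimately have "dim (UNIV :: 'f set) = card {i, 1}"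
    by (intro dim_eq_card) (simp_all add: insert_commute)
  moreover have "i \<noteq> 1" using ni[of 1] by simp
  ultimately have "dim (UNIV :: 'f set) = 2" by simp
  then have "DIM('f) = 2" by simp
  then show ?thesis using ii ci dec by blast
qed

definition field_beta :: "'f::real_or_complex itself \<Rightarrow> real" where
  "field_beta _ = real DIM('f) / 2"

lemma field_beta_real: "field_beta TYPE(real) = 1/2"
  by (simp add: field_beta_def)

lemma field_beta_complex: "field_beta TYPE(complex) = 1"
  by (simp add: field_beta_def)


section \<open>Matrices\<close>

definition adjoint_mat :: "'f::real_or_complex^'d^'d \<Rightarrow> 'f^'d^'d" where
  "adjoint_mat A = (\<chi> i j. fconj (A $ j $ i))"

definition unitary_mat :: "'f::real_or_complex^'d^'d \<Rightarrow> bool" where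
  "unitary_mat U \<longleftrightarrow> adjoint_mat U ** U = mat 1 \<and> U ** adjoint_mat U = mat 1"

definition op_norm :: "'f::real_or_complex^'d^'d \<Rightarrow> real" where
  "op_norm A = onorm (\<lambda>v. A *v v)"

text \<open>
  All traces taken below are traces of products of two Hermitian matrices, hence real;
  \<^term>\<open>re_part\<close> only changes the type.
\<close>

definition rtrace :: "'f::real_or_complex^'d^'d \<Rightarrow> real" where
  "rtrace A = re_part (trace A)"

text \<open>
  The inner product of \<^term>\<open>v\<close> and \<^term>\<open>A *v v\<close> is the real part of the Hermitian form
  of \<^term>\<open>A\<close>, which is real-valued for Hermitian \<^term>\<open>A\<close>.
\<close>

definition psd :: "'f::real_or_complex^'d^'d \<Rightarrow> bool" where
  "psd A \<longleftrightarrow> adjoint_mat A = A \<and> (\<forall>v. 0 \<le> v \<bullet> (A *v v))"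

text \<open>Only used for Hermitian matrices, all of whose eigenvalues are real.\<close>

definition is_eigenvalue :: "'f::real_or_complex^'d^'d \<Rightarrow> real \<Rightarrow> bool" where
  "is_eigenvalue A l \<longleftrightarrow> (\<exists>v. v \<noteq> 0 \<and> A *v v = l *\<^sub>R v)"

definition is_largest_eigenvalue :: "'f::real_or_complex^'d^'d \<Rightarrow> real \<Rightarrow> bool" where
  "is_largest_eigenvalue A l \<longleftrightarrow> is_eigenvalue A l \<and> (\<forall>l'. is_eigenvalue A l' \<longrightarrow> l' \<le> l)"

definition Proj :: "nat \<Rightarrow> ('f::real_or_complex^'d^'d) set" where
  "Proj k = {P. adjoint_mat P = P \<and> P ** P = P \<and> rank P = k}"

definition proj_space :: "nat \<Rightarrow> ('f::real_or_complex^'d^'d) measure" where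
  "proj_space k = restrict_space borel (Proj k)"

definition uniform_on_Proj :: "nat \<Rightarrow> ('f::real_or_complex^'d^'d) measure \<Rightarrow> bool" where
  "uniform_on_Proj k N \<longleftrightarrow>
     prob_space N \<and> sets N = sets (proj_space k) \<and>
     (\<forall>U. unitary_mat U \<longrightarrow>
        distr N (proj_space k) (\<lambda>A. U ** A ** adjoint_mat U) = N)"


section \<open>Binary measurements\<close>

definition bitstrings :: "nat \<Rightarrow> (nat \<Rightarrow> nat) set" where
  "bitstrings m = {1..m} \<rightarrow>\<^sub>E {0, 1}"

definition hamming_dist :: "nat \<Rightarrow> (nat \<Rightarrow> nat) \<Rightarrow> (nat \<Rightarrow> nat) \<Rightarrow> real" where
  "hamming_dist m b c = real (card {j \<in> {1..m}. b j \<noteq> c j}) / real m"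

definition bin_question :: "'f::real_or_complex^'d^'d \<Rightarrow> 'f^'d^'d \<Rightarrow> nat" where
  "bin_question P X = (if 1/2 \<le> rtrace (P ** X) then 1 else 0)"

definition bin_measurement ::
    "nat \<Rightarrow> (nat \<Rightarrow> 'f::real_or_complex^'d^'d) \<Rightarrow> 'f^'d^'d \<Rightarrow> nat \<Rightarrow> nat" where
  "bin_measurement m P X = (\<lambda>j\<in>{1..m}. bin_question (P j) X)"

definition mu1 :: "real \<Rightarrow> nat \<Rightarrow> real" where
  "mu1 \<beta> n = 1/2 + 1 / (\<beta> * n * 4 powr (\<beta> * n) * Beta (\<beta> * n) (\<beta> * n))"

definition mu2 :: "real \<Rightarrow> nat \<Rightarrow> real" where
  "mu2 \<beta> n = 1/2 - 1 / (\<beta> * n * (2 * real n - 1) * 4 powr (\<beta> * n) * Beta (\<beta> * n) (\<beta> * n))"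


section \<open>The Principal Eigenspace Program\<close>

definition pep_matrix ::
    "nat \<Rightarrow> (nat \<Rightarrow> 'f::real_or_complex^'d^'d) \<Rightarrow> (nat \<Rightarrow> nat) \<Rightarrow> 'f^'d^'d" where
  "pep_matrix m P b =
     (1 / real m) *\<^sub>R (\<Sum>j=1..m. if b j = 1 then P j else mat 1 - P j)"

definition pep_maximizer :: "'f::real_or_complex^'d^'d \<Rightarrow> 'f^'d^'d \<Rightarrow> bool" where
  "pep_maximizer Q Y \<longleftrightarrow>
     is_arg_max (\<lambda>Y. rtrace (Q ** Y)) (\<lambda>Y. psd Y \<and> rtrace Y \<le> 1) Y"

text \<open>
  Among the maximizers, the solutions are the rank-one projections onto a line in the
  eigenspace of the largest eigenvalue. If that eigenvalue is not simple, there are several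
  solutions in this sense.
\<close>

definition pep_solution ::
    "nat \<Rightarrow> (nat \<Rightarrow> 'f::real_or_complex^'d^'d) \<Rightarrow> (nat \<Rightarrow> nat) \<Rightarrow> 'f^'d^'d \<Rightarrow> bool" where
  "pep_solution m P b Y \<longleftrightarrow>
     pep_maximizer (pep_matrix m P b) Y \<and> Y \<in> Proj 1 \<and>
     (\<exists>l. is_largest_eigenvalue (pep_matrix m P b) l \<and>
        range (\<lambda>v. Y *v v) \<subseteq> {v. pep_matrix m P b *v v = l *\<^sub>R v})"

end

theory Submission
  imports Defs
begin

text \<open>
  Write \<open>X = x x\<^sup>*\<close> and orient every random projection \<open>P\<^sub>j\<close> towards \<open>x\<close>: keep it if
  \<open>\<langle>x, P\<^sub>j x\<rangle> \<ge> 1/2\<close>, and replace it by \<open>I - P\<^sub>j\<close> otherwise. For uncorrupted measurements the matrix of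
  the program is the average of the oriented projections. By unitary invariance its mean is
  \<open>mu2 I + \<Delta> X\<close> with \<open>\<Delta> = mu1 - mu2 > 0\<close>, and \<open>x\<close> is the leading eigenvector of this mean. So the proof
  has three parts: the mean, the deviation from the mean, and the stability of the leading eigenvector.

  Stability (\<open>recovery_error\<close>). Suppose that the quadratic form of \<open>Q\<close> differs from that of \<open>mu2 I + \<Delta> X\<close> by
  at most \<open>e\<close> on unit vectors, and that \<open>Y = y y\<^sup>*\<close> is at least as good for \<open>Q\<close> as \<open>X\<close>. With
  \<open>s = \<parallel>Y - X\<parallel>\<close> the gap of the mean is \<open>\<Delta> s\<^sup>2\<close>, while the perturbation can contribute \<open>2 e s\<close> only. Hence
  \<open>s \<le> 2 e / \<Delta>\<close>. Corrupting a fraction \<open>\<tau>\<close> of the bits changes the form by at most \<open>\<tau>\<close>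
  (\<open>pep_matrix_flip\<close>). Therefore a deviation of at most \<open>\<delta> \<Delta> / 2\<close> from the mean is what the theorem needs.

  The mean (\<open>mean_oriented\<close>). Reflections that fix \<open>x\<close> reduce it to the two numbers at \<open>x\<close> and at
  the orthogonal vectors, and the trace determines the second from the first, which is
  \<open>1/2 + E |t - 1/2|\<close> with \<open>t = \<langle>x, P x\<rangle>\<close>. To compute it, observe that \<open>E \<langle>u, P u\<rangle>\<^sup>k\<close> is a multiple of
  \<open>|u|\<^sup>2\<^sup>k\<close> by invariance. Applying the Laplacian in \<open>u\<close> to this polynomial identity gives a recursion
  for the moments of \<open>t\<close> (\<open>moment_recursion\<close>), which is that of the Beta distribution with parameters
  \<open>\<beta> n\<close>, \<open>\<beta> n\<close>. By the Weierstrass approximation theorem the mean of \<open>|t - 1/2|\<close> is the one under the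
  Beta distribution, and that integral is elementary (\<open>mean_abs_deviation\<close>).

  The deviation (\<open>prob_quadratic_form_ge\<close>). This is a Hoeffding type bound for the sum \<open>S\<close> of the centred
  matrices \<open>Z\<^sub>j\<close>, each of which satisfies \<open>Z\<^sub>j\<^sup>2 \<le> c I\<close> with \<open>c = 7/12\<close> (\<open>norm_centered_le\<close>). In place of the
  matrix exponential it uses the trace of \<open>(I + \<theta> S / N)\<^sup>N\<close> with \<open>N\<close> a large power of two, which depends
  polynomially on the summands. Adding a summand \<open>B\<close> to a base \<open>M\<close>, the second derivative of
  \<open>tr (M + t B)\<^sup>N\<close> in \<open>t\<close> is at most a constant times the function itself; this rests on an inequality
  for the traces of \<open>B M\<^sup>i B M\<^sup>j\<close> (\<open>mixed_trace_le\<close>). The comparison with the hyperbolic cosine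
  (\<open>rtrace_mpow_step\<close>) leaves a term that is linear in \<open>B\<close> and has mean zero. So the expected trace
  grows by a factor of about \<open>cosh (\<theta> \<surd>c)\<close> per summand, and Markov's inequality in the limit of large \<open>N\<close> gives
  the tail \<open>2 n exp (- m \<epsilon>\<^sup>2 / (2 c))\<close> for a deviation of \<open>\<epsilon>\<close> upwards, and the same downwards. With
  \<open>\<epsilon> = \<delta> \<Delta> / 2\<close> the exponent is \<open>m \<delta>\<^sup>2 \<Delta>\<^sup>2 / (8 c)\<close>, and \<open>8 c = 14/3\<close>.
\<close>


section \<open>Hermitian linear algebra over the real or complex numbers\<close>

lemma fconj_fconj [simp]: "fconj (fconj x) = (x :: 'f::real_or_complex)"
proof (cases "fconj x = 0")
  case True
  then have "x * fconj x = 0" by simp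
  then have "x = 0" by (simp add: mult_fconj)
  then show ?thesis by (simp add: fconj_0)
next
  case False
  have n: "norm (fconj x) = norm x"
  proof (cases "x = 0")
    case True then show ?thesis by (simp add: fconj_0)
  next
    case False
    have "norm x * norm (fconj x) = (norm x)\<^sup>2"
      using arg_cong[OF mult_fconj[of x], of norm] by (simp add: norm_mult norm_power)
    then show ?thesis using False by (simp add: power2_eq_square)
  qed
  have "fconj x * fconj (fconj x) = fconj x * x"
    using mult_fconj[of x] mult_fconj[of "fconj x"] n by (simp add: mult.commute)
  then show ?thesis using False by simp
qed

lemma norm_fconj [simp]: "norm (fconj x) = norm (x :: 'f::real_or_complex)"
proof -
  have "of_real ((norm (fconj x))\<^sup>2) = (of_real ((norm x)\<^sup>2) :: 'f)"
    using mult_fconj[of x] mult_fconj[of "fconj x"] by (simp only: fconj_fconj mult.commute)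
  then show ?thesis using of_real_eq_iff by (metis norm_ge_zero power2_eq_imp_eq)
qed

lemma fconj_minus: "fconj (- x) = - fconj (x :: 'f::real_or_complex)"
  using fconj_add[of x "- x"] by (simp add: fconj_0 eq_neg_iff_add_eq_0 add.commute)

lemma fconj_diff: "fconj (x - y) = fconj x - fconj (y :: 'f::real_or_complex)"
  using fconj_add[of x "- y"] by (simp add: fconj_minus)

lemma fconj_sum: "fconj (sum f S) = (\<Sum>i\<in>S. fconj (f i :: 'f::real_or_complex))"
  by (induction S rule: infinite_finite_induct) (simp_all add: fconj_0 fconj_add)

lemma fconj_scaleR: "fconj (r *\<^sub>R x) = r *\<^sub>R fconj (x :: 'f::real_or_complex)"
  by (simp add: scaleR_conv_of_real fconj_mult fconj_of_real)

lemma re_part_simps [simp]: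
  "re_part (0 :: 'f::real_or_complex) = 0" "re_part (1 :: 'f) = 1"
  "re_part (x + y :: 'f) = re_part x + re_part y"
  "re_part (x - y :: 'f) = re_part x - re_part y"
  "re_part (- x :: 'f) = - re_part x"
  "re_part (r *\<^sub>R x :: 'f) = r * re_part x"
  "re_part (of_real r :: 'f) = r"
  by (simp_all add: re_part_def inner_add_left inner_diff_left of_real_def dot_square_norm)

lemma re_part_sum: "re_part (sum f S) = (\<Sum>i\<in>S. re_part (f i :: 'f::real_or_complex))"
  by (simp add: re_part_def inner_sum_left)

lemma inner_eq_re_part: "x \<bullet> y = re_part (fconj x * (y :: 'f::real_or_complex))"
proof -
  have "of_real ((norm (x + y))\<^sup>2) = (x + y) * fconj (x + y)"
    by (simp only: mult_fconj)
  also have "\<dots> = x * fconj x + y * fconj y + (fconj x * y + fconj (fconj x * y))"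
    by (simp add: fconj_add fconj_mult algebra_simps)
  also have "fconj x * y + fconj (fconj x * y) = of_real (2 * re_part (fconj x * y))"
    using of_real_re_part[of "fconj x * y"] by (simp add: field_simps)
  finally have "(norm (x + y))\<^sup>2 = (norm x)\<^sup>2 + (norm y)\<^sup>2 + 2 * re_part (fconj x * y)"
    by (simp only: mult_fconj flip: of_real_add) (simp only: of_real_eq_iff)
  then show ?thesis using dot_norm[of x y] by simp
qed

lemma inner_mult_left_fconj: "(a * x) \<bullet> y = x \<bullet> (fconj a * (y :: 'f::real_or_complex))"
  by (simp add: inner_eq_re_part fconj_mult mult_ac)

lemma inner_mult_right_fconj: "x \<bullet> (a * y) = (fconj a * x) \<bullet> (y :: 'f::real_or_complex)"
  by (simp add: inner_eq_re_part fconj_mult mult_ac)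

subsection \<open>The Hermitian inner product\<close>

definition hdot :: "'f::real_or_complex^'d \<Rightarrow> 'f^'d \<Rightarrow> 'f" where
  "hdot u v = (\<Sum>i\<in>UNIV. fconj (u $ i) * v $ i)"

lemma re_part_hdot: "re_part (hdot u v) = u \<bullet> v"
  by (simp add: hdot_def re_part_sum inner_vec_def inner_eq_re_part)

lemma fconj_hdot: "fconj (hdot u v) = hdot v u"
  by (simp add: hdot_def fconj_sum fconj_mult mult.commute)

lemma hdot_self: "hdot v v = of_real ((norm v)\<^sup>2)"
proof -
  have "hdot v v = (\<Sum>i\<in>UNIV. of_real ((norm (v $ i))\<^sup>2))"
    unfolding hdot_def by (intro sum.cong refl) (subst mult.commute, rule mult_fconj)
  then show ?thesis
    by (simp add: power2_norm_eq_inner inner_vec_def)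
qed

lemma hdot_linear:
  "hdot u (v + w) = hdot u v + hdot u w" "hdot u (v - w) = hdot u v - hdot u w"
  "hdot u (c *s v) = c * hdot u v" "hdot (u + w) v = hdot u v + hdot w v"
  "hdot (u - w) v = hdot u v - hdot w v" "hdot (c *s u) v = fconj c * hdot u v"
  "hdot u 0 = 0" "hdot 0 u = 0"
  by (auto simp: hdot_def sum_distrib_left fconj_add fconj_diff fconj_mult fconj_0 algebra_simps
      simp flip: sum.distrib sum_subtractf intro!: sum.cong)

lemma scaleR_eq_scalar: "r *\<^sub>R v = of_real r *s (v :: 'f::real_or_complex^'d)"
  unfolding vec_eq_iff vector_scaleR_component by (simp add: scaleR_conv_of_real)

lemma inner_scalar_left: "(c *s u) \<bullet> v = u \<bullet> (fconj c *s (v :: 'f::real_or_complex^'d))"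
  by (simp add: inner_vec_def inner_mult_left_fconj)

lemma norm_scalar: "norm (c *s v) = norm c * norm (v :: 'f::real_or_complex^'d)"
  by (simp add: norm_vec_def norm_mult L2_set_right_distrib)

text \<open>
  Multiplying by a unit scalar turns a Hermitian product into a nonnegative real. Real inner
  products see only the real part of the Hermitian product, so this normalization is what makes
  them as good as Hermitian ones.
\<close>

lemma exists_phase:
  fixes z :: "'f::real_or_complex"
  obtains c where "norm c = 1" "c * z = of_real (norm z)"
proof (cases "z = 0")
  case True then show ?thesis by (intro that[of 1]) auto
next
  case False
  have "fconj z / of_real (norm z) * z = of_real (norm z)"
    using mult_fconj[of z] False by (simp add: power2_eq_square field_simps)
  then show ?thesis using False by (intro that[of "fconj z / of_real (norm z)"]) (auto simp: norm_divide)
qed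

subsection \<open>Adjoints and traces\<close>

lemma adjoint_mat_simps [simp]:
  fixes A B :: "'f::real_or_complex^'d^'d"
  shows "adjoint_mat (adjoint_mat A) = A" "adjoint_mat (A + B) = adjoint_mat A + adjoint_mat B"
    "adjoint_mat (A - B) = adjoint_mat A - adjoint_mat B" "adjoint_mat (- A) = - adjoint_mat A"
    "adjoint_mat (r *\<^sub>R A) = r *\<^sub>R adjoint_mat A" "adjoint_mat (mat 1 :: 'f^'d^'d) = mat 1"
    "adjoint_mat (0 :: 'f^'d^'d) = 0"
  by (simp_all add: adjoint_mat_def vec_eq_iff fconj_add fconj_diff fconj_minus fconj_scaleR mat_def
      fconj_0 fconj_1)

lemma adjoint_mat_mult: "adjoint_mat (A ** B) = adjoint_mat B ** adjoint_mat (A :: 'f::real_or_complex^'d^'d)"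
  by (simp add: adjoint_mat_def matrix_matrix_mult_def vec_eq_iff fconj_sum fconj_mult mult.commute)

lemma adjoint_mat_sum: "adjoint_mat (sum F S) = (\<Sum>i\<in>S. adjoint_mat (F i :: 'f::real_or_complex^'d^'d))"
  by (induction S rule: infinite_finite_induct) simp_all

lemma scaleR_matrix_vector: "(r *\<^sub>R A) *v v = r *\<^sub>R (A *v (v :: 'f::real_or_complex^'d))"
  by (simp add: matrix_vector_mult_def vec_eq_iff scaleR_sum_right)

lemma matrix_vector_scaleR: "A *v (r *\<^sub>R v) = r *\<^sub>R (A *v (v :: 'f::real_or_complex^'d))"
  by (simp add: matrix_vector_mult_def vec_eq_iff scaleR_sum_right)

lemma sum_matrix_vector: "sum F S *v v = (\<Sum>i\<in>S. F i *v (v :: 'f::real_or_complex^'d))"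
  by (induction S rule: infinite_finite_induct) (simp_all add: matrix_vector_mult_add_rdistrib)

lemma matrix_vector_scalar: "A *v (c *s v) = c *s (A *v (v :: 'f::real_or_complex^'d))"
  by (simp add: vector_scalar_commute)

lemma matrix_vector_axis: "(A *v axis j b) $ i = A $ i $ j * (b :: 'f::field)"
  by (simp add: matrix_vector_mult_def axis_def mult_delta_right)

lemma inner_adjoint_mat: "u \<bullet> (A *v v) = (adjoint_mat A *v u) \<bullet> (v :: 'f::real_or_complex^'d)"
proof -
  have "u \<bullet> (A *v v) = (\<Sum>i\<in>UNIV. \<Sum>j\<in>UNIV. u$i \<bullet> (A$i$j * v$j))"
    by (simp add: inner_vec_def matrix_vector_mult_def inner_sum_right)
  also have "\<dots> = (\<Sum>j\<in>UNIV. \<Sum>i\<in>UNIV. (fconj (A$i$j) * u$i) \<bullet> v$j)"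
    by (subst sum.swap) (simp add: inner_mult_right_fconj)
  also have "\<dots> = (adjoint_mat A *v u) \<bullet> v"
    by (simp add: inner_vec_def matrix_vector_mult_def inner_sum_left adjoint_mat_def)
  finally show ?thesis .
qed

lemma rtrace_eq: "rtrace A = (\<Sum>i\<in>UNIV. re_part (A $ i $ i))"
  by (simp only: rtrace_def trace_def re_part_sum)

lemma rtrace_simps [simp]:
  fixes A B :: "'f::real_or_complex^'d^'d"
  shows "rtrace (A + B) = rtrace A + rtrace B" "rtrace (A - B) = rtrace A - rtrace B"
    "rtrace (r *\<^sub>R A) = r * rtrace A" "rtrace (0 :: 'f^'d^'d) = 0"
    "rtrace (transpose A) = rtrace A"
  unfolding rtrace_eq
  by (simp_all add: sum.distrib sum_subtractf sum_distrib_left transpose_def)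

lemma rtrace_mat_1 [simp]: "rtrace (mat 1 :: 'f::real_or_complex^'d^'d) = real CARD('d)"
proof -
  have "rtrace (mat 1 :: 'f^'d^'d) = (\<Sum>i\<in>(UNIV :: 'd set). 1)"
    unfolding rtrace_eq by (intro sum.cong refl) (simp add: mat_def)
  then show ?thesis by simp
qed

lemma rtrace_sum: "rtrace (sum F S) = (\<Sum>i\<in>S. rtrace (F i :: 'f::real_or_complex^'d^'d))"
  by (induction S rule: infinite_finite_induct) simp_all

lemma rtrace_commute: "rtrace (A ** B) = rtrace (B ** (A :: 'f::real_or_complex^'d^'d))"
  unfolding rtrace_def by (rule arg_cong[OF trace_mul_sym])

text \<open>The Euclidean inner product on matrices is the (real) Hilbert-Schmidt inner product.\<close>

lemma rtrace_adjoint_mult: "rtrace (adjoint_mat A ** B) = A \<bullet> (B :: 'f::real_or_complex^'d^'d)"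
proof -
  have "rtrace (adjoint_mat A ** B) = (\<Sum>i\<in>UNIV. \<Sum>j\<in>UNIV. re_part (fconj (A$j$i) * B$j$i))"
    by (simp add: rtrace_eq matrix_matrix_mult_def adjoint_mat_def re_part_sum)
  also have "\<dots> = (\<Sum>j\<in>UNIV. \<Sum>i\<in>UNIV. re_part (fconj (A$j$i) * B$j$i))"
    by (rule sum.swap)
  finally show ?thesis by (simp add: inner_vec_def inner_eq_re_part)
qed

lemma bounded_linear_rtrace: "bounded_linear (rtrace :: 'f::real_or_complex^'d^'d \<Rightarrow> real)"
  by (intro linear_conv_bounded_linear[THEN iffD1] linearI) simp_all

lemma matrix_mult_scaleR:
  fixes A B :: "'f::real_or_complex^'d^'d"
  shows "(r *\<^sub>R A) ** B = r *\<^sub>R (A ** B)" "A ** (r *\<^sub>R B) = r *\<^sub>R (A ** B)"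
  by (simp_all add: matrix_matrix_mult_def vec_eq_iff scaleR_sum_right)

lemma matrix_mult_diff:
  fixes A B :: "'f::real_or_complex^'d^'d"
  shows "(A - B) ** C = A ** C - B ** C" "A ** (B - C) = A ** B - A ** C"
    "(A + B) ** C = A ** C + B ** C" "A ** (B + C) = A ** B + A ** C"
  by (simp_all add: matrix_matrix_mult_def vec_eq_iff sum_subtractf left_diff_distrib right_diff_distrib
       sum.distrib distrib_left distrib_right)

lemma bounded_bilinear_matrix_mult:
  "bounded_bilinear (\<lambda>(A :: 'f::real_or_complex^'d^'d) (B :: 'f^'d^'d). A ** B)"
  by (intro bilinear_conv_bounded_bilinear[THEN iffD1])
     (auto simp: bilinear_def matrix_mult_diff matrix_mult_scaleR intro!: linearI)

lemma bounded_bilinear_matrix_vector: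
  "bounded_bilinear (\<lambda>(A :: 'f::real_or_complex^'d^'d) (v :: 'f^'d). A *v v)"
  by (intro bilinear_conv_bounded_bilinear[THEN iffD1])
     (auto simp: bilinear_def scaleR_matrix_vector matrix_vector_scaleR
        matrix_vector_mult_add_rdistrib matrix_vector_right_distrib intro!: linearI)

text \<open>
  On the underlying real vector space every diagonal entry occurs with multiplicity \<open>DIM('f)\<close>, once for
  each real direction of the scalar field.
\<close>

lemma real_trace_eq:
  "(\<Sum>b\<in>Basis. b \<bullet> (A *v b)) = real DIM('f) * rtrace (A :: 'f::real_or_complex^'d^'d)"
proof -
  have unit: "b \<bullet> (a * b) = re_part a" if "b \<in> Basis" for a b :: 'f
  proof -
    have e: "fconj b * b = 1"
      using mult_fconj[of b] that by (subst mult.commute) simp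
    have "fconj b * (a * b) = a * (fconj b * b)" by (rule mult.left_commute)
    also have "\<dots> = a" by (simp only: e mult_1_right)
    finally have "fconj b * (a * b) = a" .
    then show ?thesis by (simp only: inner_eq_re_part)
  qed
  have "(\<Sum>b\<in>Basis. b \<bullet> (A *v b)) = (\<Sum>i\<in>UNIV. \<Sum>b\<in>Basis. axis i b \<bullet> (A *v axis i b))"
  proof -
    have B: "Basis = (\<lambda>(i, b). axis i b :: 'f^'d) ` (UNIV \<times> Basis)"
      by (auto simp: Basis_vec_def)
    have inj: "inj_on (\<lambda>(i, b). axis i b :: 'f^'d) (UNIV \<times> Basis)"
      by (auto simp: inj_on_def axis_eq_axis)
    show ?thesis unfolding B
      unfolding sum.cartesian_product by (subst sum.reindex[OF inj]) (simp only: o_def case_prod_unfold)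
  qed
  also have "\<dots> = (\<Sum>i\<in>UNIV. \<Sum>b\<in>Basis. b \<bullet> (A$i$i * b))"
  proof -
    show ?thesis by (simp add: inner_axis' matrix_vector_axis)
  qed
  also have "\<dots> = (\<Sum>i\<in>UNIV. real DIM('f) * re_part (A$i$i))"
    by (simp add: unit)
  finally show ?thesis by (simp add: rtrace_eq sum_distrib_left)
qed

subsection \<open>Rank-one projections\<close>

definition outer :: "'f::real_or_complex^'d \<Rightarrow> 'f^'d^'d" where
  "outer x = (\<chi> i j. x $ i * fconj (x $ j))"

lemma outer_vector: "outer x *v v = hdot x v *s x"
  by (simp add: outer_def hdot_def matrix_vector_mult_def vec_eq_iff sum_distrib_left sum_distrib_right mult_ac)

lemma adjoint_outer [simp]: "adjoint_mat (outer x) = outer x"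
  by (simp add: outer_def adjoint_mat_def vec_eq_iff fconj_mult mult.commute)

lemma matrix_mult_outer: "A ** outer x = (\<chi> i j. (A *v x) $ i * fconj (x $ j))"
  by (simp add: outer_def matrix_matrix_mult_def matrix_vector_mult_def vec_eq_iff sum_distrib_right mult.assoc)

lemma rtrace_mult_outer: "rtrace (A ** outer x) = x \<bullet> (A *v (x :: 'f::real_or_complex^'d))"
  by (simp add: matrix_mult_outer rtrace_eq inner_vec_def inner_eq_re_part mult.commute)

lemma rtrace_outer: "rtrace (outer x) = (norm x)\<^sup>2"
  using rtrace_mult_outer[of "mat 1" x] by (simp add: power2_norm_eq_inner)

lemma outer_idem: "norm x = 1 \<Longrightarrow> outer x ** outer x = outer x"
  by (simp add: matrix_eq outer_vector hdot_linear hdot_self flip: matrix_vector_mul_assoc)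

lemma outer_fixed:
  assumes "A *v x = x" shows "A ** outer x = outer x"
  using assms by (simp add: matrix_mult_outer) (simp add: outer_def)

lemma rank_eq_dim_range:
  "rank A = vec.dim (range (\<lambda>v. transpose A *v v))" for A :: "'f::field^'d^'d"
proof -
  have "vec.span (columns B) = range (\<lambda>v. B *v v)" for B :: "'f^'d^'d"
  proof
    have "vec.subspace (range (\<lambda>v. B *v v))"
      using vec.subspace_image[OF vec.subspace_UNIV] by simp
    moreover have "columns B \<subseteq> range (\<lambda>v. B *v v)"
    proof -
      have "column i B = B *v axis i 1" for i
        by (simp add: vec_eq_iff column_def matrix_vector_axis)
      then show ?thesis by (auto simp: columns_def)
    qed
    ultimately show "vec.span (columns B) \<subseteq> range (\<lambda>v. B *v v)"
      by (simp add: vec.span_minimal)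
    show "range (\<lambda>v. B *v v) \<subseteq> vec.span (columns B)"
      using matrix_vector_mult_in_columnspace_gen by blast
  qed
  then show ?thesis
    unfolding row_rank_def_gen by (metis vec.dim_span columns_transpose)
qed

text \<open>
  Peeling off a unit vector of the range lowers both the trace and the dimension of the range
  by one, so both are the same number.
\<close>

lemma dim_range_projection:
  fixes Q :: "'f::real_or_complex^'d^'d"
  assumes "adjoint_mat Q = Q" "Q ** Q = Q"
  shows "real (vec.dim (range (\<lambda>v. Q *v v))) = rtrace Q"
  using assms
proof (induction "vec.dim (range (\<lambda>v. Q *v v))" arbitrary: Q)
  case 0
  then have "range (\<lambda>v. Q *v v) \<subseteq> {0}" by (simp add: vec.dim_eq_0)
  then have "Q = 0" by (auto simp: matrix_eq)
  then show ?case by (simp add: image_def vec.dim_eq_0)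
next
  case (Suc k)
  have "\<not> range (\<lambda>v. Q *v v) \<subseteq> {0}"
  proof
    assume "range (\<lambda>v. Q *v v) \<subseteq> {0}"
    then have "vec.dim (range (\<lambda>v. Q *v v)) = 0" using vec.dim_eq_0 by blast
    then show False using Suc.hyps(2) by (metis nat.distinct(1))
  qed
  then obtain z where z: "Q *v z \<noteq> 0" by auto
  define y where "y = (1 / norm (Q *v z)) *\<^sub>R (Q *v z)"
  have ny: "norm y = 1" using z by (simp add: y_def)
  have Qy: "Q *v y = y"
    using Suc.prems(2) by (simp add: y_def matrix_vector_scaleR matrix_vector_mul_assoc)
  define R where "R = Q - outer y"
  have Qo: "Q ** outer y = outer y" using Qy by (rule outer_fixed)
  then have oQ: "outer y ** Q = outer y"
    using adjoint_mat_mult[of Q "outer y"] Suc.prems(1) by simp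
  have R: "adjoint_mat R = R" "R ** R = R"
    using Suc.prems by (simp_all add: R_def matrix_mult_diff Qo oQ outer_idem[OF ny])
  have ran: "vec.span (insert y (range (\<lambda>v. R *v v))) = range (\<lambda>v. Q *v v)"
  proof
    have "vec.subspace (range (\<lambda>v. Q *v v))"
      using vec.subspace_image[OF vec.subspace_UNIV] by simp
    moreover have "R *v v = Q *v (R *v v)" for v
      using Suc.prems(2) Qo by (simp add: matrix_vector_mul_assoc R_def matrix_mult_diff)
    then have "range (\<lambda>v. R *v v) \<subseteq> range (\<lambda>v. Q *v v)" by (metis image_subsetI rangeI)
    moreover have "y \<in> range (\<lambda>v. Q *v v)" using Qy by (metis rangeI)
    ultimately show "vec.span (insert y (range (\<lambda>v. R *v v))) \<subseteq> range (\<lambda>v. Q *v v)"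
      by (intro vec.span_minimal) auto
    have "Q *v v = R *v v + hdot y v *s y" for v
      by (simp add: R_def matrix_vector_mult_diff_rdistrib outer_vector)
    then show "range (\<lambda>v. Q *v v) \<subseteq> vec.span (insert y (range (\<lambda>v. R *v v)))"
      by (auto intro!: vec.span_add vec.span_scale intro: vec.span_base)
  qed
  have "y \<notin> vec.span (range (\<lambda>v. R *v v))"
  proof
    assume y: "y \<in> vec.span (range (\<lambda>v. R *v v))"
    have "vec.subspace (range (\<lambda>v. R *v v))"
      using vec.subspace_image[OF vec.subspace_UNIV] by simp
    then obtain v where "y = R *v v" using y by (auto simp: vec.span_eq_iff[THEN iffD2])
    then have "R *v y = y" using R(2) by (simp add: matrix_vector_mul_assoc)
    moreover have "R *v y = 0"
      using ny by (simp add: R_def matrix_vector_mult_diff_rdistrib outer_vector Qy hdot_self)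
    ultimately show False using ny by simp
  qed
  then have "vec.dim (insert y (range (\<lambda>v. R *v v))) = Suc (vec.dim (range (\<lambda>v. R *v v)))"
    by (simp add: vec.dim_insert)
  then have d: "vec.dim (range (\<lambda>v. Q *v v)) = Suc (vec.dim (range (\<lambda>v. R *v v)))"
    using ran by (metis vec.dim_span)
  then have "real (vec.dim (range (\<lambda>v. R *v v))) = rtrace R"
    using Suc.hyps R by simp
  moreover have "rtrace Q = rtrace R + 1"
    using ny by (simp add: R_def rtrace_outer)
  ultimately show ?case using d by simp
qed

lemma Proj_iff_rtrace:
  "P \<in> Proj k \<longleftrightarrow> adjoint_mat P = P \<and> P ** P = P \<and> rtrace P = real k"
proof -
  have "real (rank P) = rtrace P" if "adjoint_mat P = P" "P ** P = P"
  proof -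
    have "adjoint_mat (transpose P) = transpose P"
      using that(1) by (auto simp: adjoint_mat_def transpose_def vec_eq_iff)
    moreover have "transpose P ** transpose P = transpose P"
      using that(2) by (metis matrix_transpose_mul)
    ultimately show ?thesis
      using dim_range_projection[of "transpose P"] by (simp add: rank_eq_dim_range)
  qed
  then show ?thesis unfolding Proj_def by (metis (mono_tags, lifting) mem_Collect_eq of_nat_eq_iff)
qed

lemma outer_in_Proj: "norm x = 1 \<Longrightarrow> outer x \<in> Proj 1"
  by (simp add: Proj_iff_rtrace outer_idem rtrace_outer)

lemma projection_zero:
  assumes "adjoint_mat Q = Q" "Q ** Q = Q" "rtrace Q = 0"
  shows "Q = (0 :: 'f::real_or_complex^'d^'d)"
proof -
  have "Q \<bullet> Q = 0" using rtrace_adjoint_mult[of Q Q] assms by simp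
  then show ?thesis by simp
qed

lemma Proj_1_eq: "Proj 1 = outer ` {x :: 'f::real_or_complex^'d. norm x = 1}"
proof
  show "outer ` {x. norm x = 1} \<subseteq> Proj 1" using outer_in_Proj by auto
  show "Proj 1 \<subseteq> outer ` {x :: 'f^'d. norm x = 1}"
  proof
    fix Q :: "'f^'d^'d" assume Q: "Q \<in> Proj 1"
    then have q: "adjoint_mat Q = Q" "Q ** Q = Q" "rtrace Q = 1" by (auto simp: Proj_iff_rtrace)
    then have "Q \<noteq> 0" by auto
    then obtain z where z: "Q *v z \<noteq> 0" by (auto simp: matrix_eq)
    define y where "y = (1 / norm (Q *v z)) *\<^sub>R (Q *v z)"
    have ny: "norm y = 1" using z by (simp add: y_def)
    have Qy: "Q *v y = y"
      using q(2) by (simp add: y_def matrix_vector_scaleR matrix_vector_mul_assoc)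
    have Qo: "Q ** outer y = outer y" using Qy by (rule outer_fixed)
    then have oQ: "outer y ** Q = outer y"
      using adjoint_mat_mult[of Q "outer y"] q(1) by simp
    have "Q - outer y = 0"
      using q ny by (intro projection_zero)
        (simp_all add: matrix_mult_diff Qo oQ outer_idem[OF ny] rtrace_outer)
    then show "Q \<in> outer ` {x. norm x = 1}" using ny by auto
  qed
qed

section \<open>Leading eigenvectors under perturbation\<close>

lemma inner_outer: "v \<bullet> (outer x *v v) = (norm (hdot x v))\<^sup>2"
proof -
  have "hdot v (outer x *v v) = of_real ((norm (hdot x v))\<^sup>2)"
    using mult_fconj[of "hdot x v"] by (simp add: outer_vector hdot_linear fconj_hdot)
  then show ?thesis using re_part_hdot[of v "outer x *v v"] re_part_simps(7) by metis
qed

lemma rtrace_outer_outer: "rtrace (outer x ** outer y) = (norm (hdot x y))\<^sup>2"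
  by (simp add: rtrace_mult_outer inner_outer)

lemma norm_hdot_le: 
  assumes "norm x = 1" shows "norm (hdot x v) \<le> norm v"
proof -
  have "(norm (hdot x v))\<^sup>2 = v \<bullet> (outer x *v v)" by (simp add: inner_outer)
  also have "\<dots> \<le> norm v * norm (outer x *v v)" by (rule norm_cauchy_schwarz)
  also have "norm (outer x *v v) = norm (hdot x v)"
    using assms by (simp add: outer_vector norm_scalar)
  finally have "norm (hdot x v) * norm (hdot x v) \<le> norm v * norm (hdot x v)"
    by (simp add: power2_eq_square)
  then show ?thesis
    by (cases "norm (hdot x v) = 0") (auto intro: mult_right_le_imp_le)
qed

lemma psd_outer: "psd (outer x)"
  by (simp add: psd_def inner_outer)

lemma outer_phase: "norm c = 1 \<Longrightarrow> outer (c *s y) = outer y"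
proof -
  assume "norm c = 1"
  then have c: "c * fconj c = 1" by (simp add: mult_fconj)
  have "c * a * (fconj c * b) = a * b" for a b
  proof -
    have "c * a * (fconj c * b) = (c * fconj c) * (a * b)" by (simp only: mult_ac)
    then show ?thesis by (simp add: c)
  qed
  then show ?thesis by (simp add: outer_def vec_eq_iff fconj_mult)
qed

text \<open>
  A Hermitian form is controlled by its diagonal: polarize, after scaling both vectors to unit
  length.
\<close>

lemma bilinear_le_quadratic:
  fixes E :: "'f::real_or_complex^'d^'d"
  assumes E: "adjoint_mat E = E" and q: "\<And>v. \<bar>v \<bullet> (E *v v)\<bar> \<le> e * (norm v)\<^sup>2"
  shows "a \<bullet> (E *v b) \<le> e * (norm a * norm b)"
proof (cases "a = 0 \<or> b = 0")
  case True then show ?thesis by auto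
next
  case False
  define u where "u = (1 / norm a) *\<^sub>R a"
  define w where "w = (1 / norm b) *\<^sub>R b"
  have n: "norm u = 1" "norm w = 1" using False by (auto simp: u_def w_def)
  have sym: "w \<bullet> (E *v u) = u \<bullet> (E *v w)"
    using inner_adjoint_mat[of w E u] E by (simp add: inner_commute)
  have "4 * (u \<bullet> (E *v w)) = (u + w) \<bullet> (E *v (u + w)) - (u - w) \<bullet> (E *v (u - w))"
    by (simp add: matrix_vector_right_distrib matrix_vector_mult_diff_distrib inner_add_left
        inner_add_right inner_diff_left inner_diff_right sym)
  also have "\<dots> \<le> e * (norm (u + w))\<^sup>2 + e * (norm (u - w))\<^sup>2"
    using q[of "u + w"] q[of "u - w"] by linarith
  also have "\<dots> = e * ((norm (u + w))\<^sup>2 + (norm (u - w))\<^sup>2)" by (simp add: algebra_simps)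
  also have "(norm (u + w))\<^sup>2 + (norm (u - w))\<^sup>2 = 4"
    using n by (simp add: power2_norm_eq_inner inner_add_left inner_add_right inner_diff_left
        inner_diff_right) (simp add: flip: power2_norm_eq_inner)
  finally have "u \<bullet> (E *v w) \<le> e" by simp
  then have "(norm a * norm b) * (u \<bullet> (E *v w)) \<le> (norm a * norm b) * e"
    by (intro mult_left_mono) auto
  moreover have "(norm a * norm b) * (u \<bullet> (E *v w)) = a \<bullet> (E *v b)"
    using False by (simp add: u_def w_def matrix_vector_scaleR)
  ultimately show ?thesis by (simp add: mult_ac)
qed

text \<open>
  The difference \<open>D\<close> of two rank-one projections satisfies \<open>D ** D ** D = s\<^sup>2 *\<^sub>R D\<close> with
  \<open>s\<^sup>2 = 1 - tr (X Y)\<close>, because \<open>X Y X = tr (X Y) X\<close>. So \<open>D\<close> scales lengths by \<open>s\<close> on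
  its own range, and it has operator norm at most \<open>s\<close>.
\<close>

lemma norm_outer_diff_le:
  fixes x y :: "'f::real_or_complex^'d"
  assumes x: "norm x = 1" and y: "norm y = 1"
  shows "norm ((outer y - outer x) *v v) \<le> sqrt (1 - (norm (hdot x y))\<^sup>2) * norm v"
proof -
  define D where "D = outer y - outer x"
  define s2 where "s2 = 1 - (norm (hdot x y))\<^sup>2"
  have s2: "s2 \<ge> 0"
    using norm_hdot_le[OF x, of y] y by (simp add: s2_def power_le_one)
  have sandwich: "outer x ** (outer y ** outer x) = (norm (hdot x y))\<^sup>2 *\<^sub>R outer x" for x y :: "'f^'d"
  proof -
    have "outer x *v (outer y *v (outer x *v v)) = (norm (hdot x y))\<^sup>2 *\<^sub>R (outer x *v v)" for v
    proof -
      have "outer x *v (outer y *v (outer x *v v)) = (hdot x v * (hdot y x * hdot x y)) *s x"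
        by (simp add: outer_vector hdot_linear mult_ac)
      also have "hdot y x * hdot x y = of_real ((norm (hdot x y))\<^sup>2)"
        using mult_fconj[of "hdot x y"] by (simp add: fconj_hdot mult.commute)
      finally show ?thesis by (simp add: outer_vector scaleR_eq_scalar mult.commute)
    qed
    then show ?thesis by (simp add: matrix_eq scaleR_matrix_vector flip: matrix_vector_mul_assoc)
  qed
  have nyx: "norm (hdot y x) = norm (hdot x y)" by (metis fconj_hdot norm_fconj)
  have idem: "outer x ** outer x = outer x" "outer y ** outer y = outer y"
    using x y outer_idem by auto
  have idem': "outer x ** (outer x ** C) = outer x ** C" "outer y ** (outer y ** C) = outer y ** C" for C
    by (simp_all add: matrix_mul_assoc idem)
  have cube: "D ** (D ** D) = s2 *\<^sub>R D"
    unfolding D_def s2_def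
    by (simp add: matrix_mult_diff idem idem' sandwich nyx scaleR_diff_left scaleR_diff_right)
  have adj: "adjoint_mat D = D" by (simp add: D_def)
  define z where "z = D *v v"
  have "(norm (D *v z))\<^sup>2 = z \<bullet> (D *v (D *v z))"
    using inner_adjoint_mat[of z D "D *v z"] adj by (simp add: power2_norm_eq_inner)
  also have "D *v (D *v z) = s2 *\<^sub>R z"
    using cube by (simp add: z_def matrix_vector_mul_assoc scaleR_matrix_vector)
  finally have Dz: "(norm (D *v z))\<^sup>2 = s2 * (norm z)\<^sup>2" by (simp add: power2_norm_eq_inner)
  have "norm (D *v z) = sqrt s2 * norm z"
    using real_sqrt_unique[OF Dz norm_ge_zero] by (simp add: real_sqrt_mult)
  moreover have "(norm z)\<^sup>2 = v \<bullet> (D *v z)"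
    using inner_adjoint_mat[of v D z] adj by (simp add: z_def power2_norm_eq_inner)
  ultimately have "norm z * norm z \<le> (sqrt s2 * norm v) * norm z"
    using norm_cauchy_schwarz[of v "D *v z"] by (simp add: power2_eq_square mult_ac)
  then have "norm z \<le> sqrt s2 * norm v"
    using s2 by (cases "norm z = 0") (auto intro: mult_right_le_imp_le)
  then show ?thesis by (simp add: z_def D_def s2_def)
qed

text \<open>
  With the phase of \<open>y\<close> chosen so that \<open>\<langle>x, y\<rangle> = \<rho> \<ge> 0\<close>, the difference of the two quadratic
  forms is \<open>\<langle>y - x, E (y + x)\<rangle>\<close>, and the two vectors have lengths \<open>\<surd>(2 - 2\<rho>)\<close> and \<open>\<surd>(2 + 2\<rho>)\<close>.
\<close>

lemma rtrace_outer_diff_le: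
  fixes x y :: "'f::real_or_complex^'d"
  assumes x: "norm x = 1" and y: "norm y = 1"
    and E: "adjoint_mat E = E" and q: "\<And>v. \<bar>v \<bullet> (E *v v)\<bar> \<le> e * (norm v)\<^sup>2"
  shows "rtrace (E ** outer y) - rtrace (E ** outer x) \<le> 2 * e * sqrt (1 - (norm (hdot x y))\<^sup>2)"
proof -
  define \<rho> where "\<rho> = norm (hdot x y)"
  obtain c where c: "norm c = 1" "c * hdot x y = of_real \<rho>"
    unfolding \<rho>_def by (rule exists_phase)
  define w where "w = c *s y"
  have w: "norm w = 1" "outer w = outer y"
    using c y by (simp_all add: w_def norm_scalar outer_phase)
  have "hdot x w = of_real \<rho>" using c by (simp add: w_def hdot_linear)
  then have xw: "x \<bullet> w = \<rho>" using re_part_hdot[of x w] by simp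
  have n1: "(norm (w - x))\<^sup>2 = 2 - 2 * \<rho>" and n2: "(norm (w + x))\<^sup>2 = 2 + 2 * \<rho>"
    using x w xw by (simp_all add: power2_norm_eq_inner inner_add_left inner_add_right inner_diff_left
        inner_diff_right inner_commute norm_eq_1)
  have sym: "x \<bullet> (E *v w) = w \<bullet> (E *v x)"
    using inner_adjoint_mat[of x E w] E by (simp add: inner_commute)
  have "rtrace (E ** outer y) - rtrace (E ** outer x) = (w - x) \<bullet> (E *v (w + x))"
    unfolding w(2)[symmetric]
    by (simp add: rtrace_mult_outer matrix_vector_right_distrib inner_diff_left inner_add_right sym)
  also have "\<dots> \<le> e * (norm (w - x) * norm (w + x))"
    by (rule bilinear_le_quadratic[OF E q])
  also have "norm (w - x) * norm (w + x) = sqrt ((2 - 2 * \<rho>) * (2 + 2 * \<rho>))"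
    unfolding n1[symmetric] n2[symmetric] real_sqrt_mult by simp
  also have "(2 - 2 * \<rho>) * (2 + 2 * \<rho>) = 2\<^sup>2 * (1 - \<rho>\<^sup>2)" by (simp add: power2_eq_square algebra_simps)
  also have "sqrt (2\<^sup>2 * (1 - \<rho>\<^sup>2)) = 2 * sqrt (1 - \<rho>\<^sup>2)"
    unfolding real_sqrt_mult by simp
  finally show ?thesis by (simp add: \<rho>_def mult_ac)
qed

text \<open>
  The gap between the values of the form of \<open>\<mu> I + \<Delta> X\<close> at \<open>x\<close> and at \<open>y\<close> is quadratic in the distance of
  the projections, whereas a perturbation contributes only linearly: dividing by the distance
  gives the bound.
\<close>

lemma recovery_error:
  fixes x y :: "'f::real_or_complex^'d"
  assumes x: "norm x = 1" and y: "norm y = 1" and \<Delta>: "\<Delta> > 0" and Q: "adjoint_mat Q = Q"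
    and q: "\<And>v. \<bar>v \<bullet> ((Q - (\<mu> *\<^sub>R mat 1 + \<Delta> *\<^sub>R outer x)) *v v)\<bar> \<le> e * (norm v)\<^sup>2"
    and max: "rtrace (Q ** outer x) \<le> rtrace (Q ** outer y)"
  shows "op_norm (outer y - outer x) \<le> 2 * e / \<Delta>"
proof -
  define s where "s = sqrt (1 - (norm (hdot x y))\<^sup>2)"
  have s2: "s\<^sup>2 = 1 - (norm (hdot x y))\<^sup>2" and s0: "s \<ge> 0"
    using norm_hdot_le[OF x, of y] y by (simp_all add: s_def power_le_one)
  have op: "op_norm (outer y - outer x) \<le> s"
    unfolding op_norm_def s_def by (rule onorm_le) (rule norm_outer_diff_le[OF x y])
  define E where "E = Q - (\<mu> *\<^sub>R mat 1 + \<Delta> *\<^sub>R outer x)"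
  have "adjoint_mat E = E" by (simp add: E_def Q)
  then have "rtrace (E ** outer y) - rtrace (E ** outer x) \<le> 2 * e * s"
    unfolding s_def by (rule rtrace_outer_diff_le[OF x y]) (use q in \<open>simp add: E_def\<close>)
  moreover have "rtrace (E ** outer y) - rtrace (E ** outer x)
      = rtrace (Q ** outer y) - rtrace (Q ** outer x) + \<Delta> * s\<^sup>2"
    using x y by (simp add: E_def matrix_mult_diff matrix_mult_scaleR rtrace_outer rtrace_outer_outer
        hdot_self s2 algebra_simps)
  ultimately have "\<Delta> * s\<^sup>2 \<le> 2 * e * s" using max by linarith
  then have "(\<Delta> * s) * s \<le> (2 * e) * s" by (simp add: power2_eq_square)
  moreover have "e \<ge> 0" using q[of x] x by simp
  ultimately have "\<Delta> * s \<le> 2 * e"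
    using s0 by (cases "s = 0") (auto intro: mult_right_le_imp_le)
  then have "s \<le> 2 * e / \<Delta>" using \<Delta> by (simp add: pos_le_divide_eq mult.commute)
  then show ?thesis using op by simp
qed

lemma projection_form:
  assumes "adjoint_mat P = P" "P ** P = P"
  shows "v \<bullet> (P *v v) = (norm (P *v v))\<^sup>2"
proof -
  have "v \<bullet> (P *v v) = v \<bullet> (P *v (P *v v))" using assms by (simp add: matrix_vector_mul_assoc)
  then show ?thesis using inner_adjoint_mat[of v P "P *v v"] assms by (simp add: power2_norm_eq_inner)
qed

lemma projection_form_bounds:
  assumes "adjoint_mat P = P" "P ** P = P"
  shows "0 \<le> v \<bullet> (P *v v)" "v \<bullet> (P *v v) \<le> (norm v)\<^sup>2"
proof -
  show "0 \<le> v \<bullet> (P *v v)" using projection_form[OF assms] by simp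
  have "(norm (P *v v))\<^sup>2 \<le> norm v * norm (P *v v)"
    using norm_cauchy_schwarz[of v "P *v v"] projection_form[OF assms, of v] by simp
  then have "norm (P *v v) \<le> norm v"
    by (cases "P *v v = 0") (auto simp: power2_eq_square)
  then show "v \<bullet> (P *v v) \<le> (norm v)\<^sup>2"
    unfolding projection_form[OF assms] by (intro power_mono) auto
qed

text \<open>
  Flipping one bit exchanges \<open>P\<close> and \<open>I - P\<close>, whose forms have values in \<open>[0, 1]\<close> on unit vectors.
\<close>

lemma pep_matrix_flip:
  fixes P :: "nat \<Rightarrow> 'f::real_or_complex^'d^'d"
  assumes P: "\<And>j. j \<in> {1..m} \<Longrightarrow> adjoint_mat (P j) = P j \<and> P j ** P j = P j"
  shows "\<bar>v \<bullet> ((pep_matrix m P c - pep_matrix m P b) *v v)\<bar> \<le> hamming_dist m b c * (norm v)\<^sup>2"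
proof -
  define R where "R = (\<lambda>(b :: nat \<Rightarrow> nat) j. if b j = 1 then P j else mat 1 - P j)"
  have "pep_matrix m P c - pep_matrix m P b = (1 / real m) *\<^sub>R (\<Sum>j=1..m. R c j - R b j)"
    unfolding pep_matrix_def R_def sum_subtractf scaleR_diff_right by (rule refl)
  then have "v \<bullet> ((pep_matrix m P c - pep_matrix m P b) *v v) =
      (1 / real m) * (\<Sum>j=1..m. v \<bullet> ((R c j - R b j) *v v))"
    by (simp only: scaleR_matrix_vector sum_matrix_vector inner_sum_right inner_scaleR_right)
  also have "\<bar>\<dots>\<bar> \<le> (1 / real m) * (\<Sum>j=1..m. \<bar>v \<bullet> ((R c j - R b j) *v v)\<bar>)"
    unfolding abs_mult by (intro mult_mono sum_abs) auto
  also have "(\<Sum>j=1..m. \<bar>v \<bullet> ((R c j - R b j) *v v)\<bar>) \<le> (\<Sum>j=1..m. if b j \<noteq> c j then (norm v)\<^sup>2 else 0)"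
  proof (intro sum_mono)
    fix j assume j: "j \<in> {1..m}"
    have *: "0 \<le> v \<bullet> (P j *v v)" "v \<bullet> (P j *v v) \<le> (norm v)\<^sup>2"
      using projection_form_bounds P[OF j] by blast+
    have **: "v \<bullet> ((mat 1 - P j) *v v) = (norm v)\<^sup>2 - v \<bullet> (P j *v v)"
      by (simp add: matrix_vector_mult_diff_rdistrib inner_diff_right power2_norm_eq_inner)
    show "\<bar>v \<bullet> ((R c j - R b j) *v v)\<bar> \<le> (if b j \<noteq> c j then (norm v)\<^sup>2 else 0)"
    proof -
      have "v \<bullet> ((R c j - R b j) *v v) = v \<bullet> (R c j *v v) - v \<bullet> (R b j *v v)"
        by (simp only: matrix_vector_mult_diff_rdistrib inner_diff_right)
      moreover have "v \<bullet> (R a j *v v) = (if a j = 1 then v \<bullet> (P j *v v) else (norm v)\<^sup>2 - v \<bullet> (P j *v v))" for a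
        by (simp only: R_def ** split: if_split) simp
      ultimately show ?thesis using * by (auto simp: abs_le_iff)
    qed
  qed
  also have "\<dots> = real (card {j \<in> {1..m}. b j \<noteq> c j}) * (norm v)\<^sup>2"
    by (simp add: sum.If_cases Int_def)
  finally show ?thesis by (simp add: hamming_dist_def divide_right_mono)
qed

lemma adjoint_pep_matrix:
  assumes "\<And>j. j \<in> {1..m} \<Longrightarrow> adjoint_mat (P j) = P j"
  shows "adjoint_mat (pep_matrix m P b) = pep_matrix m P b"
proof -
  have "(\<Sum>j=1..m. adjoint_mat (if b j = 1 then P j else mat 1 - P j)) =
      (\<Sum>j=1..m. if b j = 1 then P j else mat 1 - P j)"
    using assms by (intro sum.cong refl) auto
  then show ?thesis by (simp only: pep_matrix_def adjoint_mat_sum adjoint_mat_simps)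
qed

subsection \<open>Maximizers of a quadratic form on the unit sphere\<close>

lemma maximizer_is_eigenvector:
  fixes Q :: "'f::real_or_complex^'d^'d"
  assumes Q: "adjoint_mat Q = Q" and y: "norm y = 1"
    and max: "\<And>x. norm x = 1 \<Longrightarrow> x \<bullet> (Q *v x) \<le> y \<bullet> (Q *v y)"
  shows "\<exists>l. is_largest_eigenvalue Q l \<and> range (\<lambda>v. outer y *v v) \<subseteq> {v. Q *v v = l *\<^sub>R v}"
proof -
  define l where "l = y \<bullet> (Q *v y)"
  define K where "K = l *\<^sub>R mat 1 - Q"
  have K: "adjoint_mat K = K" by (simp add: K_def Q)
  have Kform: "v \<bullet> (K *v v) = l * (norm v)\<^sup>2 - v \<bullet> (Q *v v)" for v
    by (simp add: K_def matrix_vector_mult_diff_rdistrib scaleR_matrix_vector inner_diff_right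
        power2_norm_eq_inner)
  have Kpos: "v \<bullet> (K *v v) \<ge> 0" for v
  proof (cases "v = 0")
    case False
    have "((1 / norm v) *\<^sub>R v) \<bullet> (Q *v ((1 / norm v) *\<^sub>R v)) \<le> l"
      unfolding l_def using False by (intro max) simp
    then have "v \<bullet> (Q *v v) / (norm v)\<^sup>2 \<le> l"
      by (simp add: matrix_vector_scaleR power2_eq_square)
    then show ?thesis using False by (simp add: Kform divide_le_eq)
  qed simp
  have Ky: "K *v y = 0"
  proof (rule ccontr)
    assume nz: "K *v y \<noteq> 0"
    define z where "z = K *v y"
    define a where "a = z \<bullet> z"
    define b where "b = z \<bullet> (K *v z)"
    have a: "a > 0" and b: "b \<ge> 0" using nz Kpos by (auto simp: a_def b_def z_def)
    define t where "t = a / (b + 1)"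
    have t: "t > 0" "t * b \<le> a" using a b by (auto simp: t_def field_simps)
    have yKz: "y \<bullet> (K *v z) = a" and zKy: "z \<bullet> (K *v y) = a" and yKy: "y \<bullet> (K *v y) = 0"
      using inner_adjoint_mat[of y K z] K Kform[of y] y by (simp_all add: a_def z_def l_def)
    \<comment> \<open>moving from the maximizer \<open>y\<close> against the gradient would make the form of \<open>K\<close> negative\<close>
    have "0 \<le> (y - t *\<^sub>R z) \<bullet> (K *v (y - t *\<^sub>R z))" by (rule Kpos)
    also have "\<dots> = t * (t * b - 2 * a)"
      by (simp add: matrix_vector_mult_diff_distrib matrix_vector_scaleR inner_diff_left inner_diff_right
          yKz zKy yKy b_def algebra_simps)
    also have "\<dots> < 0" using a t by (intro mult_pos_neg) auto
    finally show False by simp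
  qed
  then have Qy: "Q *v y = l *\<^sub>R y"
    by (simp add: K_def matrix_vector_mult_diff_rdistrib scaleR_matrix_vector)
  have "is_largest_eigenvalue Q l"
    unfolding is_largest_eigenvalue_def is_eigenvalue_def
  proof (intro conjI allI impI)
    show "\<exists>v. v \<noteq> 0 \<and> Q *v v = l *\<^sub>R v" using Qy y by (intro exI[of _ y]) auto
    fix l' assume "\<exists>v. v \<noteq> 0 \<and> Q *v v = l' *\<^sub>R v"
    then obtain v where v: "v \<noteq> 0" "Q *v v = l' *\<^sub>R v" by auto
    have "0 \<le> (l - l') * (norm v)\<^sup>2"
      using Kpos[of v] v by (simp add: Kform power2_norm_eq_inner algebra_simps)
    then show "l' \<le> l" using v by (simp add: zero_le_mult_iff)
  qed
  moreover have "range (\<lambda>v. outer y *v v) \<subseteq> {v. Q *v v = l *\<^sub>R v}"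
    using Qy by (auto simp: outer_vector matrix_vector_scalar vec_eq_iff)
  ultimately show ?thesis by blast
qed

lemma pep_maximizer_outer_le:
  assumes "pep_maximizer Q Y" "norm x = 1"
  shows "rtrace (Q ** outer x) \<le> rtrace (Q ** Y)"
proof -
  have "psd (outer x) \<and> rtrace (outer x) \<le> 1" using assms by (simp add: psd_outer rtrace_outer)
  then show ?thesis using assms(1) unfolding pep_maximizer_def is_arg_max_def by (meson not_less)
qed

text \<open>
  A rank-one maximizer has its range in the leading eigenspace, by the variational principle. So being a
  solution amounts to a closed condition on the pair of the program's matrix and the solution.
\<close>

lemma pep_solution_iff:
  assumes "adjoint_mat (pep_matrix m P b) = pep_matrix m P b"
  shows "pep_solution m P b Y \<longleftrightarrow>
    (\<exists>y. norm y = 1 \<and> Y = outer y \<and> pep_maximizer (pep_matrix m P b) Y)"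
proof
  assume "pep_solution m P b Y"
  then show "\<exists>y. norm y = 1 \<and> Y = outer y \<and> pep_maximizer (pep_matrix m P b) Y"
    unfolding pep_solution_def Proj_1_eq by auto
next
  assume "\<exists>y. norm y = 1 \<and> Y = outer y \<and> pep_maximizer (pep_matrix m P b) Y"
  then obtain y where y: "norm y = 1" "Y = outer y" and M: "pep_maximizer (pep_matrix m P b) Y" by auto
  have "x \<bullet> (pep_matrix m P b *v x) \<le> y \<bullet> (pep_matrix m P b *v y)" if "norm x = 1" for x
    using pep_maximizer_outer_le[OF M that] y by (simp add: rtrace_mult_outer)
  from maximizer_is_eigenvector[OF assms y(1) this] show "pep_solution m P b Y"
    unfolding pep_solution_def Proj_1_eq using M y by auto
qed

section \<open>Unitary invariance\<close>

text \<open>The Householder reflection in the hyperplane orthogonal to \<open>z\<close>.\<close>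

definition reflection :: "'f::real_or_complex^'d \<Rightarrow> 'f^'d^'d" where
  "reflection z = mat 1 - (2 / (norm z)\<^sup>2) *\<^sub>R outer z"

lemma reflection_vector: "reflection z *v v = v - (2 / (norm z)\<^sup>2) *\<^sub>R (hdot z v *s z)"
  by (simp add: reflection_def matrix_vector_mult_diff_rdistrib scaleR_matrix_vector outer_vector)

lemma adjoint_reflection: "adjoint_mat (reflection z) = reflection z"
  by (simp add: reflection_def)

lemma reflection_reflection: "z \<noteq> 0 \<Longrightarrow> reflection z *v (reflection z *v v) = v"
proof -
  assume z: "z \<noteq> 0"
  define r where "r = 2 / (norm z)\<^sup>2"
  have "hdot z (reflection z *v v) = - hdot z v"
  proof -
    have "hdot z (r *\<^sub>R (hdot z v *s z)) = of_real (r * (norm z)\<^sup>2) * hdot z v"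
      by (simp add: scaleR_eq_scalar hdot_linear hdot_self mult_ac)
    also have "r * (norm z)\<^sup>2 = 2" using z by (simp add: r_def)
    finally show ?thesis by (simp add: reflection_vector hdot_linear flip: r_def)
  qed
  then show ?thesis by (simp add: reflection_vector[of z "reflection z *v v"])
     (simp add: reflection_vector vector_sneg_minus1 scaleR_eq_scalar)
qed

lemma unitary_reflection: "z \<noteq> 0 \<Longrightarrow> unitary_mat (reflection z)"
  using reflection_reflection[of z]
  by (simp add: unitary_mat_def adjoint_reflection matrix_eq flip: matrix_vector_mul_assoc)

lemma unitary_mat_1: "unitary_mat (mat 1)"
  by (simp add: unitary_mat_def)

text \<open>
  After a change of phase the Hermitian product of \<open>u\<close> and \<open>w\<close> is real, and then the reflection
  along \<open>u - w\<close> exchanges the two vectors.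
\<close>

lemma exists_unitary_moving:
  fixes u w :: "'f::real_or_complex^'d"
  assumes n: "norm u = norm w"
  obtains U c where "unitary_mat U" "adjoint_mat U = U" "norm c = 1" "U *v u = c *s w"
    "\<And>v. hdot u v = 0 \<Longrightarrow> hdot w v = 0 \<Longrightarrow> U *v v = v"
proof -
  obtain c where c: "norm c = 1" "c * hdot u w = of_real (norm (hdot u w))"
    by (rule exists_phase)
  define w' where "w' = c *s w"
  define \<rho> where "\<rho> = norm (hdot u w)"
  have uw: "hdot u w' = of_real \<rho>" using c by (simp add: w'_def hdot_linear \<rho>_def)
  then have wu: "hdot w' u = of_real \<rho>" using fconj_hdot[of u w'] by (simp add: fconj_of_real)
  have nw: "norm w' = norm u" using c n by (simp add: w'_def norm_scalar)
  show ?thesis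
  proof (cases "u = w'")
    case True
    then show ?thesis
      by (intro that[of "mat 1" c]) (auto simp: unitary_mat_1 c w'_def[symmetric])
  next
    case False
    define z where "z = u - w'"
    have z: "z \<noteq> 0" using False by (simp add: z_def)
    have zu: "hdot z u = of_real ((norm u)\<^sup>2 - \<rho>)"
      by (simp add: z_def hdot_linear hdot_self wu)
    have "hdot z z = of_real (2 * ((norm u)\<^sup>2 - \<rho>))"
      unfolding z_def hdot_linear by (simp add: hdot_self wu uw nw)
    then have nz: "(norm z)\<^sup>2 = 2 * ((norm u)\<^sup>2 - \<rho>)" by (simp only: hdot_self of_real_eq_iff)
    have "(2 / (norm z)\<^sup>2) * ((norm u)\<^sup>2 - \<rho>) = 1"
      using nz z by (simp add: field_simps)
    then have "reflection z *v u = u - 1 *\<^sub>R z"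
      by (simp only: reflection_vector zu scaleR_eq_scalar[symmetric] scaleR_scaleR)
    then have "reflection z *v u = w'" by (simp add: z_def)
    moreover have "reflection z *v v = v" if "hdot u v = 0" "hdot w v = 0" for v
      using that by (simp add: reflection_vector z_def w'_def hdot_linear)
    ultimately show ?thesis
      using unitary_reflection[OF z] adjoint_reflection c(1)
      by (intro that[of "reflection z" c]) (auto simp: w'_def)
  qed
qed

lemma Proj_conjugate:
  assumes U: "unitary_mat U" and A: "A \<in> Proj k"
  shows "U ** A ** adjoint_mat U \<in> Proj k"
proof -
  have A': "adjoint_mat A = A" "A ** A = A" "rtrace A = real k" using A by (auto simp: Proj_iff_rtrace)
  have U': "adjoint_mat U ** U = mat 1" using U by (simp add: unitary_mat_def)
  have "(U ** A ** adjoint_mat U) ** (U ** A ** adjoint_mat U)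
      = U ** (A ** ((adjoint_mat U ** U) ** (A ** adjoint_mat U)))"
    by (simp only: matrix_mul_assoc)
  also have "\<dots> = U ** A ** adjoint_mat U"
    unfolding U' matrix_mul_lid by (simp only: matrix_mul_assoc) (simp only: A' flip: matrix_mul_assoc)
  finally have "(U ** A ** adjoint_mat U) ** (U ** A ** adjoint_mat U) = U ** A ** adjoint_mat U" .
  moreover have "rtrace (U ** A ** adjoint_mat U) = rtrace A"
    using rtrace_commute[of "U ** A" "adjoint_mat U"] U' by (simp add: matrix_mul_assoc)
  moreover have "adjoint_mat (U ** A ** adjoint_mat U) = U ** A ** adjoint_mat U"
    by (simp add: adjoint_mat_mult A' matrix_mul_assoc)
  ultimately show ?thesis using A' by (simp add: Proj_iff_rtrace)
qed

lemma form_conjugate: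
  "v \<bullet> ((U ** A ** adjoint_mat U) *v w) = (adjoint_mat U *v v) \<bullet> (A *v (adjoint_mat U *v w))"
  by (simp add: inner_adjoint_mat[of v U] flip: matrix_vector_mul_assoc)

lemma form_scalar:
  "(c *s v) \<bullet> (A *v (c *s v)) = (norm c)\<^sup>2 * (v \<bullet> (A *v (v :: 'f::real_or_complex^'d)))"
proof -
  have "(c *s v) \<bullet> (A *v (c *s v)) = v \<bullet> ((c * fconj c) *s (A *v v))"
    by (simp add: inner_scalar_left matrix_vector_scalar mult.commute)
  also have "\<dots> = (norm c)\<^sup>2 * (v \<bullet> (A *v v))"
    unfolding mult_fconj scaleR_eq_scalar[symmetric] by simp
  finally show ?thesis .
qed

lemma borel_measurable_form [measurable]:
  "(\<lambda>A :: 'f::real_or_complex^'d^'d. v \<bullet> (A *v w)) \<in> borel_measurable borel"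
  by (intro borel_measurable_continuous_onI continuous_intros
      bounded_bilinear.continuous_on[OF bounded_bilinear_matrix_vector])

lemma borel_measurable_rtrace_mult [measurable]:
  "(\<lambda>A :: 'f::real_or_complex^'d^'d. rtrace (A ** X)) \<in> borel_measurable borel"
  by (intro borel_measurable_continuous_onI bounded_linear.continuous_on[OF bounded_linear_rtrace]
     bounded_bilinear.continuous_on[OF bounded_bilinear_matrix_mult] continuous_intros)

locale uniform_projection =
  fixes n :: nat and N :: "('f::real_or_complex^'d^'d) measure"
  assumes n: "1 \<le> n" and card: "CARD('d) = 2 * n" and uniform: "uniform_on_Proj n N"
begin

lemma prob_space_N: "prob_space N"
  using uniform by (simp add: uniform_on_Proj_def)

sublocale prob_space N by (rule prob_space_N)

lemma sets_N: "sets N = sets (proj_space n)"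
  using uniform by (simp add: uniform_on_Proj_def)

lemma space_N: "space N = Proj n"
  using sets_eq_imp_space_eq[OF sets_N] by (simp add: proj_space_def space_restrict_space)

lemma measurable_N: "f \<in> borel_measurable borel \<Longrightarrow> f \<in> borel_measurable N"
  unfolding measurable_cong_sets[OF sets_N refl] proj_space_def by (rule measurable_restrict_space1)

lemma expectation_conjugate:
  fixes f :: "'f^'d^'d \<Rightarrow> real"
  assumes U: "unitary_mat U" and f: "f \<in> borel_measurable N"
  shows "(\<integral>A. f (U ** A ** adjoint_mat U) \<partial>N) = (\<integral>A. f A \<partial>N)"
proof -
  have "(\<lambda>A. U ** A ** adjoint_mat U) \<in> borel_measurable borel"
    by (intro borel_measurable_continuous_onI continuous_intros
        bounded_bilinear.continuous_on[OF bounded_bilinear_matrix_mult])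
  then have "(\<lambda>A. U ** A ** adjoint_mat U) \<in> proj_space n \<rightarrow>\<^sub>M (proj_space n :: ('f^'d^'d) measure)"
    unfolding proj_space_def using Proj_conjugate[OF U] by (intro measurable_restrict_space3) auto
  then have m: "(\<lambda>A. U ** A ** adjoint_mat U) \<in> N \<rightarrow>\<^sub>M (proj_space n :: ('f^'d^'d) measure)"
    by (simp add: measurable_cong_sets[OF sets_N refl])
  have f': "f \<in> borel_measurable (proj_space n)"
    using f by (simp add: measurable_cong_sets[OF sets_N refl])
  have "distr N (proj_space n) (\<lambda>A. U ** A ** adjoint_mat U) = N"
    using uniform U by (simp add: uniform_on_Proj_def)
  then show ?thesis using integral_distr[OF m f'] by simp
qed

text \<open>
  All functions of the random projection that occur are measurable and bounded; this class of
  functions is closed under the algebraic operations and consists of integrable functions.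
\<close>

definition bdd_meas :: "('f^'d^'d \<Rightarrow> real) \<Rightarrow> bool" where
  "bdd_meas f \<longleftrightarrow> f \<in> borel_measurable N \<and> (\<exists>C. \<forall>A\<in>Proj n. \<bar>f A\<bar> \<le> C)"

lemma bdd_meas_integrable: "bdd_meas f \<Longrightarrow> integrable N f"
  unfolding bdd_meas_def
  by (metis AE_I2 integrable_const_bound real_norm_def space_N)

lemma bdd_meas_const [intro]: "bdd_meas (\<lambda>_. c)"
  by (auto simp: bdd_meas_def)

lemma bdd_meas_add [intro]:
  assumes "bdd_meas f" "bdd_meas g" shows "bdd_meas (\<lambda>A. f A + g A)"
proof -
  obtain C D where "\<forall>A\<in>Proj n. \<bar>f A\<bar> \<le> C" "\<forall>A\<in>Proj n. \<bar>g A\<bar> \<le> D"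
    using assms by (auto simp: bdd_meas_def)
  then have "\<forall>A\<in>Proj n. \<bar>f A + g A\<bar> \<le> C + D" by (meson abs_triangle_ineq add_mono order_trans)
  then show ?thesis using assms unfolding bdd_meas_def by (blast intro: borel_measurable_add)
qed

lemma bdd_meas_mult [intro]:
  assumes "bdd_meas f" "bdd_meas g" shows "bdd_meas (\<lambda>A. f A * g A)"
proof -
  obtain C D where "\<forall>A\<in>Proj n. \<bar>f A\<bar> \<le> C" "\<forall>A\<in>Proj n. \<bar>g A\<bar> \<le> D"
    using assms by (auto simp: bdd_meas_def)
  then have "\<forall>A\<in>Proj n. \<bar>f A * g A\<bar> \<le> C * D"
    by (simp add: abs_mult) (meson abs_ge_zero mult_mono order_trans)
  then show ?thesis using assms unfolding bdd_meas_def by (blast intro: borel_measurable_times)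
qed

lemma bdd_meas_diff [intro]:
  assumes "bdd_meas f" "bdd_meas g" shows "bdd_meas (\<lambda>A. f A - g A)"
  using bdd_meas_add[OF assms(1) bdd_meas_mult[OF bdd_meas_const[of "-1"] assms(2)]] by simp

lemma bdd_meas_sum [intro]:
  "(\<And>i. i \<in> S \<Longrightarrow> bdd_meas (f i)) \<Longrightarrow> bdd_meas (\<lambda>A. \<Sum>i\<in>S. f i A)"
  by (induction S rule: infinite_finite_induct) auto

lemma bdd_meas_power [intro]: "bdd_meas f \<Longrightarrow> bdd_meas (\<lambda>A. f A ^ k)"
  by (induction k) auto

lemma norm_Proj_le: "A \<in> Proj k \<Longrightarrow> norm (A *v v) \<le> norm (v :: 'f^'d)"
  using projection_form_bounds(2)[of A v] projection_form[of A v]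
  by (simp add: Proj_iff_rtrace)

lemma bdd_meas_form [intro]: "bdd_meas (\<lambda>A. v \<bullet> (A *v w))"
proof -
  have "\<bar>v \<bullet> (A *v w)\<bar> \<le> norm v * norm w" if "A \<in> Proj n" for A
    using Cauchy_Schwarz_ineq2[of v "A *v w"] norm_Proj_le[OF that, of w]
    by (meson mult_left_mono norm_ge_zero order_trans)
  then show ?thesis unfolding bdd_meas_def using measurable_N[OF borel_measurable_form] by blast
qed

section \<open>The distribution of the diagonal entries\<close>

text \<open>By unitary invariance all moments of \<open>\<langle>v, A v\<rangle>\<close> depend on \<open>v\<close> through its length only.\<close>

lemma moment_homogeneous:
  assumes x: "norm x = 1"
  shows "(\<integral>A. (v \<bullet> (A *v v)) ^ j \<partial>N) = (\<integral>A. (x \<bullet> (A *v x)) ^ j \<partial>N) * (norm v) ^ (2 * j)"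
proof (cases "v = 0")
  case True
  then show ?thesis by (cases j) (simp_all add: prob_space)
next
  case False
  define u where "u = (1 / norm v) *\<^sub>R v"
  have v: "v = norm v *\<^sub>R u" and "norm x = norm u" using False x by (simp_all add: u_def)
  then obtain U c where U: "unitary_mat U" "adjoint_mat U = U" and c: "norm c = 1" and Ux: "U *v x = c *s u"
    by (metis exists_unitary_moving)
  have "(\<integral>A. (x \<bullet> (A *v x)) ^ j \<partial>N) = (\<integral>A. ((U *v x) \<bullet> (A *v (U *v x))) ^ j \<partial>N)"
  proof -
    have "x \<bullet> ((U ** A ** U) *v x) = (U *v x) \<bullet> (A *v (U *v x))" for A
      using form_conjugate[of x U A x] U(2) by simp
    then show ?thesis
      using expectation_conjugate[OF U(1), of "\<lambda>A. (x \<bullet> (A *v x)) ^ j"] U(2)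
        bdd_meas_power[OF bdd_meas_form[of x x], of j]
      by (simp add: bdd_meas_def)
  qed
  also have "\<dots> = (\<integral>A. (u \<bullet> (A *v u)) ^ j \<partial>N)"
    using c by (simp add: Ux form_scalar)
  finally have *: "(\<integral>A. (x \<bullet> (A *v x)) ^ j \<partial>N) = (\<integral>A. (u \<bullet> (A *v u)) ^ j \<partial>N)" .
  have "(v \<bullet> (A *v v)) ^ j = (norm v) ^ (2 * j) * (u \<bullet> (A *v u)) ^ j" for A
    by (subst (1 2) v) (simp add: matrix_vector_scaleR power_mult power2_eq_square power_mult_distrib)
  then show ?thesis by (simp add: *)
qed

end

lemma coeff_quadratic_power:
  fixes t p q :: "'a::comm_ring_1"
  shows "coeff ([:t, p, q:] ^ k) 0 = t ^ k"
    "coeff ([:t, p, q:] ^ k) 1 = of_nat k * t ^ (k - 1) * p"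
    "coeff ([:t, p, q:] ^ k) 2 = of_nat k * t ^ (k - 1) * q + of_nat (k choose 2) * t ^ (k - 2) * p ^ 2"
proof -
  have c: "coeff ([:t, p, q:] * F) 0 = t * coeff F 0"
    "coeff ([:t, p, q:] * F) (Suc 0) = t * coeff F 1 + p * coeff F 0"
    "coeff ([:t, p, q:] * F) (Suc (Suc 0)) = t * coeff F 2 + p * coeff F 1 + q * coeff F 0" for F
    by (simp_all add: numeral_2_eq_2)
  show A: "coeff ([:t, p, q:] ^ k) 0 = t ^ k" for k
    by (induction k) (simp_all add: c)
  show B: "coeff ([:t, p, q:] ^ k) 1 = of_nat k * t ^ (k - 1) * p" for k
  proof (induction k)
    case (Suc k)
    have "coeff ([:t, p, q:] ^ Suc k) 1 = t * (of_nat k * t ^ (k - 1) * p) + p * t ^ k"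
      using Suc by (simp add: c A)
    then show ?case by (cases k) (simp_all add: algebra_simps)
  qed simp
  show "coeff ([:t, p, q:] ^ k) 2 = of_nat k * t ^ (k - 1) * q + of_nat (k choose 2) * t ^ (k - 2) * p ^ 2"
  proof (induction k)
    case (Suc k)
    have S: "coeff ([:t, p, q:] ^ Suc k) 2 =
        t * (of_nat k * t ^ (k - 1) * q + of_nat (k choose 2) * t ^ (k - 2) * p ^ 2)
        + p * (of_nat k * t ^ (k - 1) * p) + q * t ^ k"
      using Suc by (simp add: c A B[simplified] numeral_2_eq_2)
    then show ?case
    proof (cases k)
      case k: (Suc i)
      show ?thesis
      proof (cases i)
        case (Suc i')
        have "Suc k choose 2 = (k choose 2) + k" by (simp add: numeral_2_eq_2)
        then show ?thesis using S unfolding k Suc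
          by (simp add: algebra_simps power2_eq_square)
      qed (use k S in \<open>simp_all add: power2_eq_square numeral_2_eq_2 algebra_simps\<close>)
    qed (simp_all add: numeral_2_eq_2)
  qed (simp add: numeral_2_eq_2)
qed

context uniform_projection
begin

lemma bdd_meas_coeff:
  assumes "bdd_meas t" "bdd_meas p" "bdd_meas q"
  shows "bdd_meas (\<lambda>A. coeff ([:t A, p A, q A:] ^ k) i)"
proof (induction k arbitrary: i)
  case 0
  then show ?case by (cases "i = 0") (simp_all add: bdd_meas_const)
next
  case (Suc k)
  have "bdd_meas (\<lambda>A. coeff [:t A, p A, q A:] j)" for j
  proof -
    consider "j = 0" | "j = Suc 0" | "j = Suc (Suc 0)" | i where "j = Suc (Suc (Suc i))"
      by (metis not0_implies_Suc)
    then show ?thesis by cases (use assms in \<open>simp_all add: bdd_meas_const\<close>)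
  qed
  then show ?case unfolding power_Suc coeff_mult by (intro bdd_meas_sum bdd_meas_mult Suc)
qed

text \<open>
  The identity \<open>E \<langle>u, A u\<rangle>\<^sup>k = M\<^sub>k |u|\<^sup>2\<^sup>k\<close> is one between polynomials in \<open>u\<close>. Taking the Laplacian of both
  sides at the unit vector \<open>x\<close>, that is, adding up the coefficients of \<open>\<epsilon>\<^sup>2\<close> in \<open>u = x + \<epsilon> b\<close> over an
  orthonormal basis, turns the left-hand side into a multiple of \<open>M\<^sub>k\<^sub>-\<^sub>1\<close>: the trace of \<open>A\<close> is known,
  and \<open>|A x|\<^sup>2 = \<langle>x, A x\<rangle>\<close>.
\<close>

lemma moment_recursion:
  fixes x :: "'f^'d"
  defines "s \<equiv> field_beta TYPE('f) * real n"
  assumes x: "norm x = 1"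
  shows "(s + real i) * (\<integral>A. (x \<bullet> (A *v x)) ^ i \<partial>N) = (2 * s + real i) * (\<integral>A. (x \<bullet> (A *v x)) ^ Suc i \<partial>N)"
proof -
  define k where "k = Suc i"
  define M where "M = (\<lambda>j. \<integral>A. (x \<bullet> (A *v x)) ^ j \<partial>N)"
  define F where "F = (\<lambda>b A. [:x \<bullet> (A *v x), 2 * (b \<bullet> (A *v x)), b \<bullet> (A *v b):] ^ k)"
  have herm: "adjoint_mat A = A" "A ** A = A" "rtrace A = real n" if "A \<in> Proj n" for A :: "'f^'d^'d"
    using that by (auto simp: Proj_iff_rtrace)
  have bF: "bdd_meas (\<lambda>A. coeff (F b A) j)" for b j
    unfolding F_def by (intro bdd_meas_coeff) auto
  have coeff2: "(\<integral>A. coeff (F b A) 2 \<partial>N) = M k * coeff ([:1, 2 * (x \<bullet> b), 1:] ^ k) 2" if b: "b \<in> Basis" for b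
  proof -
    have deg: "degree (F b A) \<le> 2 * k" for A
      unfolding F_def by (rule order_trans[OF degree_power_le]) (simp add: degree_pCons_eq_if)
    have pF: "poly (F b A) \<epsilon> = (\<Sum>j\<le>2*k. coeff (F b A) j * \<epsilon> ^ j)" for A \<epsilon>
      by (subst poly_as_sum_of_monoms'[OF deg, symmetric]) (simp add: poly_sum poly_monom)
    define G where "G = (\<Sum>j\<le>2*k. monom (\<integral>A. coeff (F b A) j \<partial>N) j)"
    have "poly G \<epsilon> = poly (smult (M k) ([:1, 2 * (x \<bullet> b), 1:] ^ k)) \<epsilon>" for \<epsilon>
    proof -
      have "poly G \<epsilon> = (\<integral>A. poly (F b A) \<epsilon> \<partial>N)"
        unfolding pF G_def by (subst Bochner_Integration.integral_sum)
          (auto simp: poly_sum poly_monom intro!: bdd_meas_integrable bF bdd_meas_mult)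
      also have "\<dots> = (\<integral>A. ((x + \<epsilon> *\<^sub>R b) \<bullet> (A *v (x + \<epsilon> *\<^sub>R b))) ^ k \<partial>N)"
      proof (rule Bochner_Integration.integral_cong[OF refl])
        fix A assume "A \<in> space N"
        then have "x \<bullet> (A *v b) = b \<bullet> (A *v x)"
          using inner_adjoint_mat[of x A b] herm(1)[of A] by (simp add: space_N inner_commute)
        then show "poly (F b A) \<epsilon> = ((x + \<epsilon> *\<^sub>R b) \<bullet> (A *v (x + \<epsilon> *\<^sub>R b))) ^ k"
          by (simp add: F_def matrix_vector_right_distrib matrix_vector_scaleR inner_add_left inner_add_right
              algebra_simps)
      qed
      also have "\<dots> = M k * norm (x + \<epsilon> *\<^sub>R b) ^ (2 * k)"
        unfolding M_def by (rule moment_homogeneous[OF x])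
      finally have G: "poly G \<epsilon> = M k * norm (x + \<epsilon> *\<^sub>R b) ^ (2 * k)" .
      have "(norm (x + \<epsilon> *\<^sub>R b))\<^sup>2 = 1 + \<epsilon> * (2 * (x \<bullet> b)) + \<epsilon> * \<epsilon>"
        using x b by (simp add: power2_norm_eq_inner inner_add_left inner_add_right inner_commute
            norm_eq_1 algebra_simps)
      then have "norm (x + \<epsilon> *\<^sub>R b) ^ (2 * k) = (1 + \<epsilon> * (2 * (x \<bullet> b)) + \<epsilon> * \<epsilon>) ^ k"
        by (simp only: power_mult)
      then show ?thesis by (simp add: G algebra_simps)
    qed
    then have "G = smult (M k) ([:1, 2 * (x \<bullet> b), 1:] ^ k)" by (simp add: poly_eq_poly_eq_iff[symmetric] fun_eq_iff)
    then have "coeff G 2 = M k * coeff ([:1, 2 * (x \<bullet> b), 1:] ^ k) 2" by simp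
    moreover have "coeff G 2 = (\<integral>A. coeff (F b A) 2 \<partial>N)"
    proof -
      have "2 \<le> 2 * k" by (simp add: k_def)
      then show ?thesis by (simp add: G_def coeff_sum)
    qed
    ultimately show ?thesis by simp
  qed
  have ch: "real (k choose 2) = real k * real i / 2"
    unfolding k_def by (induction i) (simp_all add: numeral_2_eq_2 field_simps)
  have DIM: "real DIM('f) * real n = 2 * s" by (simp add: s_def field_beta_def)
  have parseval: "(\<Sum>b\<in>Basis. (b \<bullet> v)\<^sup>2) = (norm v)\<^sup>2" for v :: "'f^'d"
    unfolding power2_norm_eq_inner euclidean_inner[of v v] by (simp add: power2_eq_square inner_commute)
  have "(\<Sum>b\<in>Basis. coeff (F b A) 2) = real k * (2 * s + 2 * real i) * (x \<bullet> (A *v x)) ^ i"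
    if A: "A \<in> Proj n" for A
  proof -
    define t where "t = x \<bullet> (A *v x)"
    have "(\<Sum>b\<in>Basis. coeff (F b A) 2) =
       real k * t ^ (k - 1) * (\<Sum>b\<in>Basis. b \<bullet> (A *v b)) + real (k choose 2) * t ^ (k - 2) * (4 * (\<Sum>b\<in>Basis. (b \<bullet> (A *v x))\<^sup>2))"
      unfolding F_def coeff_quadratic_power t_def
      by (simp add: sum.distrib sum_distrib_left power_mult_distrib)
    also have "(\<Sum>b\<in>Basis. (b \<bullet> (A *v x))\<^sup>2) = t"
      unfolding parseval t_def using projection_form[OF herm(1,2)[OF A]] by simp
    also have "(\<Sum>b\<in>Basis. b \<bullet> (A *v b)) = 2 * s"
      by (simp add: real_trace_eq herm[OF A] DIM)
    also have "real (k choose 2) * t ^ (k - 2) * (4 * t) = real k * (2 * real i) * t ^ i"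
      unfolding ch by (cases i) (simp_all add: k_def)
    finally show ?thesis by (simp add: k_def t_def algebra_simps)
  qed
  then have "(\<integral>A. (\<Sum>b\<in>Basis. coeff (F b A) 2) \<partial>N) = (\<integral>A. real k * (2 * s + 2 * real i) * (x \<bullet> (A *v x)) ^ i \<partial>N)"
    by (intro Bochner_Integration.integral_cong) (auto simp: space_N)
  then have "real k * (2 * s + 2 * real i) * M i = (\<Sum>b\<in>Basis. (\<integral>A. coeff (F b A) 2 \<partial>N))"
    by (simp add: M_def Bochner_Integration.integral_sum[OF bdd_meas_integrable[OF bF]])
  also have "\<dots> = (\<Sum>b\<in>Basis. M k * coeff ([:1, 2 * (x \<bullet> b), 1:] ^ k) 2)"
    by (rule sum.cong[OF refl]) (rule coeff2)
  also have "\<dots> = M k * (real k * real DIM('f^'d) + real (k choose 2) * (4 * (\<Sum>b\<in>Basis. (b \<bullet> x)\<^sup>2)))"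
    unfolding coeff_quadratic_power
    by (simp add: sum.distrib power_mult_distrib inner_commute flip: sum_distrib_left)
  also have "\<dots> = M k * (real k * (4 * s + 2 * real i))"
    using DIM x by (simp add: parseval ch card algebra_simps)
  finally have "real k * ((2 * s + 2 * real i) * M i) = real k * ((4 * s + 2 * real i) * M k)"
    by (simp add: mult_ac)
  then have "(2 * s + 2 * real i) * M i = (4 * s + 2 * real i) * M k"
    unfolding k_def by (subst (asm) mult_cancel_left) auto
  then show ?thesis by (simp add: M_def k_def algebra_simps)
qed

lemma moment_eq_Beta:
  fixes x :: "'f^'d"
  defines "s \<equiv> field_beta TYPE('f) * real n"
  assumes x: "norm x = 1"
  shows "(\<integral>A. (x \<bullet> (A *v x)) ^ i \<partial>N) = Beta (s + real i) s / Beta s s"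
proof -
  have s: "s > 0" using n by (simp add: s_def field_beta_def)
  have B: "Beta s s > 0" using s by (simp add: Beta_def Gamma_real_pos)
  show ?thesis
  proof (induction i)
    case 0
    then show ?case using B by (simp add: prob_space)
  next
    case (Suc i)
    have "s + real i \<notin> \<int>\<^sub>\<le>\<^sub>0" using s nonpos_Ints_nonpos[of "s + real i"] by force
    then have "(s + real i + s) * Beta (s + real i + 1) s = (s + real i) * Beta (s + real i) s"
      by (rule Beta_plus1_left)
    then have "Beta (s + real (Suc i)) s = (s + real i) / (2 * s + real i) * Beta (s + real i) s"
      using s by (simp add: field_simps)
    moreover have "(\<integral>A. (x \<bullet> (A *v x)) ^ Suc i \<partial>N) = (s + real i) / (2 * s + real i) * (\<integral>A. (x \<bullet> (A *v x)) ^ i \<partial>N)"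
      using moment_recursion[OF x, of i] s unfolding s_def[symmetric]
      by (simp add: field_simps)
    ultimately show ?case using Suc by simp
  qed
qed

end

text \<open>
  The function \<open>t\<^sup>s (1 - t)\<^sup>s / (2 s)\<close> is an antiderivative of \<open>(1/2 - t)\<close> times the Beta weight.
\<close>

lemma has_integral_abs_Beta:
  fixes s :: real
  assumes s: "s > 0"
  shows "((\<lambda>t. \<bar>t - 1/2\<bar> * (t powr (s - 1) * (1 - t) powr (s - 1))) has_integral 1 / (s * 4 powr s)) {0..1}"
proof -
  define F where "F = (\<lambda>t :: real. t powr s * (1 - t) powr s / (2 * s))"
  define f where "f = (\<lambda>t :: real. (1/2 - t) * (t powr (s - 1) * (1 - t) powr (s - 1)))"
  have cont: "continuous_on {0..1} F"
    unfolding F_def using s by (intro continuous_intros continuous_on_powr') auto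
  have der: "(F has_vector_derivative f t) (at t)" if "t \<in> {0<..<1}" for t
  proof -
    have "(F has_real_derivative f t) (at t)"
      unfolding F_def using that s
      by (auto intro!: derivative_eq_intros simp: f_def powr_diff field_simps)
    then show ?thesis by (simp add: has_real_derivative_iff_has_vector_derivative)
  qed
  have half: "F (1/2) = 1 / (2 * s * 4 powr s)"
  proof -
    have "(1/2) powr s * (1/2) powr s = (1/4) powr s" for s :: real by (simp flip: powr_mult)
    then show ?thesis by (simp add: F_def powr_divide)
  qed
  have "(f has_integral (F (1/2) - F 0)) {0..1/2}"
    by (rule fundamental_theorem_of_calculus_interior) (use der in \<open>auto intro: continuous_on_subset[OF cont]\<close>)
  then have 1: "((\<lambda>t. \<bar>t - 1/2\<bar> * (t powr (s - 1) * (1 - t) powr (s - 1))) has_integral 1 / (2 * s * 4 powr s)) {0..1/2}"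
    using s by (subst has_integral_cong[of _ _ f]) (auto simp: f_def half, simp add: F_def)
  have "(f has_integral (F 1 - F (1/2))) {1/2..1}"
    by (rule fundamental_theorem_of_calculus_interior) (use der in \<open>auto intro: continuous_on_subset[OF cont]\<close>)
  then have "((\<lambda>t. - f t) has_integral - (F 1 - F (1/2))) {1/2..1}" by (rule has_integral_neg)
  then have 2: "((\<lambda>t. \<bar>t - 1/2\<bar> * (t powr (s - 1) * (1 - t) powr (s - 1))) has_integral 1 / (2 * s * 4 powr s)) {1/2..1}"
    using s by (subst has_integral_cong[of _ _ "\<lambda>t. - f t"]) (auto simp: f_def half algebra_simps, simp add: F_def)
  have "((\<lambda>t. \<bar>t - 1/2\<bar> * (t powr (s - 1) * (1 - t) powr (s - 1))) has_integral
      (1 / (2 * s * 4 powr s) + 1 / (2 * s * 4 powr s))) {0..1}"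
    by (rule has_integral_combine[OF _ _ 1 2]) auto
  also have "1 / (2 * s * 4 powr s) + 1 / (2 * s * 4 powr s) = 1 / (s * 4 powr s)" by (simp add: field_simps)
  finally show ?thesis .
qed

context uniform_projection
begin

text \<open>
  The diagonal entry \<open>\<langle>x, A x\<rangle>\<close> has the moments of a Beta distribution, and polynomials are uniformly
  dense in the continuous functions on \<open>[0, 1]\<close>.
\<close>

lemma mean_abs_deviation:
  fixes x :: "'f^'d"
  assumes x: "norm x = 1"
  shows "(\<integral>A. \<bar>x \<bullet> (A *v x) - 1/2\<bar> \<partial>N) = mu1 (field_beta TYPE('f)) n - 1/2"
proof -
  define s where "s = field_beta TYPE('f) * real n"
  have s: "s > 0" using n by (simp add: s_def field_beta_def)
  define B where "B = Beta s s"
  have B: "B > 0" using s by (simp add: B_def Beta_def Gamma_real_pos)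
  define w where "w = (\<lambda>t :: real. t powr (s - 1) * (1 - t) powr (s - 1))"
  define J where "J = 1 / (s * 4 powr s)"
  define E where "E = (\<integral>A. \<bar>x \<bullet> (A *v x) - 1/2\<bar> \<partial>N)"
  have wB: "(w has_integral B) {0..1}"
    using has_integral_Beta_real[of s s] s by (simp add: w_def B_def)
  have wJ: "((\<lambda>t. \<bar>t - 1/2\<bar> * w t) has_integral J) {0..1}"
    using has_integral_abs_Beta[OF s] by (simp add: w_def J_def)
  have w0: "w t \<ge> 0" for t by (simp add: w_def)
  have t01: "x \<bullet> (A *v x) \<in> {0..1}" if "A \<in> space N" for A
    using projection_form_bounds[of A x] that x by (auto simp: space_N Proj_iff_rtrace)
  have bt: "bdd_meas (\<lambda>A. \<bar>x \<bullet> (A *v x) - 1/2\<bar>)"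
  proof -
    have "\<bar>\<bar>x \<bullet> (A *v x) - 1/2\<bar>\<bar> \<le> 1" if "A \<in> Proj n" for A
      using t01[of A] that by (auto simp: space_N)
    moreover have "(\<lambda>A. \<bar>x \<bullet> (A *v x) - 1/2\<bar>) \<in> borel_measurable N"
      by (rule measurable_N) measurable
    ultimately show ?thesis unfolding bdd_meas_def by blast
  qed
  have "\<bar>E * B - J\<bar> \<le> 2 * e * B" if e: "e > 0" for e
  proof -
    have "continuous_on {0..1::real} (\<lambda>t. \<bar>t - 1/2\<bar>)" by (intro continuous_intros)
    then obtain p where p: "real_polynomial_function p" and app: "\<And>t. t \<in> {0..1} \<Longrightarrow> \<bar>\<bar>t - 1/2\<bar> - p t\<bar> < e"
      using Stone_Weierstrass_real_polynomial_function[OF compact_Icc _ e] by metis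
    from real_polynomial_function_imp_sum[OF p] obtain a k where
      pa: "p = (\<lambda>t. \<Sum>i\<le>k. a i * t ^ i)" by blast
    have bp: "bdd_meas (\<lambda>A. p (x \<bullet> (A *v x)))"
      unfolding pa
      by (intro bdd_meas_sum bdd_meas_mult[OF bdd_meas_const] bdd_meas_power bdd_meas_form)
    have Ep: "(\<integral>A. p (x \<bullet> (A *v x)) \<partial>N) = (\<Sum>i\<le>k. a i * Beta (s + real i) s) / B"
    proof -
      have "(\<integral>A. p (x \<bullet> (A *v x)) \<partial>N) = (\<Sum>i\<le>k. a i * (\<integral>A. (x \<bullet> (A *v x)) ^ i \<partial>N))"
        unfolding pa by (subst Bochner_Integration.integral_sum) (auto intro!: bdd_meas_integrable)
      then show ?thesis
        by (simp add: moment_eq_Beta[OF x] sum_divide_distrib flip: s_def B_def)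
    qed
    have "((\<lambda>t. p t * w t) has_integral (\<Sum>i\<le>k. a i * Beta (s + real i) s)) {0..1}"
    proof -
      have "((\<lambda>t. t ^ i * w t) has_integral Beta (s + real i) s) {0..1}" for i
      proof -
        have Beta_i: "((\<lambda>t. t powr (s + real i - 1) * (1 - t) powr (s - 1)) has_integral Beta (s + real i) s) {0..1}"
          using s by (intro has_integral_Beta_real) auto
        have "t powr (s + real i - 1) * (1 - t) powr (s - 1) = t ^ i * w t" if "t \<in> {0..1}" for t
        proof (cases "t = 0")
          case False
          then have "t ^ i = t powr real i" using that by (simp add: powr_realpow)
          then have "t powr (s + real i - 1) = t powr (s - 1) * t ^ i"
            by (simp flip: powr_add) (simp add: algebra_simps)
          then show ?thesis by (simp add: w_def)
        qed (simp add: w_def)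
        then show ?thesis by (rule has_integral_eq[OF _ Beta_i])
      qed
      then have "((\<lambda>t. \<Sum>i\<le>k. a i * (t ^ i * w t)) has_integral (\<Sum>i\<le>k. a i * Beta (s + real i) s)) {0..1}"
        by (intro has_integral_sum has_integral_mult_right) auto
      then show ?thesis by (simp add: pa sum_distrib_right mult.assoc)
    qed
    then have pw: "((\<lambda>t. p t * w t) has_integral (\<integral>A. p (x \<bullet> (A *v x)) \<partial>N) * B) {0..1}"
      using B by (simp add: Ep)
    define P where "P = (\<integral>A. p (x \<bullet> (A *v x)) \<partial>N)"
    have "J \<le> P * B + e * B"
    proof (rule has_integral_le[OF wJ has_integral_add[OF pw[folded P_def] has_integral_mult_right[OF wB, of e]]])
      fix t :: real assume "t \<in> {0..1}"
      then have "\<bar>t - 1/2\<bar> \<le> p t + e" using app[of t] by linarith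
      then have "\<bar>t - 1/2\<bar> * w t \<le> (p t + e) * w t" using w0 by (intro mult_right_mono) auto
      then show "\<bar>t - 1/2\<bar> * w t \<le> p t * w t + e * w t" by (simp add: algebra_simps)
    qed
    moreover have "P * B - e * B \<le> J"
    proof (rule has_integral_le[OF has_integral_diff[OF pw[folded P_def] has_integral_mult_right[OF wB, of e]] wJ])
      fix t :: real assume "t \<in> {0..1}"
      then have "p t - e \<le> \<bar>t - 1/2\<bar>" using app[of t] by linarith
      then have "(p t - e) * w t \<le> \<bar>t - 1/2\<bar> * w t" using w0 by (intro mult_right_mono) auto
      then show "p t * w t - e * w t \<le> \<bar>t - 1/2\<bar> * w t" by (simp add: algebra_simps)
    qed
    moreover have "\<bar>E - P\<bar> \<le> e"
    proof -
      have "E - P = (\<integral>A. \<bar>x \<bullet> (A *v x) - 1/2\<bar> - p (x \<bullet> (A *v x)) \<partial>N)"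
        unfolding E_def P_def using bt bp
        by (intro Bochner_Integration.integral_diff[symmetric] bdd_meas_integrable)
      also have "\<bar>\<dots>\<bar> \<le> (\<integral>A. \<bar>\<bar>x \<bullet> (A *v x) - 1/2\<bar> - p (x \<bullet> (A *v x))\<bar> \<partial>N)"
        by (rule integral_abs_bound)
      also have "\<dots> \<le> (\<integral>A. e \<partial>N)"
      proof (rule integral_mono)
        show "integrable N (\<lambda>A. \<bar>\<bar>x \<bullet> (A *v x) - 1/2\<bar> - p (x \<bullet> (A *v x))\<bar>)"
          using bdd_meas_diff[OF bt bp] by (intro integrable_abs bdd_meas_integrable)
        show "\<bar>\<bar>x \<bullet> (A *v x) - 1/2\<bar> - p (x \<bullet> (A *v x))\<bar> \<le> e" if "A \<in> space N" for A
          using app[OF t01[OF that]] by simp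
      qed simp
      finally show ?thesis by (simp add: prob_space)
    qed
    then have "\<bar>E - P\<bar> * B \<le> e * B" using B by simp
    then have "\<bar>E * B - P * B\<bar> \<le> e * B" using B by (simp add: abs_mult flip: left_diff_distrib)
    ultimately show ?thesis by linarith
  qed
  then have "\<bar>E * B - J\<bar> \<le> 0 + e" if "e > 0" for e
    using that B \<open>\<And>e. e > 0 \<Longrightarrow> \<bar>E * B - J\<bar> \<le> 2 * e * B\<close>[of "e / (2 * B)"] by simp
  then have "\<bar>E * B - J\<bar> \<le> 0" by (rule field_le_epsilon)
  then have "E = J / B" using B by (simp add: field_simps)
  then show ?thesis
    by (simp add: E_def J_def B_def mu1_def s_def)
qed

end

section \<open>The mean of an oriented random projection\<close>

text \<open>
  These are the summands of the program's matrix for the uncorrupted measurements of \<open>x x\<^sup>*\<close>.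
\<close>

definition oriented :: "'f::real_or_complex^'d \<Rightarrow> 'f^'d^'d \<Rightarrow> 'f^'d^'d" where
  "oriented x A = (if 1/2 \<le> x \<bullet> (A *v x) then A else mat 1 - A)"

lemma oriented_in_Proj:
  assumes "CARD('d) = 2 * n" "(A :: 'f::real_or_complex^'d^'d) \<in> Proj n"
  shows "oriented x A \<in> Proj n"
  using assms by (simp add: oriented_def Proj_iff_rtrace matrix_mult_diff)

lemma oriented_diagonal:
  assumes "norm x = 1"
  shows "x \<bullet> (oriented x A *v x) = 1/2 + \<bar>x \<bullet> (A *v x) - 1/2\<bar>"
  using assms by (simp add: oriented_def matrix_vector_mult_diff_rdistrib inner_diff_right norm_eq_1)

lemma oriented_conjugate:
  assumes U: "adjoint_mat U = U" "U ** U = mat 1" "U *v x = x"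
  shows "oriented x (U ** A ** U) = U ** oriented x A ** U"
proof -
  have "x \<bullet> ((U ** A ** U) *v x) = x \<bullet> (A *v x)"
    using form_conjugate[of x U A x] U by simp
  moreover have "mat 1 - U ** A ** U = U ** (mat 1 - A) ** U"
    using U(2) by (simp add: matrix_mult_diff)
  ultimately show ?thesis by (simp add: oriented_def)
qed

lemma borel_measurable_oriented [measurable]:
  "oriented x \<in> borel_measurable (borel :: ('f::real_or_complex^'d^'d) measure)"
proof -
  have "(\<lambda>A :: 'f^'d^'d. if 1/2 \<le> x \<bullet> (A *v x) then A else mat 1 - A) \<in> borel_measurable borel"
    by measurable
  then show ?thesis by (simp add: oriented_def[abs_def])
qed

text \<open>
  The mean of \<open>|t - 1/2|\<close> when \<open>t\<close> has the Beta distribution with parameters \<open>s\<close> and \<open>s\<close>.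
\<close>

definition deviation :: "real \<Rightarrow> real" where
  "deviation s = 1 / (s * 4 powr s * Beta s s)"

lemma mu_deviation:
  "mu1 \<beta> n = 1/2 + deviation (\<beta> * real n)"
  "mu2 \<beta> n = 1/2 - deviation (\<beta> * real n) / (2 * real n - 1)"
  by (simp_all add: mu1_def mu2_def deviation_def mult_ac)

text \<open>
  A matrix with the simple eigenvalue \<open>mu1\<close> and the eigenvalue \<open>mu2\<close> of multiplicity \<open>2 n - 1\<close> has the
  same trace as the projections of rank \<open>n\<close>; so \<open>mu2\<close> can be recognized from \<open>mu1\<close>.
\<close>

lemma trace_condition:
  assumes "1 \<le> n"
  shows "mu1 \<beta> n + mu2 \<beta> n * (2 * real n - 1) = real n"
  using assms by (simp add: mu_deviation field_simps)

definition centered :: "nat \<Rightarrow> 'f::real_or_complex^'d \<Rightarrow> 'f^'d^'d \<Rightarrow> 'f^'d^'d" where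
  "centered n x A = oriented x A -
     (mu2 (field_beta TYPE('f)) n *\<^sub>R mat 1 +
      (mu1 (field_beta TYPE('f)) n - mu2 (field_beta TYPE('f)) n) *\<^sub>R outer x)"

lemma borel_measurable_centered [measurable]: "centered n x \<in> borel_measurable borel"
  unfolding centered_def[abs_def] by measurable

context uniform_projection
begin

lemma bdd_meas_oriented: "bdd_meas (\<lambda>A. v \<bullet> (oriented x A *v w))"
proof -
  have "\<bar>v \<bullet> (oriented x A *v w)\<bar> \<le> norm v * norm w" if "A \<in> Proj n" for A
    using Cauchy_Schwarz_ineq2[of v "oriented x A *v w"] norm_Proj_le[OF oriented_in_Proj[OF card that], of x w]
    by (meson mult_left_mono norm_ge_zero order_trans)
  moreover have "(\<lambda>A. v \<bullet> (oriented x A *v w)) \<in> borel_measurable N"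
    by (rule measurable_N) (rule measurable_compose[OF borel_measurable_oriented borel_measurable_form])
  ultimately show ?thesis unfolding bdd_meas_def by blast
qed

text \<open>
  The law of the oriented projection is invariant under the unitaries that fix \<open>x\<close>. The reflection
  along \<open>w\<close> shows that the mean has no cross terms between \<open>x\<close> and \<open>w \<bottom> x\<close>, and transitivity on the
  vectors orthogonal to \<open>x\<close> makes it a multiple of the identity there. The two remaining numbers
  are the mean diagonal entry at \<open>x\<close> and the one prescribed by the trace.
\<close>

lemma mean_oriented:
  fixes x :: "'f^'d"
  defines "\<beta> \<equiv> field_beta TYPE('f)"
  assumes x: "norm x = 1"
  shows "(\<integral>A. v \<bullet> (oriented x A *v v) \<partial>N) =
    mu2 \<beta> n * (norm v)\<^sup>2 + (mu1 \<beta> n - mu2 \<beta> n) * (norm (hdot x v))\<^sup>2"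
proof -
  define g where "g = (\<lambda>v. \<integral>A. v \<bullet> (oriented x A *v v) \<partial>N)"
  have int: "integrable N (\<lambda>A. v \<bullet> (oriented x A *v w))" for v w
    by (rule bdd_meas_integrable[OF bdd_meas_oriented])
  have inv: "g (U *v v) = g v" if U: "unitary_mat U" "adjoint_mat U = U" "U *v x = x" for U v
  proof -
    have "v \<bullet> (oriented x (U ** A ** adjoint_mat U) *v v) = (U *v v) \<bullet> (oriented x A *v (U *v v))" for A
      using oriented_conjugate[of U x A] U form_conjugate[of v U "oriented x A" v]
      by (simp add: unitary_mat_def)
    then show ?thesis
      using expectation_conjugate[OF U(1), of "\<lambda>A. v \<bullet> (oriented x A *v v)"] bdd_meas_oriented[of v x v]
      by (simp add: g_def bdd_meas_def)
  qed
  have scal: "g (c *s v) = (norm c)\<^sup>2 * g v" for c v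
    by (simp add: g_def form_scalar)
  have para: "g (u + w) + g (u - w) = 2 * (g u + g w)" for u w
  proof -
    have "g (u + w) + g (u - w) = (\<integral>A. (u + w) \<bullet> (oriented x A *v (u + w)) + (u - w) \<bullet> (oriented x A *v (u - w)) \<partial>N)"
      unfolding g_def by (rule Bochner_Integration.integral_add[symmetric]) (rule int)+
    also have "\<dots> = (\<integral>A. 2 * (u \<bullet> (oriented x A *v u)) + 2 * (w \<bullet> (oriented x A *v w)) \<partial>N)"
      by (simp add: matrix_vector_right_distrib matrix_vector_mult_diff_distrib inner_add_left
          inner_add_right inner_diff_left inner_diff_right)
    also have "\<dots> = 2 * (g u + g w)"
      unfolding g_def by (simp add: int)
    finally show ?thesis .
  qed
  have gx: "g x = mu1 \<beta> n"
  proof -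
    have "g x = (\<integral>A. 1/2 + \<bar>x \<bullet> (A *v x) - 1/2\<bar> \<partial>N)"
      by (simp add: g_def oriented_diagonal[OF x])
    also have "\<dots> = 1/2 + (\<integral>A. \<bar>x \<bullet> (A *v x) - 1/2\<bar> \<partial>N)"
    proof -
      have "integrable N (\<lambda>A. 1/2 + \<bar>x \<bullet> (A *v x) - 1/2\<bar>)"
        using int[of x x] by (simp add: oriented_diagonal[OF x])
      then have "integrable N (\<lambda>A. (1/2 + \<bar>x \<bullet> (A *v x) - 1/2\<bar>) - 1/2)"
        by (rule Bochner_Integration.integrable_diff) simp
      then have "integrable N (\<lambda>A. \<bar>x \<bullet> (A *v x) - 1/2\<bar>)" by simp
      then show ?thesis by (simp add: prob_space)
    qed
    finally show ?thesis by (simp add: mean_abs_deviation[OF x] \<beta>_def)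
  qed
  have eq: "g w = g w'" if w: "norm w = norm w'" "hdot x w = 0" "hdot x w' = 0" for w w'
  proof -
    obtain U c where U: "unitary_mat U" "adjoint_mat U = U" and c: "norm c = 1" "U *v w = c *s w'"
      and fix_: "\<And>v. hdot w v = 0 \<Longrightarrow> hdot w' v = 0 \<Longrightarrow> U *v v = v"
      using exists_unitary_moving[OF w(1)] by metis
    have "hdot w x = 0" "hdot w' x = 0"
      using w fconj_hdot[of x w] fconj_hdot[of x w'] by (simp_all add: fconj_0)
    then have "U *v x = x" by (rule fix_)
    then have "g w = g (c *s w')" using inv[OF U, of w] c by simp
    then show ?thesis using scal[of c w'] c by simp
  qed
  obtain \<gamma> where \<gamma>: "\<And>w. hdot x w = 0 \<Longrightarrow> g w = \<gamma> * (norm w)\<^sup>2"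
  proof (cases "\<exists>w0. norm w0 = 1 \<and> hdot x w0 = 0")
    case True
    then obtain w0 where w0: "norm w0 = 1" "hdot x w0 = 0" by auto
    have "g w = g w0 * (norm w)\<^sup>2" if "hdot x w = 0" for w
    proof -
      have "g w = g (of_real (norm w) *s w0)"
        using w0 that by (intro eq) (simp_all add: norm_scalar hdot_linear)
      then show ?thesis by (simp add: scal)
    qed
    then show ?thesis by (rule that)
  next
    case False
    have "w = 0" if "hdot x w = 0" for w
    proof (rule ccontr)
      assume "w \<noteq> 0"
      then have "norm (of_real (1 / norm w) *s w) = 1" "hdot x (of_real (1 / norm w) *s w) = 0"
        using that by (simp_all add: norm_scalar hdot_linear norm_divide)
      then show False using False by blast
    qed
    then have "g w = 0 * (norm w)\<^sup>2" if "hdot x w = 0" for w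
      using \<open>\<And>w. hdot x w = 0 \<Longrightarrow> w = 0\<close>[OF that] by (simp only: g_def) simp
    then show ?thesis by (rule that)
  qed
  have decomp: "g v = mu1 \<beta> n * (norm (hdot x v))\<^sup>2 + \<gamma> * ((norm v)\<^sup>2 - (norm (hdot x v))\<^sup>2)" for v
  proof -
    define u where "u = hdot x v *s x"
    define w where "w = v - u"
    have xw: "hdot x w = 0" using x by (simp add: w_def u_def hdot_linear hdot_self)
    have split: "g (u + w) = g u + g w"
    proof (cases "w = 0")
      case False
      have "reflection w *v x = x"
        using fconj_hdot[of x w] xw by (simp add: reflection_vector fconj_0)
      moreover have "reflection w *v (u + w) = u - w"
      proof -
        have "hdot w (u + w) = of_real ((norm w)\<^sup>2)"
          using fconj_hdot[of x w] xw by (simp add: u_def hdot_linear hdot_self fconj_0)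
        then have "reflection w *v (u + w) = u + w - (2 / (norm w)\<^sup>2 * (norm w)\<^sup>2) *\<^sub>R w"
          by (simp only: reflection_vector scaleR_eq_scalar[symmetric] scaleR_scaleR)
        then show ?thesis using False by (simp add: scaleR_2)
      qed
      ultimately have "g (u - w) = g (u + w)"
        using inv[OF unitary_reflection[OF False] adjoint_reflection, of "u + w"] by simp
      then show ?thesis using para[of u w] by simp
    qed (simp add: g_def)
    have "(norm v)\<^sup>2 = (norm u)\<^sup>2 + (norm w)\<^sup>2"
    proof -
      have "u \<bullet> w = 0" using xw re_part_hdot[of u w] by (simp add: u_def hdot_linear)
      then have "(norm (u + w))\<^sup>2 = (norm u)\<^sup>2 + (norm w)\<^sup>2"
        by (simp add: power2_norm_eq_inner inner_add_left inner_add_right inner_commute)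
      then show ?thesis by (simp add: w_def)
    qed
    moreover have "norm u = norm (hdot x v)" using x by (simp add: u_def norm_scalar)
    moreover have "g v = g u + g w" using split by (simp add: w_def)
    moreover have "g u = (norm (hdot x v))\<^sup>2 * mu1 \<beta> n" by (simp add: u_def scal gx)
    ultimately show ?thesis using \<gamma>[OF xw] by (simp add: mult.commute)
  qed
  have "\<gamma> = mu2 \<beta> n"
  proof -
    have par: "(\<Sum>b\<in>Basis. (norm (hdot x b))\<^sup>2) = real DIM('f)"
      using real_trace_eq[of "outer x"] x by (simp add: inner_outer rtrace_outer)
    have "(\<Sum>b\<in>Basis. g b) = (\<integral>A. (\<Sum>b\<in>Basis. b \<bullet> (oriented x A *v b)) \<partial>N)"
      unfolding g_def by (rule Bochner_Integration.integral_sum[symmetric]) (rule int)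
    also have "\<dots> = (\<integral>A. real DIM('f) * real n \<partial>N)"
      using oriented_in_Proj[OF card]
      by (intro Bochner_Integration.integral_cong refl) (auto simp: real_trace_eq space_N Proj_iff_rtrace)
    also have "\<dots> = real DIM('f) * real n" by (simp add: prob_space)
    also have "(\<Sum>b\<in>Basis. g b) = mu1 \<beta> n * real DIM('f) + \<gamma> * (real DIM('f^'d) - real DIM('f))"
      unfolding decomp by (simp add: sum.distrib sum_subtractf par flip: sum_distrib_left)
    also have "\<dots> = real DIM('f) * (mu1 \<beta> n + \<gamma> * (2 * real n - 1))"
      by (simp add: card algebra_simps)
    finally have "mu1 \<beta> n + \<gamma> * (2 * real n - 1) = real n" by simp
    then have "\<gamma> * (2 * real n - 1) = mu2 \<beta> n * (2 * real n - 1)"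
      using trace_condition[OF n, of \<beta>] by linarith
    then show ?thesis using n by simp
  qed
  then show ?thesis using decomp[of v] by (simp add: g_def algebra_simps)
qed

lemma adjoint_centered: "(A :: 'f^'d^'d) \<in> Proj n \<Longrightarrow> adjoint_mat (centered n x A) = centered n x A"
  using oriented_in_Proj[OF card, of A x] by (simp add: centered_def Proj_iff_rtrace)

lemma centered_form:
  fixes x :: "'f^'d"
  shows "v \<bullet> (centered n x A *v v) = v \<bullet> (oriented x A *v v) -
    (mu2 (field_beta TYPE('f)) n * (norm v)\<^sup>2 +
      (mu1 (field_beta TYPE('f)) n - mu2 (field_beta TYPE('f)) n) * (norm (hdot x v))\<^sup>2)"
  by (simp add: centered_def matrix_vector_mult_diff_rdistrib matrix_vector_mult_add_rdistrib
     scaleR_matrix_vector inner_diff_right inner_add_right inner_outer power2_norm_eq_inner)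

lemma integrable_centered_form: "integrable N (\<lambda>A :: 'f^'d^'d. v \<bullet> (centered n x A *v v))"
  unfolding centered_form by (intro bdd_meas_integrable bdd_meas_diff bdd_meas_oriented bdd_meas_const)

lemma mean_centered:
  fixes x :: "'f^'d"
  assumes x: "norm x = 1" and B: "B \<in> Basis"
  shows "(\<integral>A. centered n x A \<bullet> B \<partial>N) = 0"
proof -
  have z: "(\<integral>A. v \<bullet> (centered n x A *v v) \<partial>N) = 0" for v
    unfolding centered_form
      Bochner_Integration.integral_diff[OF bdd_meas_integrable[OF bdd_meas_oriented] integrable_const]
      mean_oriented[OF x] by (simp add: prob_space)
  obtain i j b where B': "B = axis i (axis j b)" and b: "b \<in> Basis"
    using B by (auto simp: Basis_vec_def)
  define u :: "'f^'d" where "u = axis i b"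
  define w :: "'f^'d" where "w = axis j 1"
  have "centered n x A \<bullet> B = ((u + w) \<bullet> (centered n x A *v (u + w)) - (u - w) \<bullet> (centered n x A *v (u - w))) / 4"
    if A: "A \<in> Proj n" for A
  proof -
    have "centered n x A \<bullet> B = u \<bullet> (centered n x A *v w)"
    proof -
      have "u \<bullet> (centered n x A *v w) = b \<bullet> centered n x A $ i $ j"
        by (simp only: u_def w_def inner_axis' matrix_vector_axis mult_1_right)
      moreover have "centered n x A \<bullet> B = centered n x A $ i $ j \<bullet> b"
        by (simp only: B' inner_axis)
      ultimately show ?thesis using inner_commute[of b "centered n x A $ i $ j"] by (simp only:)
    qed
    moreover have "w \<bullet> (centered n x A *v u) = u \<bullet> (centered n x A *v w)"
      using inner_adjoint_mat[of w "centered n x A" u] inner_commute[of "centered n x A *v w" u]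
      by (simp only: adjoint_centered[OF A])
    moreover have "(u + w) \<bullet> (centered n x A *v (u + w)) - (u - w) \<bullet> (centered n x A *v (u - w))
        = 2 * (u \<bullet> (centered n x A *v w)) + 2 * (w \<bullet> (centered n x A *v u))"
      by (simp only: matrix_vector_right_distrib matrix_vector_mult_diff_distrib inner_add_left
          inner_add_right inner_diff_left inner_diff_right)
    moreover have "p = q \<Longrightarrow> r = q \<Longrightarrow> s - t = 2 * q + 2 * r \<Longrightarrow> p = (s - t) / 4" for p q r s t :: real
      by simp
    ultimately show ?thesis by blast
  qed
  then have "(\<integral>A. centered n x A \<bullet> B \<partial>N) =
    (\<integral>A. ((u + w) \<bullet> (centered n x A *v (u + w)) - (u - w) \<bullet> (centered n x A *v (u - w))) / 4 \<partial>N)"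
    by (rule Bochner_Integration.integral_cong[OF refl]) (simp only: space_N)
  also have "\<dots> = 0"
    by (simp only: integral_divide_zero z
        Bochner_Integration.integral_diff[OF integrable_centered_form integrable_centered_form]) simp
  finally show ?thesis .
qed

end

section \<open>Size of the centred projections\<close>

lemma Beta_pos: "s > 0 \<Longrightarrow> Beta s s > (0 :: real)"
  by (simp add: Beta_def Gamma_real_pos)

lemma deviation_pos: "s > 0 \<Longrightarrow> deviation s > 0"
  by (simp add: deviation_def Beta_pos)

lemma deviation_plus1:
  assumes s: "s > 0"
  shows "deviation (s + 1) = deviation s * ((2 * s + 1) / (2 * s + 2))"
proof -
  have ni: "s \<notin> \<int>\<^sub>\<le>\<^sub>0" using s nonpos_Ints_nonpos[of s] by force
  have 1: "(s + (s + 1)) * Beta (s + 1) (s + 1) = s * Beta s (s + 1)"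
    using Beta_plus1_left[OF ni, of "s + 1"] .
  have 2: "(s + s) * Beta s (s + 1) = s * Beta s s"
    using Beta_plus1_right[OF ni, of s] .
  have "Beta s (s + 1) = Beta s s / 2" using 2 s by (simp add: field_simps)
  then have "(2 * s + 1) * Beta (s + 1) (s + 1) = s * (Beta s s / 2)"
    using 1 by (simp add: add.assoc[symmetric])
  moreover have "2 * s + 1 \<noteq> 0" using s by simp
  ultimately have E: "Beta (s + 1) (s + 1) = s * (Beta s s / 2) / (2 * s + 1)"
    by (subst nonzero_eq_divide_eq) (simp_all only: mult.commute not_False_eq_True)
  show ?thesis
    unfolding deviation_def E using s Beta_pos[OF s] by (simp add: powr_add divide_simps) (simp add: algebra_simps)
qed

text \<open>
  The recursion shows that \<open>deviation\<close> decreases in steps of one, so the values at \<open>s = 1\<close> and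
  \<open>s = 3/2\<close> are decisive. They are \<open>1/4\<close> and \<open>2 / (3 \<pi>)\<close>.
\<close>

lemma deviation_le_quarter: "k \<ge> 2 \<Longrightarrow> deviation (real k / 2) \<le> 1/4"
proof (induction k rule: less_induct)
  case (less k)
  have dec: "deviation (s + 1) \<le> deviation s" if "s > 0" for s
  proof -
    have "(2 * s + 1) / (2 * s + 2) \<le> 1" using that by simp
    then show ?thesis
      unfolding deviation_plus1[OF that] using deviation_pos[OF that] by (intro mult_left_le) auto
  qed
  consider "k = 2" | "k = 3" | "k \<ge> 4" using less.prems by linarith
  then show ?case
  proof cases
    case 1
    have "Beta 1 1 = (1 :: real)" by (simp add: Beta_def Gamma_numeral)
    then show ?thesis by (simp add: 1 deviation_def)
  next
    case 2
    have "Beta (1/2) (1/2) = pi" by (simp add: Beta_def Gamma_one_half_real)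
    moreover have "4 powr (1/2) = (2 :: real)" by (simp add: powr_half_sqrt)
    ultimately have "deviation (1/2) = 1 / pi" by (simp add: deviation_def)
    then have "deviation (real k / 2) = 1 / pi * (2/3)"
      using deviation_plus1[of "1/2"] by (simp add: 2)
    moreover have "1 / pi \<le> 3/8" using pi_approx by (simp add: divide_le_eq)
    then have "1 / pi * (2/3) \<le> 3/8 * (2/3)" by (rule mult_right_mono) simp
    ultimately show ?thesis by simp
  next
    case 3
    have "deviation (real k / 2) = deviation (real (k - 2) / 2 + 1)" using 3 by (simp add: field_simps)
    also have "\<dots> \<le> deviation (real (k - 2) / 2)" using 3 by (intro dec) simp
    also have "\<dots> \<le> 1/4" using 3 by (intro less.IH) auto
    finally show ?thesis .
  qed
qed

lemma mu_gap_pos: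
  assumes "1 \<le> n" "\<beta> > 0"
  shows "mu1 \<beta> n - mu2 \<beta> n > 0"
  using deviation_pos[of "\<beta> * real n"] assms by (simp add: mu_deviation add_pos_pos)

context uniform_projection
begin

text \<open>
  Let \<open>P\<close> be the oriented projection. For \<open>n = 1\<close> it has rank one and \<open>(P - X)\<^sup>2 \<le> I / 2\<close>, since
  \<open>tr (P X) \<ge> 1/2\<close>. So the cross term in the square of the difference of \<open>P - I / 2\<close> and a positive multiple
  of \<open>X - I / 2\<close> has a favourable sign, and the bound is \<open>1/4 + a\<^sup>2 \<le> 1/2\<close> with \<open>a = mu1 - 1/2\<close>. For larger \<open>n\<close> the triangle
  inequality gives \<open>(1/2 + a)\<^sup>2 \<le> 9/16\<close>.
\<close>

lemma norm_centered_le: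
  fixes x :: "'f^'d"
  assumes x: "norm x = 1" and A: "A \<in> Proj n"
  shows "(norm (centered n x A *v v))\<^sup>2 \<le> 7/12 * (norm v)\<^sup>2"
proof -
  define s where "s = field_beta TYPE('f) * real n"
  define a where "a = deviation s"
  define b where "b = a / (2 * real n - 1)"
  have s: "s > 0" using n by (simp add: s_def field_beta_def)
  have a0: "a > 0" using deviation_pos[OF s] by (simp add: a_def)
  have mu: "mu1 (field_beta TYPE('f)) n = 1/2 + a" "mu2 (field_beta TYPE('f)) n = 1/2 - b"
    by (simp_all add: mu_deviation a_def b_def s_def)
  have b: "0 \<le> b" "b \<le> a" using a0 n by (auto simp: b_def field_simps)
  define P where "P = oriented x A"
  have P: "P \<in> Proj n" using oriented_in_Proj[OF card A] by (simp add: P_def)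
  then have P': "adjoint_mat P = P" "P ** P = P" by (auto simp: Proj_iff_rtrace)
  define X where "X = outer x"
  have X': "adjoint_mat X = X" "X ** X = X" using x outer_idem by (simp_all add: X_def)
  define p where "p = P *v v - (1/2) *\<^sub>R v"
  have p2: "(norm p)\<^sup>2 = 1/4 * (norm v)\<^sup>2"
  proof -
    have "(norm p)\<^sup>2 = (norm (P *v v))\<^sup>2 - v \<bullet> (P *v v) + 1/4 * (norm v)\<^sup>2"
      by (simp add: p_def power2_norm_eq_inner inner_diff_left inner_diff_right inner_commute algebra_simps)
    then show ?thesis using projection_form[OF P', of v] by simp
  qed
  define y where "y = X *v v"
  define z where "z = v - y"
  have yz: "y \<bullet> z = 0"
    using projection_form[OF X', of v] by (simp add: z_def y_def inner_diff_right power2_norm_eq_inner inner_commute)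
  have vyz: "(norm v)\<^sup>2 = (norm y)\<^sup>2 + (norm z)\<^sup>2"
  proof -
    have "(norm (y + z))\<^sup>2 = (norm y)\<^sup>2 + (norm z)\<^sup>2"
      using yz by (simp add: power2_norm_eq_inner inner_add_left inner_add_right inner_commute)
    then show ?thesis by (simp add: z_def)
  qed
  define q where "q = a *\<^sub>R y - b *\<^sub>R z"
  have Zv: "centered n x A *v v = p - q"
    by (simp add: centered_def mu p_def q_def z_def y_def P_def X_def matrix_vector_mult_diff_rdistrib
        matrix_vector_mult_add_rdistrib scaleR_matrix_vector algebra_simps)
  have q2: "(norm q)\<^sup>2 = a\<^sup>2 * (norm y)\<^sup>2 + b\<^sup>2 * (norm z)\<^sup>2"
    unfolding q_def power2_norm_eq_inner using yz
    by (simp add: inner_diff_left inner_diff_right inner_commute power2_eq_square algebra_simps)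
  also have "\<dots> \<le> a\<^sup>2 * (norm y)\<^sup>2 + a\<^sup>2 * (norm z)\<^sup>2"
    using b by (intro add_mono mult_right_mono power_mono) auto
  finally have q2': "(norm q)\<^sup>2 \<le> a\<^sup>2 * (norm v)\<^sup>2" by (simp add: vyz algebra_simps)
  show ?thesis
  proof (cases "n = 1")
    case False
    have "1 \<le> DIM('f)" by (simp add: Suc_leI)
    moreover have "2 \<le> n" using False n by simp
    ultimately have "1 * 2 \<le> DIM('f) * n" by (rule mult_le_mono)
    then have "deviation (real (DIM('f) * n) / 2) \<le> 1/4" by (intro deviation_le_quarter) simp
    moreover have "s = real (DIM('f) * n) / 2" by (simp add: s_def field_beta_def)
    ultimately have a4: "a \<le> 1/4" by (simp only: a_def)
    have "(norm p)\<^sup>2 \<le> (1/2 * norm v)\<^sup>2" unfolding p2 by (simp add: power2_eq_square)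
    then have "norm p \<le> 1/2 * norm v" by (rule power2_le_imp_le) simp
    moreover have "(norm q)\<^sup>2 \<le> (a * norm v)\<^sup>2" unfolding power_mult_distrib by (rule q2')
    then have "norm q \<le> a * norm v" by (rule power2_le_imp_le) (use a0 in simp)
    moreover have "a * norm v \<le> 1/4 * norm v" using a4 by (intro mult_right_mono) auto
    ultimately have "norm (p - q) \<le> 3/4 * norm v"
      using norm_triangle_ineq4[of p q] by linarith
    then have "(norm (p - q))\<^sup>2 \<le> (3/4 * norm v)\<^sup>2" by (intro power_mono) auto
    also have "\<dots> = 9/16 * (norm v)\<^sup>2" by (simp add: power2_eq_square)
    also have "\<dots> \<le> 7/12 * (norm v)\<^sup>2" by simp
    finally show ?thesis by (simp add: Zv)
  next
    case True
    then have ab: "b = a" by (simp add: b_def)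
    have ahalf: "a \<le> 1/2"
    proof -
      have "mu1 (field_beta TYPE('f)) n - 1/2 = (\<integral>A. \<bar>x \<bullet> (A *v x) - 1/2\<bar> \<partial>N)"
        by (rule mean_abs_deviation[OF x, symmetric])
      also have "\<dots> \<le> (\<integral>A. 1/2 \<partial>N)"
      proof (rule integral_mono_AE')
        show "AE A in N. \<bar>x \<bullet> (A *v x) - 1/2\<bar> \<le> 1/2"
        proof (rule AE_I2)
          fix A assume "A \<in> space N"
          then have "0 \<le> x \<bullet> (A *v x)" "x \<bullet> (A *v x) \<le> (norm x)\<^sup>2"
            using projection_form_bounds[of A x] by (simp_all add: space_N Proj_iff_rtrace)
          moreover have "0 \<le> t \<Longrightarrow> t \<le> 1 \<Longrightarrow> \<bar>t - 1/2\<bar> \<le> 1/2" for t :: real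
            by (rule abs_leI) auto
          ultimately show "\<bar>x \<bullet> (A *v x) - 1/2\<bar> \<le> 1/2" using x by simp
        qed
      qed auto
      finally show ?thesis by (simp add: mu prob_space)
    qed
    have "P \<in> Proj 1" using P by (simp only: True)
    then obtain y' where y': "norm y' = 1" "P = outer y'"
      unfolding Proj_1_eq by auto
    have "(norm (hdot x y'))\<^sup>2 \<ge> 1/2"
    proof -
      have "x \<bullet> (P *v x) \<ge> 1/2" unfolding P_def oriented_diagonal[OF x] by simp
      moreover have "norm (hdot y' x) = norm (hdot x y')" by (metis fconj_hdot norm_fconj)
      ultimately show ?thesis by (simp add: y' inner_outer)
    qed
    then have g1: "sqrt (1 - (norm (hdot x y'))\<^sup>2) \<le> sqrt (1/2)" by simp
    have "norm ((P - X) *v v) \<le> sqrt (1 - (norm (hdot x y'))\<^sup>2) * norm v"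
      unfolding y' X_def by (rule norm_outer_diff_le[OF x y'(1)])
    also have "\<dots> \<le> sqrt (1/2) * norm v" by (rule mult_right_mono[OF g1]) simp
    finally have "(norm ((P - X) *v v))\<^sup>2 \<le> (sqrt (1/2) * norm v)\<^sup>2" by (intro power_mono) auto
    then have d: "(norm ((P - X) *v v))\<^sup>2 \<le> 1/2 * (norm v)\<^sup>2"
      by (simp add: power_mult_distrib)
    \<comment> \<open>\<open>p\<close> and \<open>r\<close> are half the images of \<open>v\<close> under two reflections\<close>
    define r where "r = y - (1/2) *\<^sub>R v"
    have r2: "(norm r)\<^sup>2 = 1/4 * (norm v)\<^sup>2"
    proof -
      have "(norm r)\<^sup>2 = (norm (X *v v))\<^sup>2 - v \<bullet> (X *v v) + 1/4 * (norm v)\<^sup>2"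
        by (simp add: r_def y_def power2_norm_eq_inner inner_diff_left inner_diff_right inner_commute algebra_simps)
      then show ?thesis using projection_form[OF X', of v] by simp
    qed
    have "p - r = (P - X) *v v" by (simp add: p_def r_def y_def matrix_vector_mult_diff_rdistrib)
    then have "(norm (p - r))\<^sup>2 \<le> 1/2 * (norm v)\<^sup>2" using d by simp
    moreover have "(norm (p - r))\<^sup>2 = (norm p)\<^sup>2 + (norm r)\<^sup>2 - 2 * (p \<bullet> r)"
      by (simp add: power2_norm_eq_inner inner_diff_left inner_diff_right inner_commute)
    ultimately have pr: "p \<bullet> r \<ge> 0" using p2 r2 by linarith
    have "(2 * a) *\<^sub>R y = a *\<^sub>R y + a *\<^sub>R y"
      unfolding mult_2 by (rule scaleR_left_distrib)
    then have pq: "p - q = p - (2 * a) *\<^sub>R r"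
      by (simp add: q_def ab r_def z_def scaleR_diff_right)
    have "(norm (p - c *\<^sub>R r))\<^sup>2 = (norm p)\<^sup>2 + c\<^sup>2 * (norm r)\<^sup>2 - 2 * c * (p \<bullet> r)" for c
      unfolding power2_norm_eq_inner
      by (simp add: inner_diff_left inner_diff_right inner_commute power2_eq_square algebra_simps)
    then have "(norm (p - q))\<^sup>2 = (norm p)\<^sup>2 + (2 * a)\<^sup>2 * (norm r)\<^sup>2 - 2 * (2 * a) * (p \<bullet> r)"
      unfolding pq .
    also have "\<dots> \<le> (norm p)\<^sup>2 + (2 * a)\<^sup>2 * (norm r)\<^sup>2" using pr a0 by simp
    also have "\<dots> = (1/4 + a\<^sup>2) * (norm v)\<^sup>2" by (simp add: p2 r2 power_mult_distrib algebra_simps)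
    also have "\<dots> \<le> 7/12 * (norm v)\<^sup>2"
    proof (intro mult_right_mono)
      have "a\<^sup>2 \<le> (1/2)\<^sup>2" using ahalf a0 by (intro power_mono) auto
      then show "1/4 + a\<^sup>2 \<le> 7/12" by (simp add: power2_eq_square)
    qed simp
    finally show ?thesis by (simp add: Zv)
  qed
qed

end

section \<open>A trace inequality for powers of Hermitian matrices\<close>

primrec mpow :: "'f::real_or_complex^'d^'d \<Rightarrow> nat \<Rightarrow> 'f^'d^'d" where
  "mpow M 0 = mat 1"
| "mpow M (Suc k) = M ** mpow M k"

lemma mpow_add: "mpow M (j + k) = mpow M j ** mpow M k"
  by (induction j) (simp_all add: matrix_mul_assoc)

lemma mpow_Suc_right: "mpow M (Suc k) = mpow M k ** M"
  using mpow_add[of M k 1] by simp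

lemma adjoint_mpow: "adjoint_mat M = M \<Longrightarrow> adjoint_mat (mpow M k) = mpow M k"
proof (induction k)
  case (Suc k)
  then have "adjoint_mat (mpow M (Suc k)) = mpow M k ** M" by (simp add: adjoint_mat_mult)
  then show ?case by (simp only: mpow_Suc_right)
qed simp

lemma continuous_on_mpow: "continuous_on UNIV (\<lambda>M :: 'f::real_or_complex^'d^'d. mpow M k)"
  by (induction k)
     (auto intro!: continuous_intros bounded_bilinear.continuous_on[OF bounded_bilinear_matrix_mult])

lemma rtrace_mpow_even:
  assumes "adjoint_mat M = M"
  shows "rtrace (mpow M (2 * k)) = mpow M k \<bullet> mpow M k"
  using rtrace_adjoint_mult[of "mpow M k" "mpow M k"] adjoint_mpow[OF assms, of k]
  by (simp add: mult_2 mpow_add)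

text \<open>
  Left multiplication by \<open>B\<close> acts on each column separately, so that bounds for the length of \<open>B v\<close> become
  bounds for Hilbert-Schmidt norms of products.
\<close>

lemma inner_matrix_columns:
  "A \<bullet> A = (\<Sum>j\<in>UNIV. (norm (A *v axis j 1))\<^sup>2)" for A :: "'f::real_or_complex^'d^'d"
proof -
  have "A \<bullet> A = (\<Sum>i\<in>UNIV. \<Sum>j\<in>UNIV. (A *v axis j 1) $ i \<bullet> (A *v axis j 1) $ i)"
    by (simp add: inner_vec_def matrix_vector_axis)
  also have "\<dots> = (\<Sum>j\<in>UNIV. \<Sum>i\<in>UNIV. (A *v axis j 1) $ i \<bullet> (A *v axis j 1) $ i)"
    by (rule sum.swap)
  also have "\<dots> = (\<Sum>j\<in>UNIV. (norm (A *v axis j 1))\<^sup>2)"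
    by (intro sum.cong refl) (simp only: power2_norm_eq_inner inner_vec_def[of "_ *v _"])
  finally show ?thesis .
qed

lemma inner_matrix_mult_le:
  fixes A B :: "'f::real_or_complex^'d^'d"
  assumes "\<And>v. (norm (B *v v))\<^sup>2 \<le> c * (norm v)\<^sup>2"
  shows "(B ** A) \<bullet> (B ** A) \<le> c * (A \<bullet> A)"
  unfolding inner_matrix_columns sum_distrib_left
  by (intro sum_mono) (simp add: assms flip: matrix_vector_mul_assoc)

lemma inner_matrix_mult_ge:
  fixes A B :: "'f::real_or_complex^'d^'d"
  assumes "\<And>v. c * (norm v)\<^sup>2 \<le> (norm (B *v v))\<^sup>2"
  shows "c * (A \<bullet> A) \<le> (B ** A) \<bullet> (B ** A)"
  unfolding inner_matrix_columns sum_distrib_left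
  by (intro sum_mono) (simp add: assms flip: matrix_vector_mul_assoc)

lemma power2_norm_vec: "(norm v)\<^sup>2 = (\<Sum>i\<in>UNIV. (norm (v $ i))\<^sup>2)" for v :: "'a::real_inner^'d"
  by (simp only: power2_norm_eq_inner inner_vec_def)

lemma norm_matrix_vector_le: "norm (A *v v) \<le> norm A * norm (v :: 'f::real_or_complex^'d)"
proof -
  have "(norm (A *v v))\<^sup>2 \<le> (norm A * norm v)\<^sup>2"
  proof -
    have "(norm (A *v v))\<^sup>2 = (\<Sum>i\<in>UNIV. (norm ((A *v v) $ i))\<^sup>2)"
      by (rule power2_norm_vec)
    also have "\<dots> \<le> (\<Sum>i\<in>UNIV. (norm (A $ i))\<^sup>2 * (norm v)\<^sup>2)"
    proof (rule sum_mono)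
      fix i
      have "norm ((A *v v) $ i) \<le> (\<Sum>j\<in>UNIV. norm (A$i$j) * norm (v$j))"
        unfolding matrix_vector_mult_def by (simp add: sum_norm_le norm_mult)
      also have "\<dots> \<le> norm (A $ i) * norm v"
        unfolding norm_vec_def by (rule L2_set_mult_ineq[THEN order_trans[rotated]]) simp
      finally have "(norm ((A *v v) $ i))\<^sup>2 \<le> (norm (A $ i) * norm v)\<^sup>2"
        by (intro power_mono) auto
      then show "(norm ((A *v v) $ i))\<^sup>2 \<le> (norm (A $ i))\<^sup>2 * (norm v)\<^sup>2"
        by (simp add: power_mult_distrib)
    qed
    also have "\<dots> = (norm A * norm v)\<^sup>2"
      unfolding power_mult_distrib power2_norm_vec[of A] sum_distrib_right ..
    finally show ?thesis .
  qed
  then show ?thesis by (rule power2_le_imp_le) simp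
qed

text \<open>
  Jensen's inequality \<open>\<langle>v, M v\<rangle>\<^sup>N \<le> \<langle>v, M\<^sup>N v\<rangle>\<close> for a power \<open>N\<close> of two follows by repeated use of
  \<open>\<langle>v, A v\<rangle>\<^sup>2 \<le> |A v|\<^sup>2 = \<langle>v, A\<^sup>2 v\<rangle>\<close>.
\<close>

lemma form_power_le_rtrace:
  fixes M :: "'f::real_or_complex^'d^'d"
  assumes M: "adjoint_mat M = M" and v: "norm v = 1" and pos: "0 \<le> v \<bullet> (M *v v)"
  shows "(v \<bullet> (M *v v)) ^ (2 ^ Suc q) \<le> rtrace (mpow M (2 ^ Suc q))"
proof -
  have sq: "(v \<bullet> (mpow M k *v v))\<^sup>2 \<le> (norm (mpow M k *v v))\<^sup>2" for k
  proof -
    have "\<bar>v \<bullet> (mpow M k *v v)\<bar> \<le> norm (mpow M k *v v)"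
      using Cauchy_Schwarz_ineq2[of v "mpow M k *v v"] v by simp
    then have "\<bar>v \<bullet> (mpow M k *v v)\<bar>\<^sup>2 \<le> (norm (mpow M k *v v))\<^sup>2" by (rule power_mono) simp
    then show ?thesis by simp
  qed
  have dbl: "(norm (mpow M k *v v))\<^sup>2 = v \<bullet> (mpow M (2 * k) *v v)" for k
    using inner_adjoint_mat[of v "mpow M k" "mpow M k *v v"] adjoint_mpow[OF M, of k]
    by (simp add: power2_norm_eq_inner mult_2 mpow_add matrix_vector_mul_assoc)
  have J: "(v \<bullet> (M *v v)) ^ (2 ^ q) \<le> v \<bullet> (mpow M (2 ^ q) *v v)" for q
  proof (induction q)
    case (Suc q)
    have "(v \<bullet> (M *v v)) ^ (2 ^ Suc q) = ((v \<bullet> (M *v v)) ^ (2 ^ q))\<^sup>2"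
      by (simp add: power_mult[symmetric] mult.commute)
    also have "\<dots> \<le> (v \<bullet> (mpow M (2 ^ q) *v v))\<^sup>2"
      using Suc pos by (intro power_mono) auto
    also have "\<dots> \<le> v \<bullet> (mpow M (2 ^ Suc q) *v v)"
      using sq[of "2 ^ q"] dbl[of "2 ^ q"] by simp
    finally show ?case .
  qed simp
  have "(v \<bullet> (M *v v)) ^ (2 ^ Suc q) \<le> (norm (mpow M (2 ^ q) *v v))\<^sup>2"
    using J[of "Suc q"] dbl[of "2 ^ q"] by simp
  also have "\<dots> \<le> (norm (mpow M (2 ^ q)))\<^sup>2"
    using norm_matrix_vector_le[of "mpow M (2 ^ q)" v] v by (intro power_mono) auto
  also have "\<dots> = rtrace (mpow M (2 ^ Suc q))"
    using rtrace_mpow_even[OF M, of "2 ^ q"] by (simp add: power2_norm_eq_inner)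
  finally show ?thesis .
qed

text \<open>
  If the maximum were attained in the interior only, the first such position would have a strictly smaller
  left neighbour, contrary to convexity.
\<close>

lemma discrete_convex_le:
  fixes c :: "nat \<Rightarrow> real"
  assumes conv: "\<And>k. 1 \<le> k \<Longrightarrow> k < h \<Longrightarrow> 2 * c k \<le> c (k - 1) + c (k + 1)"
    and ends: "c h = c 0" and k: "k \<le> h"
  shows "c k \<le> c 0"
proof -
  define m where "m = Max (c ` {..h})"
  have le: "c j \<le> m" if "j \<le> h" for j using that by (simp add: m_def)
  have "m \<in> c ` {..h}" unfolding m_def by (intro Max_in) auto
  then have ex: "\<exists>j. j \<le> h \<and> c j = m" by auto
  define i where "i = (LEAST j. j \<le> h \<and> c j = m)"
  have i: "i \<le> h" "c i = m" using LeastI_ex[OF ex] by (auto simp: i_def)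
  have "c 0 = m"
  proof (cases "i = 0 \<or> i = h")
    case False
    then have "2 * c i \<le> c (i - 1) + c (i + 1)" using i by (intro conv) auto
    moreover have "c (i + 1) \<le> m" using False i by (intro le) auto
    moreover have "c (i - 1) < m"
    proof -
      have "\<not> (i - 1 \<le> h \<and> c (i - 1) = m)"
        using False not_less_Least[of "i - 1" "\<lambda>j. j \<le> h \<and> c j = m"] unfolding i_def[symmetric] by auto
      then show ?thesis using le[of "i - 1"] i by linarith
    qed
    ultimately show ?thesis using i by linarith
  qed (use i ends in auto)
  then show ?thesis using le[OF k] by simp
qed

text \<open>
  The mixed traces \<open>T i j = tr (B M\<^sup>i B M\<^sup>j)\<close> with \<open>i + j\<close> fixed and even are largest when all powers
  are on one side. Indeed, second differences of \<open>T\<close> are squared Hilbert-Schmidt norms of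
  \<open>M\<^sup>i [B, M\<^sup>d] M\<^sup>l\<close>, hence nonnegative, when they are centred at \<open>T (2 i + d) (2 l + d)\<close>. The step
  \<open>d = 2\<close> makes the sequence of the even positions convex, and it is symmetric, so it is largest at
  its ends. The step \<open>d = 1\<close> bounds an odd position by the mean of its two even neighbours.
\<close>

lemma mixed_trace_le:
  fixes M B :: "'f::real_or_complex^'d^'d"
  assumes M: "adjoint_mat M = M" and B: "adjoint_mat B = B" and K: "even K" and j: "j \<le> K"
  shows "rtrace (B ** mpow M j ** B ** mpow M (K - j)) \<le> rtrace (B ** B ** mpow M K)"
proof -
  define T where "T = (\<lambda>i l. rtrace (B ** (mpow M i ** (B ** mpow M l))))"
  have sym: "T i l = T l i" for i l
    using rtrace_commute[of "B ** mpow M i" "B ** mpow M l"] by (simp add: T_def matrix_mul_assoc)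
  have conv: "2 * T (2*i+d) (2*l+d) \<le> T (2*i) (2*l+2*d) + T (2*i+2*d) (2*l)" for i l d
  proof -
    define C where "C = B ** mpow M d - mpow M d ** B"
    define D where "D = mpow M i ** (C ** mpow M l)"
    have aC: "adjoint_mat C = - C"
      by (simp add: C_def adjoint_mat_mult adjoint_mpow[OF M] B)
    have "0 \<le> D \<bullet> D" by simp
    also have "D \<bullet> D = rtrace (mpow M l ** ((- C) ** (mpow M i ** (mpow M i ** (C ** mpow M l)))))"
      unfolding rtrace_adjoint_mult[symmetric]
      by (simp only: D_def adjoint_mat_mult adjoint_mpow[OF M] aC matrix_mul_assoc)
    also have "\<dots> = rtrace ((- C) ** (mpow M i ** (mpow M i ** (C ** mpow M l))) ** mpow M l)"
      by (rule rtrace_commute)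
    also have "\<dots> = rtrace ((mpow M d ** B - B ** mpow M d) ** (mpow M (2*i) ** ((B ** mpow M d - mpow M d ** B) ** mpow M (2*l))))"
      by (simp add: C_def mult_2 mpow_add matrix_mul_assoc)
    also have "\<dots> = rtrace (mpow M d ** (B ** (mpow M (2*i) ** (B ** (mpow M d ** mpow M (2*l))))))
        - rtrace (mpow M d ** (B ** (mpow M (2*i) ** (mpow M d ** (B ** mpow M (2*l))))))
        - (rtrace (B ** (mpow M d ** (mpow M (2*i) ** (B ** (mpow M d ** mpow M (2*l))))))
         - rtrace (B ** (mpow M d ** (mpow M (2*i) ** (mpow M d ** (B ** mpow M (2*l)))))))"
      by (simp only: matrix_mult_diff rtrace_simps matrix_mul_assoc)
    also have "rtrace (mpow M d ** (B ** (mpow M (2*i) ** (B ** (mpow M d ** mpow M (2*l)))))) = T (2*i) (2*l+2*d)"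
    proof -
      have "rtrace (mpow M d ** (B ** (mpow M (2*i) ** (B ** (mpow M d ** mpow M (2*l)))))) =
        rtrace (B ** (mpow M (2*i) ** (B ** (mpow M d ** mpow M (2*l)))) ** mpow M d)"
        by (rule rtrace_commute)
      also have "\<dots> = rtrace (B ** (mpow M (2*i) ** (B ** mpow M (d + 2*l + d))))"
        by (simp only: mpow_add matrix_mul_assoc)
      also have "d + 2*l + d = 2*l + 2*d" by simp
      finally show ?thesis by (simp only: T_def)
    qed
    also have "rtrace (mpow M d ** (B ** (mpow M (2*i) ** (mpow M d ** (B ** mpow M (2*l)))))) = T (2*i+d) (2*l+d)"
    proof -
      have "rtrace (mpow M d ** (B ** (mpow M (2*i) ** (mpow M d ** (B ** mpow M (2*l)))))) =
        rtrace (B ** (mpow M (2*i) ** (mpow M d ** (B ** mpow M (2*l)))) ** mpow M d)"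
        by (rule rtrace_commute)
      also have "\<dots> = rtrace (B ** (mpow M (2*i+d) ** (B ** mpow M (2*l+d))))"
        by (simp only: mpow_add matrix_mul_assoc)
      finally show ?thesis by (simp only: T_def)
    qed
    also have "rtrace (B ** (mpow M d ** (mpow M (2*i) ** (B ** (mpow M d ** mpow M (2*l)))))) = T (2*i+d) (2*l+d)"
    proof -
      have "rtrace (B ** (mpow M d ** (mpow M (2*i) ** (B ** (mpow M d ** mpow M (2*l)))))) =
         rtrace (B ** (mpow M (d+2*i) ** (B ** mpow M (d+2*l))))"
        by (simp only: mpow_add matrix_mul_assoc)
      then show ?thesis by (simp only: T_def add.commute)
    qed
    also have "rtrace (B ** (mpow M d ** (mpow M (2*i) ** (mpow M d ** (B ** mpow M (2*l)))))) = T (2*i+2*d) (2*l)"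
    proof -
      have "rtrace (B ** (mpow M d ** (mpow M (2*i) ** (mpow M d ** (B ** mpow M (2*l)))))) =
         rtrace (B ** (mpow M (d+2*i+d) ** (B ** mpow M (2*l))))"
        by (simp only: mpow_add matrix_mul_assoc)
      also have "d + 2*i + d = 2*i + 2*d" by simp
      finally show ?thesis by (simp only: T_def)
    qed
    finally show ?thesis by simp
  qed
  obtain h where h: "K = 2 * h" using K by blast
  have ev: "T (2 * k) (K - 2 * k) \<le> T 0 K" if "k \<le> h" for k
  proof -
    have "T (2 * k) (2 * (h - k)) \<le> T (2 * 0) (2 * (h - 0))"
    proof (rule discrete_convex_le[where c = "\<lambda>k. T (2 * k) (2 * (h - k))" and h = h])
      fix k assume k: "1 \<le> k" "k < h"
      obtain a where a: "k = Suc a" using k by (cases k) auto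
      obtain l where l: "h = Suc (k + l)" using less_imp_Suc_add[OF k(2)] by blast
      have e: "2 * k = 2 * a + 2" "2 * (h - k) = 2 * l + 2" "2 * (k - 1) = 2 * a"
        "2 * (h - (k - 1)) = 2 * l + 2 * 2" "2 * (k + 1) = 2 * a + 2 * 2" "2 * (h - (k + 1)) = 2 * l"
        by (simp_all add: a l)
      show "2 * T (2 * k) (2 * (h - k)) \<le> T (2 * (k - 1)) (2 * (h - (k - 1))) + T (2 * (k + 1)) (2 * (h - (k + 1)))"
        unfolding e by (rule conv)
    qed (use sym that in auto)
    then show ?thesis by (simp add: h right_diff_distrib')
  qed
  have "T j (K - j) \<le> T 0 K"
  proof (cases "even j")
    case True
    then obtain k where "j = 2 * k" by blast
    then show ?thesis using ev[of k] j h by simp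
  next
    case False
    then obtain k where k: "j = 2 * k + 1" by (rule oddE)
    then have kh: "k < h" using j h False by presburger
    then have "K - j = 2 * (h - k - 1) + 1" using k h by simp
    then have "2 * T j (K - j) \<le> T (2 * k) (2 * (h - k - 1) + 2 * 1) + T (2 * k + 2 * 1) (2 * (h - k - 1))"
      using conv[of k 1 "h - k - 1"] k by simp
    also have "2 * (h - k - 1) + 2 * 1 = K - 2 * k" using kh h by simp
    also have "2 * (h - k - 1) = K - 2 * (k + 1)" using kh h by simp
    also have "2 * k + 2 * 1 = 2 * (k + 1)" by simp
    finally show ?thesis using ev[of k] ev[of "k + 1"] kh by simp
  qed
  then show ?thesis by (simp add: T_def matrix_mul_assoc)
qed

lemma has_vector_derivative_mpow:
  fixes M B :: "'f::real_or_complex^'d^'d"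
  shows "((\<lambda>t. mpow (M + t *\<^sub>R B) k) has_vector_derivative
     (\<Sum>j<k. mpow (M + t *\<^sub>R B) j ** B ** mpow (M + t *\<^sub>R B) (k - 1 - j))) (at t)"
proof (induction k)
  case 0
  then show ?case by simp
next
  case (Suc k)
  define Mt where "Mt = M + t *\<^sub>R B"
  have d: "((\<lambda>t. M + t *\<^sub>R B) has_vector_derivative B) (at t)"
    by (auto intro!: derivative_eq_intros)
  have "((\<lambda>t. (M + t *\<^sub>R B) ** mpow (M + t *\<^sub>R B) k) has_vector_derivative
      Mt ** (\<Sum>j<k. mpow Mt j ** B ** mpow Mt (k - 1 - j)) + B ** mpow Mt k) (at t)"
    unfolding Mt_def
    by (rule bounded_bilinear.has_vector_derivative[OF bounded_bilinear_matrix_mult d Suc])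
  moreover have "Mt ** (\<Sum>j<k. mpow Mt j ** B ** mpow Mt (k - 1 - j)) + B ** mpow Mt k =
     (\<Sum>j<Suc k. mpow Mt j ** B ** mpow Mt (Suc k - 1 - j))"
  proof -
    have "Mt ** (\<Sum>j<k. mpow Mt j ** B ** mpow Mt (k - 1 - j)) =
      (\<Sum>j<k. mpow Mt (Suc j) ** B ** mpow Mt (k - 1 - j))"
      by (simp add: bounded_bilinear.sum_right[OF bounded_bilinear_matrix_mult] matrix_mul_assoc)
    then show ?thesis unfolding sum.lessThan_Suc_shift by (simp add: add.commute)
  qed
  ultimately show ?case by (simp add: Mt_def)
qed

text \<open>The comparison function is the solution of \<open>f'' = \<kappa>\<^sup>2 f\<close> with the same initial data.\<close>

lemma cosh_comparison:
  fixes f f' f'' :: "real \<Rightarrow> real"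
  assumes f: "\<And>t. (f has_real_derivative f' t) (at t)"
    and f': "\<And>t. (f' has_real_derivative f'' t) (at t)"
    and le: "\<And>t. 0 \<le> t \<Longrightarrow> t \<le> 1 \<Longrightarrow> f'' t \<le> \<kappa>\<^sup>2 * f t" and \<kappa>: "\<kappa> > 0"
  shows "f 1 \<le> cosh \<kappa> * f 0 + sinh \<kappa> / \<kappa> * f' 0"
proof -
  define y where "y = (\<lambda>t. f' t * sinh (\<kappa> * (1 - t)) + \<kappa> * (f t * cosh (\<kappa> * (1 - t))))"
  have "y 1 \<le> y 0"
  proof (rule DERIV_nonpos_imp_nonincreasing[of 0 1 y])
    fix t :: real assume t: "0 \<le> t" "t \<le> 1"
    have "(y has_real_derivative (f'' t - \<kappa>\<^sup>2 * f t) * sinh (\<kappa> * (1 - t))) (at t)"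
      unfolding y_def
      by (auto intro!: derivative_eq_intros f f' simp: algebra_simps power2_eq_square)
    moreover have "(f'' t - \<kappa>\<^sup>2 * f t) * sinh (\<kappa> * (1 - t)) \<le> 0"
      using le[OF t] t \<kappa> by (intro mult_nonpos_nonneg) auto
    ultimately show "\<exists>z. (y has_real_derivative z) (at t) \<and> z \<le> 0" by blast
  qed simp
  then have "\<kappa> * f 1 \<le> f' 0 * sinh \<kappa> + \<kappa> * (f 0 * cosh \<kappa>)" by (simp add: y_def)
  then show ?thesis using \<kappa> by (simp add: field_simps)
qed

text \<open>
  One step of the iteration. To second order in \<open>B\<close>, the trace of \<open>(M + B)\<^sup>N\<close> grows by a factor only,
  whereas the first-order term is linear in \<open>B\<close> and will vanish in the mean. This takes the role that
  the Golden-Thompson inequality plays for the matrix exponential.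
\<close>

lemma rtrace_mpow_step:
  fixes M B :: "'f::real_or_complex^'d^'d"
  assumes M: "adjoint_mat M = M" and B: "adjoint_mat B = B"
    and Bc: "\<And>v. (norm (B *v v))\<^sup>2 \<le> c * (norm v)\<^sup>2" and c: "c > 0"
    and low: "\<And>t v. 0 \<le> t \<Longrightarrow> t \<le> 1 \<Longrightarrow> \<eta> * norm v \<le> norm ((M + t *\<^sub>R B) *v v)" and \<eta>: "\<eta> > 0"
    and N: "N = 2 * Suc k" and \<kappa>: "\<kappa> = real N * sqrt c / \<eta>"
  shows "rtrace (mpow (M + B) N) \<le>
    cosh \<kappa> * rtrace (mpow M N) + sinh \<kappa> / \<kappa> * (real N * (B \<bullet> mpow M (N - 1)))"
proof -
  define Mt where "Mt = (\<lambda>t. M + t *\<^sub>R B)"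
  have aMt: "adjoint_mat (Mt t) = Mt t" for t using M B by (simp add: Mt_def)
  define f where "f = (\<lambda>t. rtrace (mpow (Mt t) N))"
  define g where "g = (\<lambda>t. real N * rtrace (B ** mpow (Mt t) (N - 1)))"
  define h where "h = (\<lambda>t. real N * (\<Sum>j<N - 1. rtrace (B ** mpow (Mt t) j ** B ** mpow (Mt t) (N - 2 - j))))"
  have f: "(f has_real_derivative g t) (at t)" for t
  proof -
    have "(f has_vector_derivative rtrace (\<Sum>j<N. mpow (Mt t) j ** B ** mpow (Mt t) (N - 1 - j))) (at t)"
      unfolding f_def Mt_def
      by (rule bounded_linear.has_vector_derivative[OF bounded_linear_rtrace has_vector_derivative_mpow])
    moreover have "rtrace (\<Sum>j<N. mpow (Mt t) j ** B ** mpow (Mt t) (N - 1 - j)) = g t"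
    proof -
      have "rtrace (mpow (Mt t) j ** B ** mpow (Mt t) (N - 1 - j)) = rtrace (B ** mpow (Mt t) (N - 1))"
        if "j < N" for j
      proof -
        have "rtrace (mpow (Mt t) j ** (B ** mpow (Mt t) (N - 1 - j))) =
           rtrace (B ** mpow (Mt t) (N - 1 - j) ** mpow (Mt t) j)" by (rule rtrace_commute)
        also have "\<dots> = rtrace (B ** mpow (Mt t) (N - 1 - j + j))"
          by (simp only: mpow_add matrix_mul_assoc)
        also have "N - 1 - j + j = N - 1" using that by simp
        finally show ?thesis by (simp only: matrix_mul_assoc)
      qed
      then show ?thesis by (simp add: rtrace_sum g_def)
    qed
    ultimately show ?thesis by (simp add: has_real_derivative_iff_has_vector_derivative)
  qed
  have g: "(g has_real_derivative h t) (at t)" for t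
  proof -
    have lin: "bounded_linear (\<lambda>A. rtrace (B ** A))"
      by (rule bounded_linear_compose[OF bounded_linear_rtrace
          bounded_bilinear.bounded_linear_right[OF bounded_bilinear_matrix_mult]])
    have "((\<lambda>t. rtrace (B ** mpow (Mt t) (N - 1))) has_vector_derivative
       rtrace (B ** (\<Sum>j<N - 1. mpow (Mt t) j ** B ** mpow (Mt t) (N - 1 - 1 - j)))) (at t)"
      unfolding Mt_def
      by (rule bounded_linear.has_vector_derivative[OF lin has_vector_derivative_mpow])
    moreover have "rtrace (B ** (\<Sum>j<N - 1. mpow (Mt t) j ** B ** mpow (Mt t) (N - 1 - 1 - j))) =
      (\<Sum>j<N - 1. rtrace (B ** mpow (Mt t) j ** B ** mpow (Mt t) (N - 2 - j)))"
      by (simp add: bounded_bilinear.sum_right[OF bounded_bilinear_matrix_mult] rtrace_sum matrix_mul_assoc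
          numeral_2_eq_2)
    ultimately have "((\<lambda>t. rtrace (B ** mpow (Mt t) (N - 1))) has_real_derivative
       (\<Sum>j<N - 1. rtrace (B ** mpow (Mt t) j ** B ** mpow (Mt t) (N - 2 - j)))) (at t)"
      by (simp add: has_real_derivative_iff_has_vector_derivative)
    then show ?thesis unfolding g_def h_def by (rule DERIV_cmult)
  qed
  have le: "h t \<le> \<kappa>\<^sup>2 * f t" if t: "0 \<le> t" "t \<le> 1" for t
  proof -
    define L where "L = mpow (Mt t) k"
    have "h t \<le> real N * (\<Sum>j<N - 1. rtrace (B ** B ** mpow (Mt t) (N - 2)))"
      unfolding h_def
      by (intro mult_left_mono sum_mono mixed_trace_le[OF aMt B]) (auto simp: N)
    also have "\<dots> = real N * real (N - 1) * rtrace (B ** B ** mpow (Mt t) (N - 2))" by simp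
    also have "rtrace (B ** B ** mpow (Mt t) (N - 2)) = (B ** L) \<bullet> (B ** L)"
    proof -
      have "N - 2 = k + k" by (simp add: N)
      then have "rtrace (B ** B ** mpow (Mt t) (N - 2)) = rtrace ((B ** (B ** L)) ** L)"
        by (simp only: L_def mpow_add matrix_mul_assoc)
      also have "\<dots> = rtrace (L ** (B ** (B ** L)))" by (rule rtrace_commute)
      also have "\<dots> = rtrace (adjoint_mat (B ** L) ** (B ** L))"
        by (simp add: adjoint_mat_mult B adjoint_mpow[OF aMt] L_def matrix_mul_assoc)
      finally show ?thesis by (simp only: rtrace_adjoint_mult)
    qed
    also have "real N * real (N - 1) * ((B ** L) \<bullet> (B ** L)) \<le> real N * real N * (c * (L \<bullet> L))"
      by (intro mult_mono inner_matrix_mult_le[OF Bc]) auto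
    also have "\<dots> = real N * real N * c / \<eta>\<^sup>2 * (\<eta>\<^sup>2 * (L \<bullet> L))" using \<eta> by simp
    also have "\<dots> \<le> real N * real N * c / \<eta>\<^sup>2 * ((Mt t ** L) \<bullet> (Mt t ** L))"
    proof (intro mult_left_mono inner_matrix_mult_ge)
      fix v
      have "(\<eta> * norm v)\<^sup>2 \<le> (norm (Mt t *v v))\<^sup>2"
        unfolding Mt_def using low[OF t] \<eta> by (intro power_mono) auto
      then show "\<eta>\<^sup>2 * (norm v)\<^sup>2 \<le> (norm (Mt t *v v))\<^sup>2" by (simp add: power_mult_distrib)
    qed (use c \<eta> in auto)
    also have "(Mt t ** L) \<bullet> (Mt t ** L) = f t"
      using rtrace_mpow_even[OF aMt, of t "Suc k"] by (simp add: f_def N L_def del: mpow.simps(2)) (simp only: mpow.simps)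
    also have "real N * real N * c / \<eta>\<^sup>2 = \<kappa>\<^sup>2"
      using c by (simp add: \<kappa> power_mult_distrib power_divide) (simp add: power2_eq_square)
    finally show ?thesis .
  qed
  have "\<kappa> > 0" using c \<eta> by (simp add: \<kappa> N)
  from cosh_comparison[OF f g le this]
  have "f 1 \<le> cosh \<kappa> * f 0 + sinh \<kappa> / \<kappa> * g 0" .
  moreover have "B \<bullet> mpow M (N - 1) = rtrace (B ** mpow M (N - 1))"
    using rtrace_adjoint_mult[of B "mpow M (N - 1)"] B by simp
  ultimately show ?thesis by (simp add: f_def g_def Mt_def)
qed

lemma cosh_le_exp_half_square: "cosh x \<le> exp (x\<^sup>2 / 2)" for x :: real
proof -
  have pos: "cosh x \<le> exp (x\<^sup>2 / 2)" if x: "x \<ge> 0" for x :: real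
  proof -
    have tanh: "sinh t \<le> t * cosh t" if "t \<ge> 0" for t :: real
    proof -
      have "0 * cosh 0 - sinh 0 \<le> t * cosh t - sinh (t :: real)"
      proof (rule DERIV_nonneg_imp_nondecreasing[OF that])
        fix u :: real assume "0 \<le> u" "u \<le> t"
        then show "\<exists>y. ((\<lambda>t. t * cosh t - sinh t) has_real_derivative y) (at u) \<and> 0 \<le> y"
          by (intro exI[of _ "u * sinh u"]) (auto intro!: derivative_eq_intros)
      qed
      then show ?thesis by simp
    qed
    have "0\<^sup>2 / 2 - ln (cosh 0) \<le> x\<^sup>2 / 2 - ln (cosh x)"
    proof (rule DERIV_nonneg_imp_nondecreasing[OF x])
      fix u :: real assume u: "0 \<le> u" "u \<le> x"
      have "((\<lambda>t. t\<^sup>2 / 2 - ln (cosh t)) has_real_derivative (u - sinh u / cosh u)) (at u)"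
        by (auto intro!: derivative_eq_intros simp: cosh_real_pos)
      moreover have "0 \<le> u - sinh u / cosh u" using tanh[OF u(1)] by (simp add: field_simps cosh_real_pos)
      ultimately show "\<exists>y. ((\<lambda>t. t\<^sup>2 / 2 - ln (cosh t)) has_real_derivative y) (at u) \<and> 0 \<le> y" by blast
    qed
    then have "ln (cosh x) \<le> x\<^sup>2 / 2" by simp
    then show ?thesis using cosh_real_pos[of x] by (metis exp_le_cancel_iff exp_ln)
  qed
  show ?thesis using pos[of x] pos[of "- x"] by (cases "x \<ge> 0") auto
qed

section \<open>Concentration of sums of independent random Hermitian matrices\<close>

context prob_space
begin

lemma integrable_continuous_bounded:
  fixes X :: "'a \<Rightarrow> 'b::euclidean_space" and f :: "'b \<Rightarrow> real"
  assumes X: "X \<in> borel_measurable M" and R: "\<And>\<omega>. \<omega> \<in> space M \<Longrightarrow> norm (X \<omega>) \<le> R"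
    and f: "continuous_on UNIV f"
  shows "integrable M (\<lambda>\<omega>. f (X \<omega>))"
proof -
  have "compact (f ` cball 0 R)"
    by (intro compact_continuous_image continuous_on_subset[OF f]) auto
  then obtain C where C: "\<And>y. y \<in> f ` cball 0 R \<Longrightarrow> norm y \<le> C"
    using compact_imp_bounded bounded_iff by metis
  show ?thesis
  proof (rule integrable_const_bound[where B = C])
    show "AE \<omega> in M. norm (f (X \<omega>)) \<le> C" using R by (intro AE_I2 C) auto
    show "(\<lambda>\<omega>. f (X \<omega>)) \<in> borel_measurable M"
      using X borel_measurable_continuous_onI[OF f] by (rule measurable_compose)
  qed
qed

text \<open>
  The moment bound is by induction on the number of summands. Given the first \<open>l\<close> summands, the mean
  of the linear term of the next step vanishes, since the next summand is independent and centred.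
  The number \<open>\<eta>\<close>, which tends to \<open>1\<close> as \<open>N\<close> grows, is a lower bound for the factor by which
  \<open>I + \<theta> S / N\<close> scales lengths, for all partial sums \<open>S\<close> and all points between them.
\<close>

lemma expectation_rtrace_mpow_le:
  fixes Z :: "nat \<Rightarrow> 'a \<Rightarrow> 'f::real_or_complex^'d^'d"
  assumes indep: "indep_vars (\<lambda>_. borel) Z {1..m}"
    and herm: "\<And>j \<omega>. j \<in> {1..m} \<Longrightarrow> \<omega> \<in> space M \<Longrightarrow> adjoint_mat (Z j \<omega>) = Z j \<omega>"
    and bd: "\<And>j \<omega> v. j \<in> {1..m} \<Longrightarrow> \<omega> \<in> space M \<Longrightarrow> (norm (Z j \<omega> *v v))\<^sup>2 \<le> c * (norm v)\<^sup>2"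
    and mean: "\<And>j B. j \<in> {1..m} \<Longrightarrow> B \<in> Basis \<Longrightarrow> expectation (\<lambda>\<omega>. Z j \<omega> \<bullet> B) = 0"
    and c: "c > 0" and \<theta>: "\<theta> > 0" and N: "N = 2 * Suc k"
    and \<eta>: "\<eta> = 1 - real m * \<theta> * sqrt c / real N" "\<eta> > 0" and \<kappa>: "\<kappa> = \<theta> * sqrt c / \<eta>" and l: "l \<le> m"
  shows "integrable M (\<lambda>\<omega>. rtrace (mpow (mat 1 + (\<theta> / N) *\<^sub>R (\<Sum>j=1..l. Z j \<omega>)) N))"
    and "expectation (\<lambda>\<omega>. rtrace (mpow (mat 1 + (\<theta> / N) *\<^sub>R (\<Sum>j=1..l. Z j \<omega>)) N)) \<le> real CARD('d) * cosh \<kappa> ^ l"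
proof -
  have N0: "real N > 0" by (simp add: N)
  define r where "r = \<theta> / real N"
  have r: "r > 0" using \<theta> N0 by (simp add: r_def)
  define S where "S = (\<lambda>l \<omega>. mat 1 + r *\<^sub>R (\<Sum>j=1..l. Z j \<omega>))"
  have Zmeas: "Z j \<in> borel_measurable M" if "j \<in> {1..m}" for j
    using indep that by (auto simp: indep_vars_def)
  have Smeas: "S l \<in> borel_measurable M" if "l \<le> m" for l
    unfolding S_def using that
    by (intro borel_measurable_add borel_measurable_scaleR borel_measurable_sum Zmeas) auto
  have Zop: "norm (Z j \<omega> *v v) \<le> sqrt c * norm v" if "j \<in> {1..m}" "\<omega> \<in> space M" for j \<omega> v
  proof -
    have "(norm (Z j \<omega> *v v))\<^sup>2 \<le> (sqrt c * norm v)\<^sup>2"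
      using bd[OF that, of v] c by (simp add: power_mult_distrib)
    then show ?thesis by (rule power2_le_imp_le) (use c in simp)
  qed
  have Znorm: "norm (Z j \<omega>) \<le> sqrt (c * (norm (mat 1 :: 'f^'d^'d))\<^sup>2)" if "j \<in> {1..m}" "\<omega> \<in> space M" for j \<omega>
  proof -
    have "(Z j \<omega> ** mat 1) \<bullet> (Z j \<omega> ** mat 1) \<le> c * (mat 1 \<bullet> (mat 1 :: 'f^'d^'d))"
      by (rule inner_matrix_mult_le) (rule bd[OF that])
    then have "(norm (Z j \<omega>))\<^sup>2 \<le> c * (norm (mat 1 :: 'f^'d^'d))\<^sup>2"
      by (simp add: power2_norm_eq_inner)
    then show ?thesis by (rule real_le_rsqrt)
  qed
  define R where "R = norm (mat 1 :: 'f^'d^'d) + r * (real m * sqrt (c * (norm (mat 1 :: 'f^'d^'d))\<^sup>2))"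
  have Snorm: "norm (S l \<omega>) \<le> R" if "l \<le> m" "\<omega> \<in> space M" for l \<omega>
  proof -
    have "norm (\<Sum>j=1..l. Z j \<omega>) \<le> (\<Sum>j=1..l. sqrt (c * (norm (mat 1 :: 'f^'d^'d))\<^sup>2))"
      using that by (intro sum_norm_le Znorm) auto
    also have "\<dots> \<le> real m * sqrt (c * (norm (mat 1 :: 'f^'d^'d))\<^sup>2)"
      using that c by (simp add: mult_right_mono)
    finally have "norm (r *\<^sub>R (\<Sum>j=1..l. Z j \<omega>)) \<le> r * (real m * sqrt (c * (norm (mat 1 :: 'f^'d^'d))\<^sup>2))"
      using r by (simp add: mult_left_mono)
    then show ?thesis unfolding S_def R_def by (intro norm_triangle_le add_left_mono) auto
  qed
  have Sherm: "adjoint_mat (S l \<omega>) = S l \<omega>" if "l \<le> m" "\<omega> \<in> space M" for l \<omega>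
  proof -
    have "(\<Sum>j=1..l. adjoint_mat (Z j \<omega>)) = (\<Sum>j=1..l. Z j \<omega>)"
      using that by (intro sum.cong refl herm) auto
    then show ?thesis by (simp add: S_def adjoint_mat_sum)
  qed
  have cont: "continuous_on UNIV (\<lambda>A :: 'f^'d^'d. rtrace (mpow A N))"
    by (rule bounded_linear.continuous_on[OF bounded_linear_rtrace continuous_on_mpow])
  have int: "integrable M (\<lambda>\<omega>. rtrace (mpow (S l \<omega>) N))" if "l \<le> m" for l
    using that by (intro integrable_continuous_bounded[OF Smeas Snorm cont]) auto
  have ortho: "expectation (\<lambda>\<omega>. Z (Suc l) \<omega> \<bullet> mpow (S l \<omega>) (N - 1)) = 0"
    and intZ: "integrable M (\<lambda>\<omega>. Z (Suc l) \<omega> \<bullet> mpow (S l \<omega>) (N - 1))" if l: "Suc l \<le> m" for l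
  proof -
    have i1: "integrable M (\<lambda>\<omega>. Z (Suc l) \<omega> \<bullet> B)" for B
      using l by (intro integrable_continuous_bounded[OF Zmeas Znorm] continuous_intros) auto
    have i2: "integrable M (\<lambda>\<omega>. mpow (S l \<omega>) (N - 1) \<bullet> B)" for B
      using l by (intro integrable_continuous_bounded[OF Smeas Snorm, where f = "\<lambda>A. mpow A (N - 1) \<bullet> B"]
        continuous_intros continuous_on_mpow) auto
    have ind: "indep_var borel (\<lambda>\<omega>. Z (Suc l) \<omega> \<bullet> B) borel (\<lambda>\<omega>. mpow (S l \<omega>) (N - 1) \<bullet> B)" for B
    proof -
      have mp: "(\<lambda>A :: 'f^'d^'d. mpow A (N - 1)) \<in> borel_measurable borel"
        by (rule borel_measurable_continuous_onI[OF continuous_on_mpow])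
      have m1: "(\<lambda>f. f (Suc l) \<bullet> B) \<in> borel_measurable (PiM {Suc l} (\<lambda>_. borel))"
        by measurable
      have m2: "(\<lambda>f. mpow (mat 1 + r *\<^sub>R (\<Sum>j=1..l. f j)) (N - 1) \<bullet> B) \<in> borel_measurable (PiM {1..l} (\<lambda>_. borel))"
        by (intro borel_measurable_inner borel_measurable_const measurable_compose[OF _ mp]
            borel_measurable_add borel_measurable_scaleR borel_measurable_sum measurable_component_singleton) auto
      have "indep_var borel ((\<lambda>f. f (Suc l) \<bullet> B) \<circ> (\<lambda>\<omega>. restrict (\<lambda>i. Z i \<omega>) {Suc l}))
         borel ((\<lambda>f. mpow (mat 1 + r *\<^sub>R (\<Sum>j=1..l. f j)) (N - 1) \<bullet> B) \<circ> (\<lambda>\<omega>. restrict (\<lambda>i. Z i \<omega>) {1..l}))"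
        using l by (intro indep_var_compose[OF indep_var_restrict[OF indep] m1 m2]) auto
      then show ?thesis by (simp add: comp_def S_def)
    qed
    have exp: "Z (Suc l) \<omega> \<bullet> mpow (S l \<omega>) (N - 1) =
        (\<Sum>B\<in>Basis. (Z (Suc l) \<omega> \<bullet> B) * (mpow (S l \<omega>) (N - 1) \<bullet> B))" for \<omega>
      by (rule euclidean_inner)
    have i3: "integrable M (\<lambda>\<omega>. (Z (Suc l) \<omega> \<bullet> B) * (mpow (S l \<omega>) (N - 1) \<bullet> B))" for B
      by (rule indep_var_integrable[OF ind i1 i2])
    have e0: "expectation (\<lambda>\<omega>. (Z (Suc l) \<omega> \<bullet> B) * (mpow (S l \<omega>) (N - 1) \<bullet> B)) = 0" if "B \<in> Basis" for B
    proof -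
      have "expectation (\<lambda>\<omega>. (Z (Suc l) \<omega> \<bullet> B) * (mpow (S l \<omega>) (N - 1) \<bullet> B)) =
         expectation (\<lambda>\<omega>. Z (Suc l) \<omega> \<bullet> B) * expectation (\<lambda>\<omega>. mpow (S l \<omega>) (N - 1) \<bullet> B)"
        by (rule indep_var_lebesgue_integral[OF ind i1 i2])
      then show ?thesis using mean[of "Suc l" B] that l by simp
    qed
    show "integrable M (\<lambda>\<omega>. Z (Suc l) \<omega> \<bullet> mpow (S l \<omega>) (N - 1))"
      unfolding exp by (intro Bochner_Integration.integrable_sum i3)
    show "expectation (\<lambda>\<omega>. Z (Suc l) \<omega> \<bullet> mpow (S l \<omega>) (N - 1)) = 0"
      unfolding exp Bochner_Integration.integral_sum[OF i3] by (rule sum.neutral) (use e0 in blast)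
  qed
  have main: "expectation (\<lambda>\<omega>. rtrace (mpow (S l \<omega>) N)) \<le> real CARD('d) * cosh \<kappa> ^ l" if "l \<le> m" for l
    using that
  proof (induction l)
    case 0
    have "mpow (mat 1 :: 'f^'d^'d) N = mat 1" for N by (induction N) simp_all
    then show ?case by (simp add: S_def prob_space)
  next
    case (Suc l)
    define a where "a = sinh \<kappa> / \<kappa> * (real N * r)"
    have step: "rtrace (mpow (S (Suc l) \<omega>) N) \<le>
        cosh \<kappa> * rtrace (mpow (S l \<omega>) N) + a * (Z (Suc l) \<omega> \<bullet> mpow (S l \<omega>) (N - 1))" if \<omega>: "\<omega> \<in> space M" for \<omega>
    proof -
      define B where "B = r *\<^sub>R Z (Suc l) \<omega>"
      have SB: "S (Suc l) \<omega> = S l \<omega> + B" by (simp add: S_def B_def scaleR_add_right)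
      have low: "\<eta> * norm v \<le> norm ((S l \<omega> + t *\<^sub>R B) *v v)" if t: "0 \<le> t" "t \<le> 1" for t v
      proof -
        define w where "w = r *\<^sub>R ((\<Sum>j=1..l. Z j \<omega> *v v) + t *\<^sub>R (Z (Suc l) \<omega> *v v))"
        have "(S l \<omega> + t *\<^sub>R B) *v v = v + w" unfolding w_def
          by (simp add: S_def B_def matrix_vector_mult_add_rdistrib scaleR_matrix_vector sum_matrix_vector
              scaleR_add_right mult.commute)
        moreover have "norm w \<le> r * (real m * (sqrt c * norm v))"
        proof -
          have "norm (\<Sum>j=1..l. Z j \<omega> *v v) \<le> (\<Sum>j=1..l. sqrt c * norm v)"
            using Suc.prems \<omega> by (intro sum_norm_le Zop) auto
          moreover have "norm (t *\<^sub>R (Z (Suc l) \<omega> *v v)) \<le> 1 * (sqrt c * norm v)"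
            unfolding norm_scaleR using t Suc.prems \<omega> by (intro mult_mono Zop) auto
          ultimately have "norm ((\<Sum>j=1..l. Z j \<omega> *v v) + t *\<^sub>R (Z (Suc l) \<omega> *v v)) \<le> real (Suc l) * (sqrt c * norm v)"
            by (intro norm_triangle_le) (simp add: algebra_simps)
          also have "\<dots> \<le> real m * (sqrt c * norm v)"
            using Suc.prems c by (intro mult_right_mono) auto
          finally show ?thesis unfolding w_def norm_scaleR using r by (simp add: mult_left_mono)
        qed
        ultimately have "norm v - r * (real m * (sqrt c * norm v)) \<le> norm ((S l \<omega> + t *\<^sub>R B) *v v)"
          using norm_diff_ineq[of v w] by simp
        moreover have "norm v - r * (real m * (sqrt c * norm v)) = \<eta> * norm v"
          by (simp add: \<eta>(1) r_def algebra_simps)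
        ultimately show ?thesis by simp
      qed
      have "rtrace (mpow (S l \<omega> + B) N) \<le>
         cosh \<kappa> * rtrace (mpow (S l \<omega>) N) + sinh \<kappa> / \<kappa> * (real N * (B \<bullet> mpow (S l \<omega>) (N - 1)))"
      proof (rule rtrace_mpow_step[where c = "r\<^sup>2 * c" and \<eta> = \<eta> and k = k])
        show "adjoint_mat (S l \<omega>) = S l \<omega>" using Suc.prems \<omega> by (intro Sherm) auto
        show "adjoint_mat B = B" using herm[of "Suc l" \<omega>] Suc.prems \<omega> by (simp add: B_def)
        show "(norm (B *v v))\<^sup>2 \<le> r\<^sup>2 * c * (norm v)\<^sup>2" for v
          using bd[of "Suc l" \<omega> v] Suc.prems \<omega>
          by (simp add: B_def scaleR_matrix_vector power_mult_distrib mult.assoc mult_left_mono)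
        show "\<kappa> = real N * sqrt (r\<^sup>2 * c) / \<eta>"
          using r N0 \<theta> by (simp add: \<kappa> real_sqrt_mult r_def)
        show "r\<^sup>2 * c > 0" using r c by simp
      qed (rule low \<eta> N; assumption)+
      also have "sinh \<kappa> / \<kappa> * (real N * (B \<bullet> mpow (S l \<omega>) (N - 1))) = a * (Z (Suc l) \<omega> \<bullet> mpow (S l \<omega>) (N - 1))"
        by (simp add: a_def B_def)
      finally show ?thesis by (simp only: SB)
    qed
    have "expectation (\<lambda>\<omega>. rtrace (mpow (S (Suc l) \<omega>) N)) \<le>
       expectation (\<lambda>\<omega>. cosh \<kappa> * rtrace (mpow (S l \<omega>) N) + a * (Z (Suc l) \<omega> \<bullet> mpow (S l \<omega>) (N - 1)))"
      by (rule integral_mono[OF int[OF Suc.prems] Bochner_Integration.integrable_add[OF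
            integrable_mult_right[OF int] integrable_mult_right[OF intZ[OF Suc.prems]]] step])
        (use Suc.prems in simp)
    also have "\<dots> = cosh \<kappa> * expectation (\<lambda>\<omega>. rtrace (mpow (S l \<omega>) N))"
      using Suc.prems int[of l] intZ[of l] ortho[of l] by simp
    also have "\<dots> \<le> cosh \<kappa> * (real CARD('d) * cosh \<kappa> ^ l)"
      using Suc cosh_real_pos[of \<kappa>] by (intro mult_left_mono) auto
    finally show ?case by (simp add: mult_ac)
  qed
  show "integrable M (\<lambda>\<omega>. rtrace (mpow (mat 1 + (\<theta> / N) *\<^sub>R (\<Sum>j=1..l. Z j \<omega>)) N))"
    using int[OF l] by (simp add: S_def r_def)
  show "expectation (\<lambda>\<omega>. rtrace (mpow (mat 1 + (\<theta> / N) *\<^sub>R (\<Sum>j=1..l. Z j \<omega>)) N)) \<le> real CARD('d) * cosh \<kappa> ^ l"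
    using main[OF l] by (simp add: S_def r_def)
qed

text \<open>
  Markov's inequality for the trace of \<open>(I + \<theta> S / N)\<^sup>N\<close>, which dominates \<open>(1 + \<theta> L / N)\<^sup>N\<close> as soon as some
  unit vector sees the value \<open>L\<close>. In the limit \<open>N \<rightarrow> \<infinity>\<close> the exponential bound appears, and \<open>\<theta>\<close> is
  chosen to optimize it.
\<close>

lemma prob_quadratic_form_ge:
  fixes Z :: "nat \<Rightarrow> 'a \<Rightarrow> 'f::real_or_complex^'d^'d"
  assumes indep: "indep_vars (\<lambda>_. borel) Z {1..m}"
    and herm: "\<And>j \<omega>. j \<in> {1..m} \<Longrightarrow> \<omega> \<in> space M \<Longrightarrow> adjoint_mat (Z j \<omega>) = Z j \<omega>"
    and bd: "\<And>j \<omega> v. j \<in> {1..m} \<Longrightarrow> \<omega> \<in> space M \<Longrightarrow> (norm (Z j \<omega> *v v))\<^sup>2 \<le> c * (norm v)\<^sup>2"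
    and mean: "\<And>j B. j \<in> {1..m} \<Longrightarrow> B \<in> Basis \<Longrightarrow> expectation (\<lambda>\<omega>. Z j \<omega> \<bullet> B) = 0"
    and c: "c > 0" and m: "0 < m" and L: "L > 0" and A: "A \<in> events"
    and large: "\<And>\<omega>. \<omega> \<in> A \<Longrightarrow> \<exists>v. norm v = 1 \<and> L \<le> v \<bullet> ((\<Sum>j=1..m. Z j \<omega>) *v v)"
  shows "prob A \<le> real CARD('d) * exp (- (L\<^sup>2 / (2 * real m * c)))"
proof -
  define \<theta> where "\<theta> = L / (real m * c)"
  have \<theta>: "\<theta> > 0" using L m c by (simp add: \<theta>_def)
  define N where "N = (\<lambda>q. 2 ^ Suc q :: nat)"
  define \<eta> where "\<eta> = (\<lambda>q. 1 - real m * \<theta> * sqrt c / real (N q))"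
  define \<kappa> where "\<kappa> = (\<lambda>q. \<theta> * sqrt c / \<eta> q)"
  have sub: "strict_mono N" by (auto simp: N_def strict_mono_Suc_iff)
  have limN: "filterlim N at_top sequentially" by (rule filterlim_subseq[OF sub])
  have limN': "filterlim (\<lambda>q. real (N q)) at_top sequentially"
    by (rule filterlim_compose[OF filterlim_real_sequentially limN])
  have "(\<lambda>q. real m * \<theta> * sqrt c / real (N q)) \<longlonglongrightarrow> 0"
    by (rule real_tendsto_divide_at_top[OF tendsto_const limN'])
  then have \<eta>1: "\<eta> \<longlonglongrightarrow> 1 - 0" unfolding \<eta>_def by (intro tendsto_intros)
  then have "\<kappa> \<longlonglongrightarrow> \<theta> * sqrt c / 1" unfolding \<kappa>_def by (intro tendsto_intros) auto
  then have lim1: "(\<lambda>q. real CARD('d) * cosh (\<kappa> q) ^ m) \<longlonglongrightarrow> real CARD('d) * cosh (\<theta> * sqrt c) ^ m"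
    by (intro tendsto_intros) auto
  have lim2: "(\<lambda>q. prob A * (1 + \<theta> * L / real (N q)) ^ N q) \<longlonglongrightarrow> prob A * exp (\<theta> * L)"
    using filterlim_compose[OF tendsto_exp_limit_sequentially limN, of "\<theta> * L"]
    by (intro tendsto_mult tendsto_const)
  have "\<forall>\<^sub>F q in sequentially. \<eta> q > 0"
    using order_tendstoD(1)[OF \<eta>1, of 0] by simp
  then have "\<forall>\<^sub>F q in sequentially. prob A * (1 + \<theta> * L / real (N q)) ^ N q \<le> real CARD('d) * cosh (\<kappa> q) ^ m"
  proof eventually_elim
    case (elim q)
    define f where "f = (\<lambda>\<omega>. rtrace (mpow (mat 1 + (\<theta> / real (N q)) *\<^sub>R (\<Sum>j=1..m. Z j \<omega>)) (N q)))"
    have N2: "N q = 2 * Suc (2 ^ q - 1)" by (simp add: N_def)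
    have E: "integrable M f" "expectation f \<le> real CARD('d) * cosh (\<kappa> q) ^ m"
      unfolding f_def
      by (rule expectation_rtrace_mpow_le[OF indep herm bd mean c \<theta> N2 _ elim, where \<kappa> = "\<kappa> q" and l = m];
          simp add: \<eta>_def \<kappa>_def)+
    have Sherm: "adjoint_mat (mat 1 + (\<theta> / real (N q)) *\<^sub>R (\<Sum>j=1..m. Z j \<omega>)) =
        mat 1 + (\<theta> / real (N q)) *\<^sub>R (\<Sum>j=1..m. Z j \<omega>)" if "\<omega> \<in> space M" for \<omega>
    proof -
      have "(\<Sum>j=1..m. adjoint_mat (Z j \<omega>)) = (\<Sum>j=1..m. Z j \<omega>)"
        using that by (intro sum.cong refl herm) auto
      then show ?thesis by (simp add: adjoint_mat_sum)
    qed
    have f0: "f \<omega> \<ge> 0" if "\<omega> \<in> space M" for \<omega>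
      using rtrace_mpow_even[OF Sherm[OF that], of "Suc (2 ^ q - 1)"] unfolding f_def N2 by (simp only: inner_ge_zero)
    have fA: "(1 + \<theta> * L / real (N q)) ^ N q \<le> f \<omega>" if in_A: "\<omega> \<in> A" for \<omega>
    proof -
      have \<omega>: "\<omega> \<in> space M" using in_A A sets.sets_into_space by auto
      obtain v where v: "norm v = 1" "L \<le> v \<bullet> ((\<Sum>j=1..m. Z j \<omega>) *v v)" using large[OF in_A] by auto
      define T where "T = mat 1 + (\<theta> / real (N q)) *\<^sub>R (\<Sum>j=1..m. Z j \<omega>)"
      have "v \<bullet> (T *v v) = 1 + \<theta> / real (N q) * (v \<bullet> ((\<Sum>j=1..m. Z j \<omega>) *v v))"
        using v(1) by (simp add: T_def matrix_vector_mult_add_rdistrib scaleR_matrix_vector inner_add_right norm_eq_1)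
      moreover have "\<theta> / real (N q) * L \<le> \<theta> / real (N q) * (v \<bullet> ((\<Sum>j=1..m. Z j \<omega>) *v v))"
        using v(2) \<theta> by (intro mult_left_mono) auto
      ultimately have ge: "1 + \<theta> * L / real (N q) \<le> v \<bullet> (T *v v)" by simp
      have p0: "0 \<le> 1 + \<theta> * L / real (N q)" using \<theta> L by simp
      have "(1 + \<theta> * L / real (N q)) ^ N q \<le> (v \<bullet> (T *v v)) ^ N q"
        by (rule power_mono[OF ge p0])
      also have "\<dots> \<le> rtrace (mpow T (N q))"
        unfolding N_def using order_trans[OF p0 ge]
        by (intro form_power_le_rtrace) (auto simp only: T_def Sherm[OF \<omega>] v(1))
      finally show ?thesis by (simp add: f_def T_def)
    qed
    have "prob A * (1 + \<theta> * L / real (N q)) ^ N q = expectation (\<lambda>\<omega>. (1 + \<theta> * L / real (N q)) ^ N q * indicator A \<omega>)"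
      using A by simp
    also have "\<dots> \<le> expectation f"
    proof (rule integral_mono)
      show "integrable M (\<lambda>\<omega>. (1 + \<theta> * L / real (N q)) ^ N q * indicator A \<omega>)"
        using A by (intro integrable_mult_right integrable_real_indicator) (simp_all add: emeasure_eq_measure)
      show "(1 + \<theta> * L / real (N q)) ^ N q * indicator A \<omega> \<le> f \<omega>" if "\<omega> \<in> space M" for \<omega>
        using f0[OF that] fA[of \<omega>] by (cases "\<omega> \<in> A") auto
    qed (rule E)
    finally show ?case using E(2) by simp
  qed
  then have "prob A * exp (\<theta> * L) \<le> real CARD('d) * cosh (\<theta> * sqrt c) ^ m"
    by (intro tendsto_le[OF _ lim1 lim2]) auto
  also have "\<dots> \<le> real CARD('d) * exp ((\<theta> * sqrt c)\<^sup>2 / 2) ^ m"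
    by (intro mult_left_mono power_mono cosh_le_exp_half_square) (auto simp: cosh_real_pos less_imp_le)
  also have "exp ((\<theta> * sqrt c)\<^sup>2 / 2) ^ m = exp (real m * (\<theta>\<^sup>2 * c / 2))"
    using c by (simp add: power_mult_distrib flip: exp_of_nat_mult)
  finally have "prob A \<le> real CARD('d) * exp (real m * (\<theta>\<^sup>2 * c / 2)) / exp (\<theta> * L)"
    by (simp add: pos_le_divide_eq)
  also have "\<dots> = real CARD('d) * exp (real m * (\<theta>\<^sup>2 * c / 2) - \<theta> * L)"
    by (simp add: exp_diff)
  also have "real m * (\<theta>\<^sup>2 * c / 2) - \<theta> * L = - (L\<^sup>2 / (2 * real m * c))"
    using m c by (simp add: \<theta>_def power2_eq_square field_simps)
  finally show ?thesis .
qed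

end

section \<open>Measurability of the recovery event\<close>

text \<open>
  By convention a set that is not measurable has measure zero, so a lower bound for the measure of
  the recovery event includes its measurability.
\<close>

lemma continuous_on_outer: "continuous_on S (\<lambda>y :: 'f::real_or_complex^'d. outer y)"
proof -
  have "bounded_linear (fconj :: 'f \<Rightarrow> 'f)"
    by (intro linear_conv_bounded_linear[THEN iffD1] linearI) (simp_all add: fconj_add fconj_scaleR)
  then show ?thesis
    unfolding outer_def
    by (intro continuous_intros bounded_linear.continuous_on[of fconj])
qed

lemma closed_quadratic_form_ge:
  "closed {S :: 'f::real_or_complex^'d^'d. \<exists>v. norm v = 1 \<and> L \<le> v \<bullet> (S *v v)}"
proof -
  have "closed {p :: ('f^'d) \<times> ('f^'d^'d). L \<le> fst p \<bullet> (snd p *v fst p)}"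
    by (intro closed_Collect_le continuous_intros
        bounded_bilinear.continuous_on[OF bounded_bilinear_matrix_vector])
  from closed_compact_projection[OF compact_sphere[of 0 1] this]
  show ?thesis by (simp add: dist_norm)
qed

lemma pep_maximizer_outer_iff:
  assumes "norm y = 1"
  shows "pep_maximizer Q (outer y) \<longleftrightarrow>
    (\<forall>Z\<in>{Z. psd Z \<and> rtrace Z \<le> 1}. rtrace (Q ** Z) \<le> rtrace (Q ** outer y))"
  using assms by (auto simp: pep_maximizer_def is_arg_max_def psd_outer rtrace_outer not_less)

lemma less_op_norm_iff:
  "K < op_norm A \<longleftrightarrow> (\<exists>v. norm v = 1 \<and> K < norm (A *v v))" for A :: "'f::real_or_complex^'d^'d"
proof
  assume K: "K < op_norm A"
  show "\<exists>v. norm v = 1 \<and> K < norm (A *v v)"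
  proof (rule ccontr)
    assume "\<not> ?thesis"
    then have le: "norm (A *v v) \<le> K" if "norm v = 1" for v using that by (meson not_less)
    have "norm (A *v v) \<le> K * norm v" for v
    proof (cases "v = 0")
      case False
      then have "norm (A *v ((1 / norm v) *\<^sub>R v)) \<le> K" by (intro le) simp
      then show ?thesis using False by (simp add: matrix_vector_scaleR divide_le_eq)
    qed simp
    then have "op_norm A \<le> K" unfolding op_norm_def by (rule onorm_le)
    then show False using K by simp
  qed
next
  assume "\<exists>v. norm v = 1 \<and> K < norm (A *v v)"
  then obtain v where v: "norm v = 1" "K < norm (A *v v)" by auto
  have "norm (A *v v) \<le> op_norm A * norm v"
    unfolding op_norm_def
    by (rule onorm[OF bounded_bilinear.bounded_linear_right[OF bounded_bilinear_matrix_vector]])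
  then show "K < op_norm A" using v by simp
qed

text \<open>
  The matrices for which the program fails form a countable union of projections of closed sets along
  a compact factor, hence a countable union of closed sets.
\<close>

lemma pep_failure_borel:
  fixes X :: "'f::real_or_complex^'d^'d"
  shows "{Q. \<exists>y. norm y = 1 \<and> pep_maximizer Q (outer y) \<and> K < op_norm (outer y - X)} \<in> sets borel"
proof -
  define T where "T = (\<lambda>i :: nat. (\<Inter>Z\<in>{Z :: 'f^'d^'d. psd Z \<and> rtrace Z \<le> 1}.
      {p :: (('f^'d) \<times> ('f^'d)) \<times> ('f^'d^'d). rtrace (snd p ** Z) \<le> rtrace (snd p ** outer (fst (fst p)))})
    \<inter> {p. K + inverse (real (Suc i)) \<le> norm ((outer (fst (fst p)) - X) *v snd (fst p))})"
  have co: "continuous_on UNIV (\<lambda>p :: (('f^'d) \<times> ('f^'d)) \<times> ('f^'d^'d). outer (fst (fst p)))"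
    by (rule continuous_on_compose2[OF continuous_on_outer[of UNIV]]) (auto intro!: continuous_intros)
  have T: "closed (T i)" for i
    unfolding T_def
    by (intro closed_Int closed_INT ballI closed_Collect_le continuous_intros co
        bounded_linear.continuous_on[OF bounded_linear_rtrace]
        bounded_bilinear.continuous_on[OF bounded_bilinear_matrix_mult]
        bounded_bilinear.continuous_on[OF bounded_bilinear_matrix_vector])
  have cpt: "compact (sphere (0 :: 'f^'d) 1 \<times> sphere (0 :: 'f^'d) 1)"
    by (intro compact_Times compact_sphere)
  have "{Q. \<exists>y. norm y = 1 \<and> pep_maximizer Q (outer y) \<and> K < op_norm (outer y - X)} =
    (\<Union>i. {Q. \<exists>p. p \<in> sphere 0 1 \<times> sphere 0 1 \<and> (p, Q) \<in> T i})" (is "?L = ?R")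
  proof (intro set_eqI iffI)
    fix Q assume "Q \<in> ?L"
    then obtain y v where y: "norm y = 1" "pep_maximizer Q (outer y)"
      and v: "norm v = 1" "K < norm ((outer y - X) *v v)"
      unfolding less_op_norm_iff by auto
    obtain i where "inverse (real (Suc i)) < norm ((outer y - X) *v v) - K"
      using reals_Archimedean[of "norm ((outer y - X) *v v) - K"] v by auto
    then have "((y, v), Q) \<in> T i"
      using y unfolding pep_maximizer_outer_iff[OF y(1)] by (auto simp: T_def)
    then show "Q \<in> ?R" using y v by (intro UN_I[of i] CollectI exI[of _ "(y, v)"]) auto
  next
    fix Q assume "Q \<in> ?R"
    then obtain i y v where yv: "norm y = 1" "norm v = 1" "((y, v), Q) \<in> T i"
      by (auto simp: dist_norm)
    have "K < K + inverse (real (Suc i))" by simp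
    also have "\<dots> \<le> norm ((outer y - X) *v v)" using yv(3) by (simp add: T_def)
    finally have "K < op_norm (outer y - X)" unfolding less_op_norm_iff using yv(2) by blast
    moreover have "pep_maximizer Q (outer y)"
      unfolding pep_maximizer_outer_iff[OF yv(1)] using yv(3) by (auto simp: T_def)
    ultimately show "Q \<in> ?L" using yv(1) by blast
  qed
  moreover have "?R \<in> sets borel"
  proof (rule sets.countable_UN'')
    show "{Q. \<exists>p. p \<in> sphere 0 1 \<times> sphere 0 1 \<and> (p, Q) \<in> T i} \<in> sets borel" for i
      by (rule borel_closed[OF closed_compact_projection[OF cpt T]])
  qed simp
  ultimately show ?thesis by simp
qed

lemma bin_question_outer: "bin_question A (outer x) = (if 1/2 \<le> x \<bullet> (A *v x) then 1 else 0)"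
  by (simp add: bin_question_def rtrace_mult_outer)

lemma pep_matrix_bin_measurement:
  "pep_matrix m P (bin_measurement m P (outer x)) = (1 / real m) *\<^sub>R (\<Sum>j=1..m. oriented x (P j))"
proof -
  have "(\<Sum>j=1..m. if bin_measurement m P (outer x) j = 1 then P j else mat 1 - P j) = (\<Sum>j=1..m. oriented x (P j))"
    by (intro sum.cong refl) (auto simp: bin_measurement_def bin_question_outer oriented_def)
  then show ?thesis by (simp only: pep_matrix_def)
qed

section \<open>Uniform recovery from corrupted binary measurements\<close>

theorem corollary2p3p7:
  fixes M :: "'w measure"
    and P :: "nat \<Rightarrow> 'w \<Rightarrow> 'f::real_or_complex^'d^'d"
    and X :: "'f^'d^'d"
    and n m :: nat
    and \<beta> \<delta> \<tau> D :: real
  assumes "1 \<le> n" and "CARD('d) = 2 * n"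
    and "\<beta> = field_beta TYPE('f)"
    and "X \<in> Proj 1"
    and "0 < \<delta>" and "0 < \<tau>" and "\<tau> < 1"
    and "0 < m"
    and "real m \<ge> 14/3 * (1 / (mu1 \<beta> n - mu2 \<beta> n)\<^sup>2) * (1 / \<delta>\<^sup>2) * (ln (4 * real n) + D)"
    and "prob_space M"
    and "prob_space.indep_vars M (\<lambda>_. proj_space n) P {1..m}"
    and "\<And>j. j \<in> {1..m} \<Longrightarrow> uniform_on_Proj n (distr M (proj_space n) (P j))"
  shows "measure M {\<omega> \<in> space M.
           \<forall>b \<in> bitstrings m.
             hamming_dist m (bin_measurement m (\<lambda>j. P j \<omega>) X) b \<le> \<tau> \<longrightarrow>
             (\<forall>Y. pep_solution m (\<lambda>j. P j \<omega>) b Y \<longrightarrow>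
                op_norm (Y - X) \<le> \<delta> + 2 * (1 / (mu1 \<beta> n - mu2 \<beta> n)) * \<tau>)}
         \<ge> 1 - exp (- D)"
proof -
  note n = assms(1) and card = assms(2) and \<beta> = assms(3) and \<delta> = assms(5) and \<tau> = assms(6) and m0 = assms(8)
  interpret prob_space M by (rule assms(10))
  note indep = assms(11)
  have uni: "uniform_projection n (distr M (proj_space n) (P j))" if "j \<in> {1..m}" for j
    using assms(1,2) assms(12)[OF that] by unfold_locales
  obtain x where x: "norm x = 1" and X: "X = outer x"
    using assms(4) unfolding Proj_1_eq by auto
  define \<Delta> where "\<Delta> = mu1 \<beta> n - mu2 \<beta> n"
  have \<Delta>: "\<Delta> > 0" unfolding \<Delta>_def \<beta> by (rule mu_gap_pos[OF n]) (simp add: field_beta_def)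
  \<comment> \<open>the deviation \<open>\<epsilon>\<close> below leads to the exponent \<open>m \<delta>\<^sup>2 \<Delta>\<^sup>2 / (8 c)\<close>, and \<open>8 c = 14/3\<close>\<close>
  define c :: real where "c = 7/12"
  have c: "c > 0" by (simp add: c_def)
  define \<epsilon> where "\<epsilon> = \<delta> * \<Delta> / 2"
  have \<epsilon>: "\<epsilon> > 0" using \<delta> \<Delta> by (simp add: \<epsilon>_def)
  define L where "L = real m * \<epsilon>"
  have L: "L > 0" using m0 \<epsilon> by (simp add: L_def)
  define K where "K = \<delta> + 2 * (1 / \<Delta>) * \<tau>"

  have Pmeas: "P j \<in> M \<rightarrow>\<^sub>M proj_space n" if "j \<in> {1..m}" for j
    using indep that by (auto simp: indep_vars_def)
  have Pborel: "P j \<in> borel_measurable M" if "j \<in> {1..m}" for j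
    using measurable_restrict_space2_iff[THEN iffD1, OF Pmeas[OF that, unfolded proj_space_def]] by blast
  have PProj: "P j \<omega> \<in> Proj n" if "j \<in> {1..m}" "\<omega> \<in> space M" for j \<omega>
    using measurable_space[OF Pmeas[OF that(1)] that(2)] by (simp add: proj_space_def space_restrict_space)
  have PProj': "adjoint_mat (P j \<omega>) = P j \<omega>" "P j \<omega> ** P j \<omega> = P j \<omega>" if "j \<in> {1..m}" "\<omega> \<in> space M" for j \<omega>
    using PProj[OF that] by (auto simp: Proj_iff_rtrace)

  define Z where "Z = (\<lambda>j \<omega>. centered n x (P j \<omega>))"
  have cmeas: "centered n x \<in> proj_space n \<rightarrow>\<^sub>M borel"
    unfolding proj_space_def by (rule measurable_restrict_space1[OF borel_measurable_centered])
  have Zindep: "indep_vars (\<lambda>_. borel) Z {1..m}"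
    unfolding Z_def by (rule indep_vars_compose2[OF indep cmeas])
  have Zherm: "adjoint_mat (Z j \<omega>) = Z j \<omega>" if "j \<in> {1..m}" "\<omega> \<in> space M" for j \<omega>
    unfolding Z_def by (rule uniform_projection.adjoint_centered[OF uni[OF that(1)] PProj[OF that]])
  have Zbd: "(norm (Z j \<omega> *v v))\<^sup>2 \<le> c * (norm v)\<^sup>2" if "j \<in> {1..m}" "\<omega> \<in> space M" for j \<omega> v
    unfolding Z_def c_def by (rule uniform_projection.norm_centered_le[OF uni[OF that(1)] x PProj[OF that]])
  have Zmean: "expectation (\<lambda>\<omega>. Z j \<omega> \<bullet> B) = 0" if "j \<in> {1..m}" "B \<in> Basis" for j B
  proof -
    have "(\<lambda>A. centered n x A \<bullet> B) \<in> borel_measurable (proj_space n)"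
      by (intro borel_measurable_inner cmeas borel_measurable_const)
    then have "expectation (\<lambda>\<omega>. Z j \<omega> \<bullet> B) = (\<integral>A. centered n x A \<bullet> B \<partial>distr M (proj_space n) (P j))"
      unfolding Z_def by (rule integral_distr[OF Pmeas[OF that(1)], symmetric])
    also have "\<dots> = 0"
      by (rule uniform_projection.mean_centered[OF uni[OF that(1)] x that(2)])
    finally show ?thesis .
  qed
  define S where "S = (\<lambda>\<omega>. \<Sum>j=1..m. Z j \<omega>)"
  have Zmeas: "Z j \<in> borel_measurable M" if "j \<in> {1..m}" for j
    using Zindep that by (auto simp: indep_vars_def)
  have Smeas: "S \<in> borel_measurable M"
    unfolding S_def by (intro borel_measurable_sum Zmeas)

  define A where "A = {\<omega> \<in> space M. \<exists>v. norm v = 1 \<and> L \<le> v \<bullet> (S \<omega> *v v)}"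
  define A' where "A' = {\<omega> \<in> space M. \<exists>v. norm v = 1 \<and> L \<le> v \<bullet> ((- S \<omega>) *v v)}"
  have Aev: "A \<in> events"
    using measurable_sets[OF Smeas borel_closed[OF closed_quadratic_form_ge[of L]]]
    by (simp add: A_def vimage_def Int_def conj_commute)
  have Aev': "A' \<in> events"
    using measurable_sets[OF borel_measurable_uminus[OF Smeas] borel_closed[OF closed_quadratic_form_ge[of L]]]
    by (simp add: A'_def vimage_def Int_def conj_commute)
  have prob_A: "prob A \<le> real CARD('d) * exp (- (L\<^sup>2 / (2 * real m * c)))"
    by (rule prob_quadratic_form_ge[OF Zindep Zherm Zbd Zmean c m0 L Aev]) (auto simp: A_def S_def)
  have prob_A': "prob A' \<le> real CARD('d) * exp (- (L\<^sup>2 / (2 * real m * c)))"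
  proof (rule prob_quadratic_form_ge[where Z = "\<lambda>j \<omega>. - Z j \<omega>", OF _ _ _ _ c m0 L Aev'])
    show "indep_vars (\<lambda>_. borel) (\<lambda>j \<omega>. - Z j \<omega>) {1..m}"
      by (rule indep_vars_compose2[OF Zindep]) simp
    show "adjoint_mat (- Z j \<omega>) = - Z j \<omega>" if "j \<in> {1..m}" "\<omega> \<in> space M" for j \<omega>
      using Zherm[OF that] by simp
    show "(norm ((- Z j \<omega>) *v v))\<^sup>2 \<le> c * (norm v)\<^sup>2" if "j \<in> {1..m}" "\<omega> \<in> space M" for j \<omega> v
      using Zbd[OF that, of v] scaleR_matrix_vector[of "-1" "Z j \<omega>" v] by simp
    show "expectation (\<lambda>\<omega>. (- Z j \<omega>) \<bullet> B) = 0" if "j \<in> {1..m}" "B \<in> Basis" for j B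
      using Zmean[OF that] by simp
    show "\<exists>v. norm v = 1 \<and> L \<le> v \<bullet> ((\<Sum>j=1..m. - Z j \<omega>) *v v)" if "\<omega> \<in> A'" for \<omega>
      using that by (simp add: A'_def S_def sum_negf)
  qed

  define G where "G = {\<omega> \<in> space M.
           \<forall>b \<in> bitstrings m.
             hamming_dist m (bin_measurement m (\<lambda>j. P j \<omega>) X) b \<le> \<tau> \<longrightarrow>
             (\<forall>Y. pep_solution m (\<lambda>j. P j \<omega>) b Y \<longrightarrow> op_norm (Y - X) \<le> K)}"
  have Qherm: "adjoint_mat (pep_matrix m (\<lambda>j. P j \<omega>) b) = pep_matrix m (\<lambda>j. P j \<omega>) b" if "\<omega> \<in> space M" for \<omega> b
    using PProj'(1)[OF _ that] by (rule adjoint_pep_matrix)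

  have sub: "space M - (A \<union> A') \<subseteq> G"
  proof
    fix \<omega> assume "\<omega> \<in> space M - (A \<union> A')"
    then have \<omega>: "\<omega> \<in> space M" and nA: "\<omega> \<notin> A" "\<omega> \<notin> A'" by auto
    have Sle: "\<bar>v \<bullet> (S \<omega> *v v)\<bar> \<le> L * (norm v)\<^sup>2" for v
    proof (cases "v = 0")
      case False
      define u where "u = (1 / norm v) *\<^sub>R v"
      have u: "norm u = 1" using False by (simp add: u_def)
      have neg: "u \<bullet> ((- S \<omega>) *v u) = - (u \<bullet> (S \<omega> *v u))"
        using scaleR_matrix_vector[of "-1" "S \<omega>" u] by simp
      have "u \<bullet> (S \<omega> *v u) < L" "- (u \<bullet> (S \<omega> *v u)) < L"
        using nA \<omega> u neg unfolding A_def A'_def by (force simp: not_le)+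
      then have "\<bar>u \<bullet> (S \<omega> *v u)\<bar> \<le> L" by linarith
      moreover have "v \<bullet> (S \<omega> *v v) = (norm v)\<^sup>2 * (u \<bullet> (S \<omega> *v u))"
        using False by (simp add: u_def matrix_vector_scaleR power2_eq_square)
      ultimately have "\<bar>v \<bullet> (S \<omega> *v v)\<bar> = \<bar>u \<bullet> (S \<omega> *v u)\<bar> * (norm v)\<^sup>2"
        by (simp add: abs_mult)
      also have "\<dots> \<le> L * (norm v)\<^sup>2"
        using \<open>\<bar>u \<bullet> (S \<omega> *v u)\<bar> \<le> L\<close> by (rule mult_right_mono) simp
      finally show ?thesis .
    qed simp
    show "\<omega> \<in> G"
      unfolding G_def
    proof (intro CollectI conjI ballI impI allI \<omega>)
      fix b Y assume b: "hamming_dist m (bin_measurement m (\<lambda>j. P j \<omega>) X) b \<le> \<tau>"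
        and sol: "pep_solution m (\<lambda>j. P j \<omega>) b Y"
      define Q where "Q = pep_matrix m (\<lambda>j. P j \<omega>) b"
      define Q0 where "Q0 = pep_matrix m (\<lambda>j. P j \<omega>) (bin_measurement m (\<lambda>j. P j \<omega>) X)"
      have aQ: "adjoint_mat Q = Q" unfolding Q_def by (rule Qherm[OF \<omega>])
      obtain y where y: "norm y = 1" "Y = outer y" and max: "pep_maximizer Q Y"
        using sol unfolding pep_solution_iff[OF Qherm[OF \<omega>]] Q_def by auto
      have Q0: "Q0 - (mu2 \<beta> n *\<^sub>R mat 1 + \<Delta> *\<^sub>R outer x) = (1 / real m) *\<^sub>R S \<omega>"
      proof -
        define W where "W = mu2 \<beta> n *\<^sub>R mat 1 + \<Delta> *\<^sub>R outer x"
        have "Z j \<omega> = oriented x (P j \<omega>) - W" for j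
          by (simp add: Z_def centered_def W_def \<beta> \<Delta>_def)
        then have "S \<omega> = (\<Sum>j=1..m. oriented x (P j \<omega>)) - real m *\<^sub>R W"
          unfolding S_def by (simp only: sum_subtractf sum_constant_scaleR card_atLeastAtMost diff_Suc_1)
        then show ?thesis
          unfolding Q0_def X pep_matrix_bin_measurement W_def[symmetric] using m0
          by (simp add: scaleR_diff_right)
      qed
      have q: "\<bar>v \<bullet> ((Q - (mu2 \<beta> n *\<^sub>R mat 1 + \<Delta> *\<^sub>R outer x)) *v v)\<bar> \<le> (\<tau> + \<epsilon>) * (norm v)\<^sup>2" for v
      proof -
        have "Q - (mu2 \<beta> n *\<^sub>R mat 1 + \<Delta> *\<^sub>R outer x) = (Q - Q0) + (1 / real m) *\<^sub>R S \<omega>"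
          unfolding Q0[symmetric] by simp
        then have "v \<bullet> ((Q - (mu2 \<beta> n *\<^sub>R mat 1 + \<Delta> *\<^sub>R outer x)) *v v) =
            v \<bullet> ((Q - Q0) *v v) + (1 / real m) * (v \<bullet> (S \<omega> *v v))"
          by (simp only: matrix_vector_mult_add_rdistrib scaleR_matrix_vector inner_add_right inner_scaleR_right)
        moreover have "\<bar>v \<bullet> ((Q - Q0) *v v)\<bar> \<le> \<tau> * (norm v)\<^sup>2"
        proof -
          have "\<bar>v \<bullet> ((Q - Q0) *v v)\<bar> \<le> hamming_dist m (bin_measurement m (\<lambda>j. P j \<omega>) X) b * (norm v)\<^sup>2"
            unfolding Q_def Q0_def by (rule pep_matrix_flip) (use PProj'[OF _ \<omega>] in blast)
          also have "\<dots> \<le> \<tau> * (norm v)\<^sup>2" by (rule mult_right_mono[OF b]) simp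
          finally show ?thesis .
        qed
        moreover have "\<bar>(1 / real m) * (v \<bullet> (S \<omega> *v v))\<bar> \<le> \<epsilon> * (norm v)\<^sup>2"
        proof -
          have "(1 / real m) * \<bar>v \<bullet> (S \<omega> *v v)\<bar> \<le> (1 / real m) * (L * (norm v)\<^sup>2)"
            by (rule mult_left_mono[OF Sle]) simp
          then show ?thesis using m0 by (simp add: abs_mult L_def)
        qed
        ultimately show ?thesis unfolding distrib_right by linarith
      qed
      have "op_norm (outer y - outer x) \<le> 2 * (\<tau> + \<epsilon>) / \<Delta>"
        by (rule recovery_error[OF x y(1) \<Delta> aQ q]) (use pep_maximizer_outer_le[OF max x] y in simp)
      also have "\<dots> = K" using \<Delta> by (simp add: K_def \<epsilon>_def field_simps)
      finally show "op_norm (Y - X) \<le> K" by (simp add: y X)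
    qed
  qed

  have Gev: "G \<in> events"
    unfolding G_def
  proof (intro sets.sets_Collect_finite_All sets.sets_Collect_imp)
    show "finite (bitstrings m)" by (simp add: bitstrings_def finite_PiE)
  next
    fix b
    define f where "f = (\<lambda>\<omega>. (\<Sum>j=1..m. if bin_question (P j \<omega>) X \<noteq> b j then 1 else 0) / real m)"
    have ham: "hamming_dist m (bin_measurement m (\<lambda>j. P j \<omega>) X) b = f \<omega>" for \<omega>
    proof -
      have "{j \<in> {1..m}. bin_measurement m (\<lambda>j. P j \<omega>) X j \<noteq> b j} = {1..m} \<inter> {j. bin_question (P j \<omega>) X \<noteq> b j}"
        by (auto simp: bin_measurement_def)
      then show ?thesis by (simp add: f_def hamming_dist_def sum.If_cases)
    qed
    have "(\<lambda>\<omega>. if bin_question (P j \<omega>) X \<noteq> b j then 1 else 0 :: real) \<in> borel_measurable M" if "j \<in> {1..m}" for j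
    proof -
      have [measurable]: "P j \<in> borel_measurable M" by (rule Pborel[OF that])
      show ?thesis unfolding bin_question_def by measurable
    qed
    then have "f \<in> borel_measurable M"
      unfolding f_def by (intro borel_measurable_divide borel_measurable_sum borel_measurable_const)
    then have "{\<omega> \<in> space M. f \<omega> \<le> \<tau>} \<in> events" by measurable
    then show "{\<omega> \<in> space M. hamming_dist m (bin_measurement m (\<lambda>j. P j \<omega>) X) b \<le> \<tau>} \<in> events"
      by (simp only: ham)
  next
    fix b
    define Bad where "Bad = {Q. \<exists>y. norm y = 1 \<and> pep_maximizer Q (outer y) \<and> K < op_norm (outer y - X)}"
    have Bad: "Bad \<in> sets borel" unfolding Bad_def by (rule pep_failure_borel)
    have Qmeas: "(\<lambda>\<omega>. pep_matrix m (\<lambda>j. P j \<omega>) b) \<in> borel_measurable M"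
    proof -
      have "(\<lambda>\<omega>. if b j = 1 then P j \<omega> else mat 1 - P j \<omega>) \<in> borel_measurable M" if "j \<in> {1..m}" for j
        using Pborel[OF that] by (cases "b j = 1") simp_all
      then show ?thesis unfolding pep_matrix_def by (intro borel_measurable_scaleR borel_measurable_sum borel_measurable_const)
    qed
    have "{\<omega> \<in> space M. \<forall>Y. pep_solution m (\<lambda>j. P j \<omega>) b Y \<longrightarrow> op_norm (Y - X) \<le> K} =
        space M - ((\<lambda>\<omega>. pep_matrix m (\<lambda>j. P j \<omega>) b) -` Bad \<inter> space M)"
      using pep_solution_iff[OF Qherm] by (auto simp: Bad_def not_less[symmetric])
    also have "\<dots> \<in> events" using measurable_sets[OF Qmeas Bad] by auto
    finally show "{\<omega> \<in> space M. \<forall>Y. pep_solution m (\<lambda>j. P j \<omega>) b Y \<longrightarrow> op_norm (Y - X) \<le> K} \<in> events" .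
  qed

  have expo: "ln (4 * real n) + D \<le> L\<^sup>2 / (2 * real m * c)"
  proof -
    define W where "W = ln (4 * real n) + D"
    have "14/3 * (1 / \<Delta>\<^sup>2) * (1 / \<delta>\<^sup>2) * W \<le> real m" using assms(9) by (simp add: W_def \<Delta>_def)
    then have "(3/14 * \<Delta>\<^sup>2 * \<delta>\<^sup>2) * (14/3 * (1 / \<Delta>\<^sup>2) * (1 / \<delta>\<^sup>2) * W) \<le> (3/14 * \<Delta>\<^sup>2 * \<delta>\<^sup>2) * real m"
      by (intro mult_left_mono) auto
    also have "(3/14 * \<Delta>\<^sup>2 * \<delta>\<^sup>2) * (14/3 * (1 / \<Delta>\<^sup>2) * (1 / \<delta>\<^sup>2) * W) = W"
      using \<Delta> \<delta> by simp
    also have "(3/14 * \<Delta>\<^sup>2 * \<delta>\<^sup>2) * real m = L\<^sup>2 / (2 * real m * c)"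
      using m0 by (simp add: L_def \<epsilon>_def c_def power2_eq_square field_simps)
    finally show ?thesis by (simp add: W_def)
  qed
  have "prob A + prob A' \<le> 4 * real n * exp (- (L\<^sup>2 / (2 * real m * c)))"
    using prob_A prob_A' by (simp add: card)
  also have "\<dots> \<le> 4 * real n * exp (- (ln (4 * real n) + D))"
    using expo by (intro mult_left_mono) auto
  also have "\<dots> = exp (- D)"
    using n by (simp add: exp_add exp_minus exp_diff field_simps)
  finally have AA: "prob A + prob A' \<le> exp (- D)" .
  have "1 - exp (- D) \<le> 1 - prob (A \<union> A')"
    using AA measure_Un_le[OF Aev Aev'] by linarith
  also have "\<dots> = prob (space M - (A \<union> A'))"
    using Aev Aev' by (intro prob_compl[symmetric]) auto
  also have "\<dots> \<le> prob G"
    by (rule finite_measure_mono[OF sub Gev])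
  finally show ?thesis by (simp only: G_def K_def \<Delta>_def)
qed

end
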